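(* Let $s\in(0,1)$, $n>2s$, let $\Omega$ be an open bounded subset of $\mathbb{R}^n$ with Lipschitz boundary, and let $K:\mathbb{R}^n\setminus\{0\}\to(0,+\infty)$ be a function such that: (i) $\gamma K\in L^1(\mathbb{R}^n)$, where $\gamma(x):=\min\{|x|^2,1\}$; (ii) there exists $\beta>0$ such that $K(x)\ge\beta|x|^{-(n+2s)}$ for every $x\in\mathbb{R}^n\setminus\{0\}$; (iii) $K(x)=K(-x)$ for every $x\in\mathbb{R}^n\setminus\{0\}$. Let $f\in\mathcal{A}$ and $F(x,\xi):=\int_0^\xi f(x,t)\,dt$, and assume that $$\sup_{(x,\xi)\in\Omega\times\mathbb{R}}|F(x,\xi)|<+\infty\qquad\text{and}\qquad \sup_{u\in X_0}\left|\int_\Omega F(x,u(x))\,dx\right|>0 .$$ Then, for every $M\in\mathcal{M}$, for every continuous non-decreasing function $h:(-\omega_f,\omega_f)\to\mathbb{R}$ with $h^{-1}(0)=\{0\}$, and for every $$\mu>\inf_{u\in\mathcal{R}}\left\{\frac{\widehat{M}(\|u\|_{X_0}^2)}{2H\left(\int_\Omega F(x,u(x))\,dx\right)}\right\},$$ there exist a non-empty open interval $\Lambda\subseteq(\alpha_f,\beta_f)$ and a number $\rho>0$ such that, for each $\lambda\in\Lambda$, the problem $$\begin{cases}-M(\|u\|_{X_0}^2)\,\mathcal{L}_K u=\mu\, h\left(\displaystyle\int_\Omega\left(\int_0^{u(x)}f(x,t)\,dt\right)dx-\lambda\right)f(x,u)&\text{in }\Omega,\\ u=0&\text{in }\mathbb{R}^n\setminus\Omega\end{cases}$$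 has at least three distinct weak solutions whose norms in $X_0$ are less than $\rho$.
   Context: **Operator.** $\mathcal{L}_K u(x):=\int_{\mathbb{R}^n}\big(u(x+y)+u(x-y)-2u(x)\big)K(y)\,dy$ for $x\in\mathbb{R}^n$. **Function space.** Let $\mathcal{C}\Omega:=\mathbb{R}^n\setminus\Omega$ and $Q:=(\mathbb{R}^n\times\mathbb{R}^n)\setminus(\mathcal{C}\Omega\times\mathcal{C}\Omega)$. $X$ is the linear space of Lebesgue measurable functions $g:\mathbb{R}^n\to\mathbb{R}$ such that $g|_\Omega\in L^2(\Omega)$ and the map $(x,y)\mapsto(g(x)-g(y))\sqrt{K(x-y)}$ belongs to $L^2(Q,dx\,dy)$. Put $X_0:=\{g\in X: g=0\text{ a.e. in }\mathbb{R}^n\setminus\Omega\}$ (functions identified when equal a.e.), with norm $$\|u\|_{X_0}:=\left(\int_Q|u(x)-u(y)|^2K(x-y)\,dx\,dy\right)^{1/2};$$ the integral may equivalently be taken over $\mathbb{R}^n\times\mathbb{R}^n$. **Class $\mathcal{A}$.** With $2^*:=2n/(n-2s)$, $\mathcal{A}$ is the class of all Carathéodory functions $f:\Omega\times\mathbb{R}\to\mathbb{R}$ such that $\sup_{(x,t)\in\Omega\times\mathbb{R}}\frac{|f(x,t)|}{1+|t|^{q-1}}<+\infty$ for some $q\in[1,2^* )$. **Class $\mathcal{M}$.** $\mathcal{M}$ is the class of continuous functions $M:[0,+\infty)\to\mathbb{R}$ such that $\inf_{t\ge0}M(t)>0$ and there exists a continuous function $v_M:[0,+\infty)\to\mathbb{R}$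 with $v_M(tM(t^2))=t$ for every $t\in[0,+\infty)$. For $M\in\mathcal{M}$, $\widehat{M}(t):=\int_0^tM(\tau)\,d\tau$ for $t\ge0$. **Further notation.** $H(\xi):=\int_0^\xi h(t)\,dt$ for $\xi$ in the domain of $h$; $$\alpha_f:=\inf_{u\in X_0}\int_\Omega F(x,u(x))\,dx,\quad \beta_f:=\sup_{u\in X_0}\int_\Omega F(x,u(x))\,dx,\quad \omega_f:=\beta_f-\alpha_f,$$ $$\mathcal{R}:=\left\{u\in X_0:\ \int_\Omega F(x,u(x))\,dx\in(\alpha_f,\beta_f)\setminus\{0\}\right\}.$$ **Weak solution.** A weak solution of the problem is a function $u\in X_0$ such that $$M(\|u\|_{X_0}^2)\int_Q(u(x)-u(y))(\varphi(x)-\varphi(y))K(x-y)\,dx\,dy=\mu\,h\left(\int_\Omega F(x,u(x))\,dx-\lambda\right)\int_\Omega f(x,u(x))\varphi(x)\,dx$$ for every $\varphi\in X_0$. *)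

theory Defs
  imports "HOL-Analysis.Analysis"
begin

(* Near each boundary point U is the strict epigraph, in the direction of a unit vector e,
   of a Lipschitz function on the hyperplane orthogonal to e (which is {0} in dimension 1). *)
definition lipschitz_boundary :: "'a::euclidean_space set \<Rightarrow> bool" where
  "lipschitz_boundary U \<longleftrightarrow>
     (\<forall>p\<in>frontier U. \<exists>e r L \<phi>. norm e = 1 \<and> r > 0 \<and> L-lipschitz_on {y. y \<bullet> e = 0} \<phi> \<and>
        (\<forall>x\<in>ball p r. x \<in> U \<longleftrightarrow> \<phi> (x - (x \<bullet> e) *\<^sub>R e) < x \<bullet> e))"

definition square_integrable_on :: "('a::euclidean_space \<Rightarrow> real) \<Rightarrow> 'a set \<Rightarrow> bool"
    (infix "square'_integrable'_on" 50) where
  "g square_integrable_on A \<longleftrightarrow>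
     set_borel_measurable lebesgue A g \<and> set_integrable lebesgue A (\<lambda>x. (g x)\<^sup>2)"

definition prim :: "(real \<Rightarrow> real) \<Rightarrow> real \<Rightarrow> real" where
  "prim g \<xi> = (LBINT t=0..ereal \<xi>. g t)"

definition Q_set :: "'a set \<Rightarrow> ('a \<times> 'a) set" where
  "Q_set \<Omega> = UNIV - (- \<Omega>) \<times> (- \<Omega>)"

(* K is a function on the space minus the origin; here and below its value at 0 is irrelevant,
   because it is always multiplied by 0 on the diagonal. Elements of X and X0 are functions,
   not classes: identification a.e. is made explicit where distinctness matters. *)
definition space_X :: "(real^'n \<Rightarrow> real) \<Rightarrow> (real^'n) set \<Rightarrow> (real^'n \<Rightarrow> real) set" where
  "space_X K \<Omega> =
     {g. g \<in> borel_measurable lebesgue \<and> g square_integrable_on \<Omega> \<and>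
         (\<lambda>(x, y). (g x - g y) * sqrt (K (x - y))) square_integrable_on Q_set \<Omega>}"

definition space_X0 :: "(real^'n \<Rightarrow> real) \<Rightarrow> (real^'n) set \<Rightarrow> (real^'n \<Rightarrow> real) set" where
  "space_X0 K \<Omega> = {g \<in> space_X K \<Omega>. AE x in lebesgue. x \<notin> \<Omega> \<longrightarrow> g x = 0}"

definition norm_X0 :: "(real^'n \<Rightarrow> real) \<Rightarrow> (real^'n) set \<Rightarrow> (real^'n \<Rightarrow> real) \<Rightarrow> real" where
  "norm_X0 K \<Omega> u =
     sqrt (set_lebesgue_integral lebesgue (Q_set \<Omega>) (\<lambda>(x, y). \<bar>u x - u y\<bar>\<^sup>2 * K (x - y)))"

definition caratheodory :: "(real^'n) set \<Rightarrow> (real^'n \<Rightarrow> real \<Rightarrow> real) \<Rightarrow> bool" where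
  "caratheodory \<Omega> f \<longleftrightarrow>
     (\<forall>t. (\<lambda>x. f x t) \<in> borel_measurable (lebesgue_on \<Omega>)) \<and>
     (AE x in lebesgue_on \<Omega>. continuous_on UNIV (f x))"

(* Since 0 powr 0 = 0, for q = 1 the denominator at t = 0 is 1 rather than 2, which does not
   affect the finiteness of the supremum. *)
definition class_A :: "real \<Rightarrow> (real^'n) set \<Rightarrow> (real^'n \<Rightarrow> real \<Rightarrow> real) set" where
  "class_A s \<Omega> =
     {f. caratheodory \<Omega> f \<and>
         (\<exists>q. 1 \<le> q \<and> q < 2 * real CARD('n) / (real CARD('n) - 2 * s) \<and>
              (SUP (x, t)\<in>\<Omega> \<times> UNIV. ereal (\<bar>f x t\<bar> / (1 + \<bar>t\<bar> powr (q - 1)))) < \<infinity>)}"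

definition class_M :: "(real \<Rightarrow> real) set" where
  "class_M =
     {M. continuous_on {0..} M \<and> (INF t\<in>{0..}. ereal (M t)) > 0 \<and>
         (\<exists>v. continuous_on {0..} v \<and> (\<forall>t\<ge>0. v (t * M (t\<^sup>2)) = t))}"

definition potential :: "(real^'n) set \<Rightarrow> (real^'n \<Rightarrow> real \<Rightarrow> real) \<Rightarrow> (real^'n \<Rightarrow> real) \<Rightarrow> real" where
  "potential \<Omega> f u = (LINT x:\<Omega>|lebesgue. prim (f x) (u x))"

definition alpha ::
    "(real^'n \<Rightarrow> real) \<Rightarrow> (real^'n) set \<Rightarrow> (real^'n \<Rightarrow> real \<Rightarrow> real) \<Rightarrow> real" where
  "alpha K \<Omega> f = (INF u\<in>space_X0 K \<Omega>. potential \<Omega> f u)"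

definition beta ::
    "(real^'n \<Rightarrow> real) \<Rightarrow> (real^'n) set \<Rightarrow> (real^'n \<Rightarrow> real \<Rightarrow> real) \<Rightarrow> real" where
  "beta K \<Omega> f = (SUP u\<in>space_X0 K \<Omega>. potential \<Omega> f u)"

definition omega ::
    "(real^'n \<Rightarrow> real) \<Rightarrow> (real^'n) set \<Rightarrow> (real^'n \<Rightarrow> real \<Rightarrow> real) \<Rightarrow> real" where
  "omega K \<Omega> f = beta K \<Omega> f - alpha K \<Omega> f"

definition R_set ::
    "(real^'n \<Rightarrow> real) \<Rightarrow> (real^'n) set \<Rightarrow> (real^'n \<Rightarrow> real \<Rightarrow> real) \<Rightarrow> (real^'n \<Rightarrow> real) set" where
  "R_set K \<Omega> f =
     {u \<in> space_X0 K \<Omega>. potential \<Omega> f u \<in> {alpha K \<Omega> f<..<beta K \<Omega> f} - {0}}"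

definition weak_solution ::
    "(real^'n \<Rightarrow> real) \<Rightarrow> (real^'n) set \<Rightarrow> (real^'n \<Rightarrow> real \<Rightarrow> real) \<Rightarrow>
     (real \<Rightarrow> real) \<Rightarrow> (real \<Rightarrow> real) \<Rightarrow> real \<Rightarrow> real \<Rightarrow> (real^'n \<Rightarrow> real) \<Rightarrow> bool" where
  "weak_solution K \<Omega> f M h \<mu> l u \<longleftrightarrow>
     u \<in> space_X0 K \<Omega> \<and>
     (\<forall>\<phi>\<in>space_X0 K \<Omega>.
        M ((norm_X0 K \<Omega> u)\<^sup>2) *
          set_lebesgue_integral lebesgue (Q_set \<Omega>)
            (\<lambda>(x, y). (u x - u y) * (\<phi> x - \<phi> y) * K (x - y)) =
        \<mu> * h (potential \<Omega> f u - l) * (LINT x:\<Omega>|lebesgue. f x (u x) * \<phi> x))"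

end

theory Submission
  imports Defs "HOL-Library.Function_Algebras" "HOL-Library.Diagonal_Subsequence"
begin

text \<open>
  Write \<open>J u\<close> for the integral of \<open>F(x, u(x))\<close> and
  \<open>\<Phi>\<^sub>l u = M^(\<parallel>u\<parallel>\<^sup>2) / 2 - \<mu> H(J u - l)\<close>, where \<open>M^\<close> and \<open>H\<close> are the primitives of
  \<open>M\<close> and \<open>h\<close>; its critical points are the weak solutions. On the wall \<open>J u = l\<close> the second term
  vanishes, so \<open>\<Phi>\<^sub>l \<ge> 0\<close> there. Since \<open>H > 0\<close> off \<open>0\<close>, the function \<open>0\<close> has \<open>\<Phi>\<^sub>l 0 < 0\<close> for \<open>l \<noteq> 0\<close>, and
  the hypothesis on \<open>\<mu>\<close> gives a \<open>u0\<close> with \<open>\<Phi>\<^sub>l u0 < 0\<close> for all small \<open>l\<close>. If \<open>l\<close> lies strictly between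
  \<open>0\<close> and \<open>J u0\<close> and is small, then \<open>\<Phi>\<^sub>l\<close> takes negative values on both sides of the wall. Minimising
  over \<open>J u \<le> l\<close> and over \<open>J u \<ge> l\<close> yields two interior minimisers, that is, two critical points with
  \<open>\<Phi>\<^sub>l < 0\<close>. Every path joining them crosses the wall, hence the mountain pass theorem yields a third
  critical point, with \<open>\<Phi>\<^sub>l \<ge> 0\<close>. Coercivity bounds all three uniformly in \<open>l\<close>.

  The required compactness is that of the embedding of \<open>X\<^sub>0\<close> into the subcritical Lebesgue spaces. It is
  obtained from the fractional Sobolev inequality and from a Poincare inequality on small cubes.
\<close>

section \<open>The mountain pass theorem\<close>

text \<open>Elements of X0 are functions, not classes, so the form is only semidefinite. The Hilbert
  space arguments are therefore carried out modulo vectors of seminorm 0, and distinctness is read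
  off at the end from \<open>J\<close> and \<Phi>, which do not see null sets. The obstacle to
  compactness is the coefficient M(N(u)^2), which is not continuous under weak convergence. Passing
  to a subsequence whose norms converge to some \<nu>, possibly larger than the norm of the limit,
  removes it: the gradient is then asymptotically M(\<nu>^2) times the sequence minus a fixed
  vector. Since M is bounded away from 0, this one description yields bounded gradients, their
  uniform continuity on bounded sets and the Palais-Smale condition. The uniform bound on the
  solutions needs H to be bounded, although h lives on an open interval at whose ends H may blow up.
  It is bounded where it is evaluated, because J u - l stays in a compact part of that interval as
  long as l stays away from \<alpha> and \<beta>.\<close>

lemma tendsto_of_abs_diff_le:
  fixes f :: "'a \<Rightarrow> real"
  assumes "\<forall>\<^sub>F k in F. \<bar>f k - l\<bar> \<le> g k" "(g \<longlongrightarrow> 0) F"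
  shows "(f \<longlongrightarrow> l) F"
  by (rule LIM_zero_cancel, rule Lim_null_comparison[OF _ assms(2)]) (use assms(1) in simp)

text \<open>The carrier is a set, because the space depends on \<open>K\<close> and \<Omega>. The
  form may be degenerate: \<open>N u = 0\<close> does not give \<open>u = 0\<close>.\<close>

locale semi_inner_space =
  fixes V :: "'v::real_vector set" and B :: "'v \<Rightarrow> 'v \<Rightarrow> real" and N :: "'v \<Rightarrow> real"
  assumes subspace: "subspace V"
    and B_sym: "\<And>u v. u \<in> V \<Longrightarrow> v \<in> V \<Longrightarrow> B u v = B v u"
    and B_add: "\<And>u v w. u \<in> V \<Longrightarrow> v \<in> V \<Longrightarrow> w \<in> V \<Longrightarrow> B (u + v) w = B u w + B v w"
    and B_scale: "\<And>c u v. u \<in> V \<Longrightarrow> v \<in> V \<Longrightarrow> B (c *\<^sub>R u) v = c * B u v"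
    and B_nonneg: "\<And>u. u \<in> V \<Longrightarrow> 0 \<le> B u u"
    and N_def: "\<And>u. u \<in> V \<Longrightarrow> N u = sqrt (B u u)"
begin

lemma V_0 [simp]: "0 \<in> V" using subspace by (rule subspace_0)
lemma V_add [simp]: "u \<in> V \<Longrightarrow> v \<in> V \<Longrightarrow> u + v \<in> V" using subspace by (rule subspace_add)
lemma V_diff [simp]: "u \<in> V \<Longrightarrow> v \<in> V \<Longrightarrow> u - v \<in> V" using subspace by (rule subspace_diff)
lemma V_scale [simp]: "u \<in> V \<Longrightarrow> c *\<^sub>R u \<in> V" using subspace by (rule subspace_scale)
lemma V_minus [simp]: "u \<in> V \<Longrightarrow> - u \<in> V" using subspace by (rule subspace_neg)

lemma B_add_right: "u \<in> V \<Longrightarrow> v \<in> V \<Longrightarrow> w \<in> V \<Longrightarrow> B w (u + v) = B w u + B w v"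
  using B_add[of u v w] by (simp add: B_sym)
lemma B_scale_right: "u \<in> V \<Longrightarrow> v \<in> V \<Longrightarrow> B v (c *\<^sub>R u) = c * B v u"
  using B_scale[of u v c] by (simp add: B_sym)
lemma B_minus: "u \<in> V \<Longrightarrow> v \<in> V \<Longrightarrow> B (- u) v = - B u v"
  using B_scale[of u v "-1"] by simp
lemma B_minus_right: "u \<in> V \<Longrightarrow> v \<in> V \<Longrightarrow> B v (- u) = - B v u"
  using B_scale_right[of u v "-1"] by simp
lemma B_diff: "u \<in> V \<Longrightarrow> v \<in> V \<Longrightarrow> w \<in> V \<Longrightarrow> B (u - v) w = B u w - B v w"
  using B_add[of u "- v" w] by (simp add: B_minus)
lemma B_diff_right: "u \<in> V \<Longrightarrow> v \<in> V \<Longrightarrow> w \<in> V \<Longrightarrow> B w (u - v) = B w u - B w v"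
  using B_add_right[of u "- v" w] by (simp add: B_minus_right)

lemmas B_simps = B_add B_add_right B_scale B_scale_right B_minus B_minus_right B_diff B_diff_right

lemma N_sq: "u \<in> V \<Longrightarrow> (N u)\<^sup>2 = B u u" by (simp add: N_def B_nonneg)
lemma N_nonneg [simp]: "u \<in> V \<Longrightarrow> 0 \<le> N u" by (simp add: N_def B_nonneg)

lemma N_scale: "u \<in> V \<Longrightarrow> N (c *\<^sub>R u) = \<bar>c\<bar> * N u"
  by (simp add: N_def B_simps real_sqrt_mult flip: mult.assoc)
lemma N_minus: "u \<in> V \<Longrightarrow> N (- u) = N u"
  using N_scale[of u "-1"] by simp
lemma N_0 [simp]: "N 0 = 0" using N_scale[of 0 0] by simp
lemma N_diff_commute: "u \<in> V \<Longrightarrow> v \<in> V \<Longrightarrow> N (u - v) = N (v - u)"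
  using N_minus[of "u - v"] by simp

text \<open>Division by \<open>N u\<close> is impossible for null vectors. For these the nonnegative
  polynomial \<open>q\<close> in \<open>t\<close> is affine, so its slope, a multiple of
  \<open>B u v\<close>, vanishes.\<close>

lemma Cauchy_Schwarz:
  assumes "u \<in> V" "v \<in> V" shows "\<bar>B u v\<bar> \<le> N u * N v"
proof -
  have q: "0 \<le> (N u)\<^sup>2 * t\<^sup>2 + 2 * t * B u v + (N v)\<^sup>2" for t
    using B_nonneg[of "t *\<^sub>R u + v"] assms
    by (simp add: N_sq) (simp add: B_simps B_sym[of v u] power2_eq_square algebra_simps)
  have "(B u v)\<^sup>2 \<le> (N u)\<^sup>2 * (N v)\<^sup>2"
  proof (cases "N u = 0")
    case True
    have "B u v = 0"
    proof (rule ccontr)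
      assume "B u v \<noteq> 0"
      \<comment> \<open>At this \<open>t\<close> the affine polynomial takes the value -1.\<close>
      with q[of "- ((N v)\<^sup>2 + 1) / (2 * B u v)"] True show False by (simp add: field_simps)
    qed
    then show ?thesis by simp
  next
    case False
    define n where "n = (N u)\<^sup>2"
    have "0 < n" using False by (simp add: n_def)
    \<comment> \<open>The minimiser of the quadratic is \<open>- B u v / n\<close>; its value there
      is the discriminant inequality.\<close>
    then have "n * (- B u v / n)\<^sup>2 + 2 * (- B u v / n) * B u v = - ((B u v)\<^sup>2 / n)"
      by (simp add: power2_eq_square field_simps)
    with q[of "- B u v / n"] have "(B u v)\<^sup>2 / n \<le> (N v)\<^sup>2" by (simp add: n_def)
    then show ?thesis using \<open>0 < n\<close> by (simp add: n_def field_simps)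
  qed
  then have "\<bar>B u v\<bar> \<le> \<bar>N u * N v\<bar>" by (intro abs_le_square_iff[THEN iffD2]) (simp add: power_mult_distrib)
  then show ?thesis using assms by (simp add: abs_mult)
qed

lemma N_add_sq: "u \<in> V \<Longrightarrow> v \<in> V \<Longrightarrow> (N (u + v))\<^sup>2 = (N u)\<^sup>2 + 2 * B u v + (N v)\<^sup>2"
  by (simp add: N_sq B_simps B_sym[of v u])

lemma N_triangle: assumes "u \<in> V" "v \<in> V" shows "N (u + v) \<le> N u + N v"
proof (rule power2_le_imp_le)
  show "(N (u + v))\<^sup>2 \<le> (N u + N v)\<^sup>2"
    using assms Cauchy_Schwarz[of u v]
    by (simp add: N_sq B_simps B_sym[of v u] power2_sum)
qed (use assms in auto)

lemma N_triangle_diff: assumes "u \<in> V" "v \<in> V" shows "N (u - v) \<le> N u + N v"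
  using N_triangle[of u "- v"] assms by (simp add: N_minus)

lemma N_diff_abs: assumes "u \<in> V" "v \<in> V" shows "\<bar>N u - N v\<bar> \<le> N (u - v)"
  using N_triangle[of "u - v" v] N_triangle[of "v - u" u] assms N_diff_commute[of u v] by simp

lemma N_tendsto:
  assumes "\<And>k. X k \<in> V" "u \<in> V" "((\<lambda>k. N (X k - u)) \<longlongrightarrow> 0) F"
  shows "((\<lambda>k. N (X k)) \<longlongrightarrow> N u) F"
  by (rule tendsto_of_abs_diff_le[OF always_eventually assms(3)]) (auto intro: N_diff_abs assms)

lemma Cauchy_bounded:
  fixes X :: "nat \<Rightarrow> 'v"
  assumes X: "\<And>k. X k \<in> V" and "\<And>e. e > 0 \<Longrightarrow> \<exists>n0. \<forall>m\<ge>n0. \<forall>n\<ge>n0. N (X m - X n) < e"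
  shows "\<exists>R. \<forall>k. N (X k) \<le> R"
proof -
  obtain n0 where n0: "\<And>m n. m \<ge> n0 \<Longrightarrow> n \<ge> n0 \<Longrightarrow> N (X m - X n) < 1" using assms(2)[of 1] by auto
  have "N (X k) \<le> (\<Sum>j<n0. N (X j)) + (N (X n0) + 1)" for k
  proof (cases "k < n0")
    case True
    then have "N (X k) \<le> (\<Sum>j<n0. N (X j))" using X by (intro member_le_sum) auto
    then show ?thesis using N_nonneg[OF X[of n0]] by simp
  next
    case False
    then have "N (X k) \<le> N (X n0) + 1" using n0[of k n0] N_diff_abs[OF X[of k] X[of n0]] by simp
    moreover have "0 \<le> (\<Sum>j<n0. N (X j))" using X by (intro sum_nonneg) auto
    ultimately show ?thesis by simp
  qed
  then show ?thesis by blast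
qed

text \<open>Growth estimates are not homogeneous and give a bound on the unit ball only; scaling
  extends it. Null vectors cannot be normalised, but all their multiples lie in the unit ball, which
  forces \<open>L u = 0\<close>.\<close>

lemma homogeneous_bound:
  assumes scale: "\<And>c u. u \<in> V \<Longrightarrow> L (c *\<^sub>R u) = c * L u"
    and unit: "\<And>u. u \<in> V \<Longrightarrow> N u \<le> 1 \<Longrightarrow> \<bar>L u\<bar> \<le> c" and u: "u \<in> V"
  shows "\<bar>L u\<bar> \<le> c * N u"
proof (cases "N u = 0")
  case True
  have "\<bar>L u\<bar> \<le> 0"
  proof (rule ccontr)
    assume "\<not> ?thesis"
    then have pos: "\<bar>L u\<bar> > 0" by simp
    \<comment> \<open>The multiple is chosen so that \<open>L\<close> takes a value of modulus
      \<open>\<bar>c + 1\<bar>\<close>, which exceeds \<open>c\<close>.\<close>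
    have "\<bar>L (((c + 1) / \<bar>L u\<bar>) *\<^sub>R u)\<bar> \<le> c"
      using u True by (intro unit) (simp_all add: N_scale)
    moreover have "\<bar>L (((c + 1) / \<bar>L u\<bar>) *\<^sub>R u)\<bar> = \<bar>c + 1\<bar>"
      using pos by (simp add: scale[OF u] abs_mult)
    ultimately show False by linarith
  qed
  then show ?thesis using True by simp
next
  case False
  then have pos: "N u > 0" using N_nonneg[OF u] by simp
  have "\<bar>L ((1 / N u) *\<^sub>R u)\<bar> \<le> c" using u pos by (intro unit) (simp_all add: N_scale)
  then have "\<bar>L u\<bar> / N u \<le> c" using pos by (simp add: scale[OF u] abs_mult)
  then show ?thesis using pos by (simp add: pos_divide_le_eq)
qed

end

section \<open>Complete semi-inner product spaces and the Riesz representation\<close>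

locale semi_hilbert = semi_inner_space +
  assumes complete: "\<And>X. (\<And>k::nat. X k \<in> V) \<Longrightarrow>
          (\<And>e. e > 0 \<Longrightarrow> \<exists>n0. \<forall>m\<ge>n0. \<forall>n\<ge>n0. N (X m - X n) < e) \<Longrightarrow>
          \<exists>u\<in>V. (\<lambda>k. N (X k - u)) \<longlonglongrightarrow> 0"
begin

text \<open>The representative is the minimiser of the quadratic functional \<open>q\<close>.
  Convexity in the form of the parallelogram law makes minimising sequences Cauchy, and the first
  variation at the minimiser is the required identity. Neither kernels nor orthogonal complements
  are needed, so null vectors cause no trouble.\<close>

lemma riesz_representation:
  assumes add: "\<And>u v. u \<in> V \<Longrightarrow> v \<in> V \<Longrightarrow> \<phi> (u + v) = \<phi> u + \<phi> v"
    and scale: "\<And>c u. u \<in> V \<Longrightarrow> \<phi> (c *\<^sub>R u) = c * \<phi> u"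
    and bound: "\<And>u. u \<in> V \<Longrightarrow> \<bar>\<phi> u\<bar> \<le> C * N u"
  shows "\<exists>g\<in>V. \<forall>v\<in>V. \<phi> v = B g v"
proof -
  define q where "q v = (N v)\<^sup>2 / 2 - \<phi> v" for v
  have lb: "- (C\<^sup>2) / 2 \<le> q v" if "v \<in> V" for v
  proof -
    have "\<phi> v \<le> C * N v" using bound[OF that] by simp
    moreover have "0 \<le> (C - N v)\<^sup>2" by simp
    ultimately show ?thesis by (simp add: q_def power2_diff field_simps)
  qed
  define m where "m = Inf (q ` V)"
  have bdd: "bdd_below (q ` V)" using lb by (auto intro!: bdd_belowI)
  have m_le: "m \<le> q v" if "v \<in> V" for v
    unfolding m_def using bdd that by (auto intro: cInf_lower)
  have "\<exists>v\<in>V. q v < m + 1 / real (Suc k)" for k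
    using cInf_lessD[of "q ` V" "m + 1 / real (Suc k)"] V_0 by (fastforce simp: m_def)
  then obtain X where X: "\<And>k. X k \<in> V" and Xq: "\<And>k. q (X k) < m + 1 / real (Suc k)" by metis
  \<comment> \<open>Parallelogram law: the linear part cancels, and the midpoint has value at least
    \<open>m\<close>.\<close>
  have par: "(N (a - b))\<^sup>2 \<le> 4 * (q a - m + (q b - m))" if "a \<in> V" "b \<in> V" for a b
  proof -
    have "(N (a - b))\<^sup>2 / 4 = q a + q b - 2 * q ((1/2) *\<^sub>R (a + b))"
      using that by (simp add: q_def N_sq B_simps B_sym[of b a] scale add field_simps)
    moreover have "m \<le> q ((1/2) *\<^sub>R (a + b))" using that by (intro m_le) auto
    ultimately show ?thesis by simp
  qed
  have "\<exists>n0. \<forall>i\<ge>n0. \<forall>j\<ge>n0. N (X i - X j) < e" if "e > 0" for e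
  proof -
    have "0 < e\<^sup>2 / 8" using that by simp
    then obtain n0 where n0: "inverse (real (Suc n0)) < e\<^sup>2 / 8" using reals_Archimedean by blast
    have small: "q (X i) - m < e\<^sup>2 / 8" if "i \<ge> n0" for i
    proof -
      have "1 / real (Suc i) \<le> 1 / real (Suc n0)" using that by (intro divide_left_mono) auto
      then show ?thesis using Xq[of i] n0 by (simp add: inverse_eq_divide)
    qed
    have "N (X i - X j) < e" if "i \<ge> n0" "j \<ge> n0" for i j
    proof (rule power2_less_imp_less)
      show "(N (X i - X j))\<^sup>2 < e\<^sup>2"
        using par[OF X X, of i j] small[OF that(1)] small[OF that(2)] by simp
    qed (use \<open>e > 0\<close> in simp)
    then show ?thesis by blast
  qed
  then obtain g where g: "g \<in> V" and lim: "(\<lambda>k. N (X k - g)) \<longlonglongrightarrow> 0" using complete[of X] X by blast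
  have "(\<lambda>k. \<phi> (X k)) \<longlonglongrightarrow> \<phi> g"
  proof (rule tendsto_of_abs_diff_le)
    show "\<forall>\<^sub>F k in sequentially. \<bar>\<phi> (X k) - \<phi> g\<bar> \<le> C * N (X k - g)"
    proof (rule always_eventually, rule allI)
      fix k
      have "\<phi> (X k) = \<phi> (X k - g) + \<phi> g" using add[of "X k - g" g] X g by simp
      then show "\<bar>\<phi> (X k) - \<phi> g\<bar> \<le> C * N (X k - g)" using bound[of "X k - g"] X g by simp
    qed
    show "(\<lambda>k. C * N (X k - g)) \<longlonglongrightarrow> 0" using tendsto_mult_left[OF lim, of C] by simp
  qed
  moreover have "(\<lambda>k. N (X k)) \<longlonglongrightarrow> N g" using X g lim by (intro N_tendsto)
  ultimately have "(\<lambda>k. q (X k)) \<longlonglongrightarrow> q g" unfolding q_def by (intro tendsto_intros) simp_all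
  moreover have "(\<lambda>k. m + 1 / real (Suc k)) \<longlonglongrightarrow> m + 0"
    by (intro tendsto_intros LIMSEQ_Suc[OF lim_1_over_n])
  ultimately have qg: "q g \<le> m"
    using Xq LIMSEQ_le[of "\<lambda>k. q (X k)" "q g" "\<lambda>k. m + 1 / real (Suc k)" m] by (auto intro: less_imp_le)
  have "\<phi> v = B g v" if "v \<in> V" for v
  proof -
    define d where "d = B g v - \<phi> v"
    have step: "0 \<le> t * d + t\<^sup>2 * ((N v)\<^sup>2 / 2)" for t
    proof -
      have "q (g + t *\<^sub>R v) = q g + (t * d + t\<^sup>2 * ((N v)\<^sup>2 / 2))"
        using that g N_add_sq[of g "t *\<^sub>R v"]
        by (simp add: q_def d_def N_scale B_simps scale add power_mult_distrib field_simps)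
      then show ?thesis using qg m_le[of "g + t *\<^sub>R v"] that g by simp
    qed
    have "d = 0"
    proof (rule ccontr)
      assume "d \<noteq> 0"
      define w where "w = (N v)\<^sup>2 / 2"
      \<comment> \<open>Moving by \<open>- (z * d)\<close> gains \<open>z * d\<^sup>2\<close> to
        first order and loses only the fraction \<open>z * w < 1\<close> of it to second order,
        against minimality.\<close>
      define z where "z = 1 / (w + 1)"
      have "w \<ge> 0" by (simp add: w_def)
      then have z: "z > 0" "z * w < 1" by (simp_all add: z_def)
      have "0 \<le> - (z * d) * d + (- (z * d))\<^sup>2 * w" using step[of "- (z * d)"] by (simp add: w_def)
      also have "\<dots> = - (z * d\<^sup>2 * (1 - z * w))" by (simp add: power2_eq_square algebra_simps)
      finally have "z * d\<^sup>2 * (1 - z * w) \<le> 0" by simp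
      moreover have "0 < z * d\<^sup>2 * (1 - z * w)" using z \<open>d \<noteq> 0\<close> by simp
      ultimately show False by simp
    qed
    then show ?thesis by (simp add: d_def)
  qed
  then show ?thesis using g by blast
qed

end

text \<open>\<open>G u\<close> represents the directional derivatives at \<open>u\<close>. These
  weak requirements are separated out so that they apply to the constraint \<open>J\<close> as well
  as to the energy; from \<open>J\<close> only continuity along paths is wanted.\<close>

locale differentiable_functional = semi_hilbert V B N
  for V :: "'v::real_vector set" and B :: "'v \<Rightarrow> 'v \<Rightarrow> real" and N :: "'v \<Rightarrow> real" +
  fixes \<Phi> :: "'v \<Rightarrow> real" and G :: "'v \<Rightarrow> 'v"
  assumes G_V [simp]: "\<And>u. u \<in> V \<Longrightarrow> G u \<in> V"
    and deriv0: "\<And>u v. u \<in> V \<Longrightarrow> v \<in> V \<Longrightarrow> ((\<lambda>t. \<Phi> (u + t *\<^sub>R v)) has_real_derivative B (G u) v) (at 0)"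
    and G_bdd: "\<And>R. \<exists>L. \<forall>u\<in>V. N u \<le> R \<longrightarrow> N (G u) \<le> L"
begin

lemma deriv:
  assumes "u \<in> V" "v \<in> V"
  shows "((\<lambda>t. \<Phi> (u + t *\<^sub>R v)) has_real_derivative B (G (u + t *\<^sub>R v)) v) (at t)"
proof -
  have "((\<lambda>h. \<Phi> ((u + t *\<^sub>R v) + h *\<^sub>R v)) has_real_derivative B (G (u + t *\<^sub>R v)) v) (at 0)"
    using assms by (intro deriv0) auto
  moreover have "u + t *\<^sub>R v + h *\<^sub>R v = u + (t + h) *\<^sub>R v" for h
    by (simp add: scaleR_add_left)
  ultimately show ?thesis by (simp only: DERIV_def diff_0_right scaleR_zero_left add_0_left add_0_right)
qed

lemma mean_value:
  assumes "u \<in> V" "v \<in> V"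
  shows "\<exists>z. 0 < z \<and> z < 1 \<and> \<Phi> (u + v) - \<Phi> u = B (G (u + z *\<^sub>R v)) v"
proof -
  have "\<exists>z>0. z < 1 \<and> \<Phi> (u + 1 *\<^sub>R v) - \<Phi> (u + 0 *\<^sub>R v) = (1 - 0) * B (G (u + z *\<^sub>R v)) v"
    by (rule MVT2) (auto intro: deriv assms)
  then show ?thesis by simp
qed

text \<open>Directional derivatives alone do not give continuity; together with a locally bounded
  gradient they give a Lipschitz bound along segments. The filter is arbitrary, so that sequences
  and paths are both covered.\<close>

lemma \<Phi>_cont:
  assumes "\<And>k. X k \<in> V" "u \<in> V" "((\<lambda>k. N (X k - u)) \<longlongrightarrow> 0) F"
  shows "((\<lambda>k. \<Phi> (X k)) \<longlongrightarrow> \<Phi> u) F"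
proof -
  obtain L where L: "\<forall>w\<in>V. N w \<le> N u + 1 \<longrightarrow> N (G w) \<le> L" using G_bdd[of "N u + 1"] by blast
  have "\<forall>\<^sub>F k in F. N (X k - u) < 1" using assms(3) by (rule order_tendstoD) simp
  then have "\<forall>\<^sub>F k in F. \<bar>\<Phi> (X k) - \<Phi> u\<bar> \<le> L * N (X k - u)"
  proof eventually_elim
    case (elim k)
    define v where "v = X k - u"
    have v: "v \<in> V" and Xv: "X k = u + v" and Nv: "0 \<le> N v" "N v < 1"
      using assms(1,2) elim by (simp_all add: v_def)
    obtain z where z: "0 < z" "z < 1" "\<Phi> (u + v) - \<Phi> u = B (G (u + z *\<^sub>R v)) v"
      using mean_value[OF assms(2) v] by blast
    have zV: "u + z *\<^sub>R v \<in> V" using v assms(2) by simp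
    have "N (u + z *\<^sub>R v) \<le> N u + N (z *\<^sub>R v)" using v assms(2) by (intro N_triangle) simp_all
    also have "N (z *\<^sub>R v) = z * N v" using z(1) v by (simp add: N_scale)
    also have "z * N v \<le> 1 * 1" using z Nv by (intro mult_mono) simp_all
    finally have "N (G (u + z *\<^sub>R v)) \<le> L" using L zV by simp
    then have "N (G (u + z *\<^sub>R v)) * N v \<le> L * N v" using Nv by (intro mult_right_mono)
    moreover have "\<bar>B (G (u + z *\<^sub>R v)) v\<bar> \<le> N (G (u + z *\<^sub>R v)) * N v"
      by (intro Cauchy_Schwarz G_V zV v)
    ultimately have "\<bar>\<Phi> (u + v) - \<Phi> u\<bar> \<le> L * N v" unfolding z(3) by linarith
    then show ?case by (simp add: Xv)
  qed
  moreover have "((\<lambda>k. L * N (X k - u)) \<longlongrightarrow> 0) F" using tendsto_mult_left[OF assms(3), of L] by simp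
  ultimately show ?thesis by (rule tendsto_of_abs_diff_le)
qed

end

text \<open>\<open>palais_smale\<close> is required of bounded sequences only;
  \<open>coercive\<close> supplies the bound whenever the values of the functional are bounded
  above.\<close>

locale C1_functional = differentiable_functional V B N \<Phi> G
  for V :: "'v::real_vector set" and B :: "'v \<Rightarrow> 'v \<Rightarrow> real" and N :: "'v \<Rightarrow> real"
    and \<Phi> :: "'v \<Rightarrow> real" and G :: "'v \<Rightarrow> 'v" +
  assumes G_uc: "\<And>R e. e > 0 \<Longrightarrow> \<exists>d>0. \<forall>u\<in>V. \<forall>v\<in>V. N u \<le> R \<longrightarrow> N v \<le> R \<longrightarrow> N (u - v) \<le> d \<longrightarrow> N (G u - G v) \<le> e"
    and coercive: "\<And>c. \<exists>R. \<forall>u\<in>V. \<Phi> u \<le> c \<longrightarrow> N u \<le> R"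
    and palais_smale: "\<And>X R. (\<And>k::nat. X k \<in> V) \<Longrightarrow> (\<And>k. N (X k) \<le> R) \<Longrightarrow> (\<lambda>k. N (G (X k))) \<longlonglongrightarrow> 0 \<Longrightarrow>
          \<exists>r u. strict_mono r \<and> u \<in> V \<and> (\<lambda>k. N (X (r k) - u)) \<longlonglongrightarrow> 0"
begin

text \<open>Endpoints are matched up to seminorm 0, because a deformation step may move a critical
  point by a null vector. Membership in \<open>V\<close> is asked for every real \<open>t\<close>,
  as the continuity lemmas expect of their index.\<close>

definition path_between :: "'v \<Rightarrow> 'v \<Rightarrow> (real \<Rightarrow> 'v) \<Rightarrow> bool" where
  "path_between a b \<gamma> \<longleftrightarrow> (\<forall>t. \<gamma> t \<in> V) \<and> N (\<gamma> 0 - a) = 0 \<and> N (\<gamma> 1 - b) = 0 \<and>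
     (\<forall>t\<in>{0..1}. ((\<lambda>r. N (\<gamma> r - \<gamma> t)) \<longlongrightarrow> 0) (at t within {0..1}))"

lemma path_segment:
  assumes "a \<in> V" "b \<in> V"
  shows "path_between a b (\<lambda>t. a + t *\<^sub>R (b - a))"
proof -
  have eq: "N (a + r *\<^sub>R (b - a) - (a + t *\<^sub>R (b - a))) = \<bar>r - t\<bar> * N (b - a)" for r t
  proof -
    have "a + r *\<^sub>R (b - a) - (a + t *\<^sub>R (b - a)) = (r - t) *\<^sub>R (b - a)"
      by (simp add: scaleR_left_diff_distrib)
    then show ?thesis using assms by (simp only: N_scale V_diff)
  qed
  have "((\<lambda>r. \<bar>r - t\<bar> * N (b - a)) \<longlongrightarrow> \<bar>t - t\<bar> * N (b - a)) (at t within {0..1})" for t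
    by (intro tendsto_intros)
  then show ?thesis
    unfolding path_between_def eq using assms by simp
qed

lemma G_cont:
  assumes "\<And>k. X k \<in> V" "u \<in> V" "((\<lambda>k. N (X k - u)) \<longlongrightarrow> 0) F"
  shows "((\<lambda>k. N (G (X k) - G u)) \<longlongrightarrow> 0) F"
proof (rule tendstoI)
  fix e :: real assume "e > 0"
  then have "e / 2 > 0" by simp
  from G_uc[OF this, of "N u + 1"] obtain d where d: "d > 0"
    "\<And>v w. v \<in> V \<Longrightarrow> w \<in> V \<Longrightarrow> N v \<le> N u + 1 \<Longrightarrow> N w \<le> N u + 1 \<Longrightarrow> N (v - w) \<le> d \<Longrightarrow> N (G v - G w) \<le> e / 2"
    by blast
  have "\<forall>\<^sub>F k in F. N (X k - u) < min 1 d" using assms(3) d(1) by (intro order_tendstoD(2)[of _ 0]) auto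
  then show "\<forall>\<^sub>F k in F. dist (N (G (X k) - G u)) 0 < e"
  proof eventually_elim
    case (elim k)
    have "N (X k) \<le> N u + 1" using elim N_diff_abs[of "X k" u] assms(1,2) by simp linarith
    then have "N (G (X k) - G u) \<le> e / 2" using elim assms by (intro d) auto
    then show ?case using \<open>e > 0\<close> assms by simp
  qed
qed

lemma G_null:
  assumes "u \<in> V" "v \<in> V" "N (u - v) = 0" shows "N (G u - G v) = 0"
  using G_cont[of "\<lambda>_. u" v sequentially] assms by (simp add: tendsto_const_iff)

text \<open>
  The gradient is uniformly continuous on bounded sets, so a single step \<open>u - \<tau> *\<^sub>R G u\<close> with a uniform
  \<open>\<tau>\<close> replaces the deformation flow; it fixes the endpoints because they are critical points.
\<close>

theorem mountain_pass:
  assumes w: "w1 \<in> V" "w2 \<in> V" and crit: "N (G w1) = 0" "N (G w2) = 0"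
    and cross: "\<And>\<gamma>. path_between w1 w2 \<gamma> \<Longrightarrow> \<exists>t\<in>{0..1}. b \<le> \<Phi> (\<gamma> t)"
    and seg: "\<And>t. t \<in> {0..1} \<Longrightarrow> \<Phi> (w1 + t *\<^sub>R (w2 - w1)) \<le> D"
  shows "\<exists>w\<in>V. N (G w) = 0 \<and> b \<le> \<Phi> w \<and> \<Phi> w \<le> D"
proof -
  \<comment> \<open>The upper bounds of the functional along paths; their infimum is the minimax
    level.\<close>
  define A where "A = {m. \<exists>\<gamma>. path_between w1 w2 \<gamma> \<and> (\<forall>t\<in>{0..1}. \<Phi> (\<gamma> t) \<le> m)}"
  define c where "c = Inf A"
  have DA: "D \<in> A" using path_segment[OF w] seg by (auto simp: A_def)
  have lbA: "b \<le> m" if "m \<in> A" for m using that cross by (fastforce simp: A_def)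
  then have bdd: "bdd_below A" by (auto simp: bdd_below_def)
  have cb: "b \<le> c" unfolding c_def using DA lbA by (intro cInf_greatest) auto
  have c_le: "c \<le> m" if "m \<in> A" for m unfolding c_def using that bdd by (rule cInf_lower)
  have "\<exists>w\<in>V. N (G w) = 0 \<and> \<Phi> w = c"
  proof (rule ccontr)
    assume no: "\<not> ?thesis"
    \<comment> \<open>Without a critical point at level \<open>c\<close>, the Palais-Smale condition
      keeps the gradient away from 0 in a whole band around \<open>c\<close>.\<close>
    have "\<exists>e>0. \<forall>u\<in>V. \<bar>\<Phi> u - c\<bar> \<le> e \<longrightarrow> e \<le> N (G u)"
    proof (rule ccontr)
      assume H: "\<not> ?thesis"
      have "\<exists>u\<in>V. \<bar>\<Phi> u - c\<bar> \<le> 1 / real (Suc k) \<and> N (G u) < 1 / real (Suc k)" for k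
        using H by (auto simp: not_le dest: spec[of _ "1 / real (Suc k)"])
      then obtain X where X: "\<And>k. X k \<in> V" "\<And>k. \<bar>\<Phi> (X k) - c\<bar> \<le> 1 / real (Suc k)"
        "\<And>k. N (G (X k)) < 1 / real (Suc k)" by metis
      have lim: "(\<lambda>k. 1 / real (Suc k)) \<longlonglongrightarrow> 0" by (rule LIMSEQ_Suc[OF lim_1_over_n])
      have g0: "(\<lambda>k. N (G (X k))) \<longlonglongrightarrow> 0"
        by (rule tendsto_of_abs_diff_le[OF always_eventually lim]) (use X in \<open>auto intro: less_imp_le\<close>)
      have p0: "(\<lambda>k. \<Phi> (X k)) \<longlonglongrightarrow> c"
        by (rule tendsto_of_abs_diff_le[OF always_eventually lim]) (use X in auto)
      obtain R where R: "\<forall>u\<in>V. \<Phi> u \<le> c + 1 \<longrightarrow> N u \<le> R" using coercive[of "c + 1"] by blast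
      have "\<Phi> (X k) \<le> c + 1" for k
      proof -
        have "1 / real (Suc k) \<le> 1" by simp
        then show ?thesis using X(2)[of k] by linarith
      qed
      then have "N (X k) \<le> R" for k using R X by blast
      from palais_smale[of X, OF X(1) this g0]
      obtain r u where r: "strict_mono r" "u \<in> V" "(\<lambda>k. N (X (r k) - u)) \<longlonglongrightarrow> 0" by blast
      have "(\<lambda>k. \<Phi> (X (r k))) \<longlonglongrightarrow> \<Phi> u" using X r by (intro \<Phi>_cont) auto
      moreover have "(\<lambda>k. \<Phi> (X (r k))) \<longlonglongrightarrow> c" using LIMSEQ_subseq_LIMSEQ[OF p0 r(1)] by (simp add: o_def)
      ultimately have "\<Phi> u = c" by (rule LIMSEQ_unique)
      have "(\<lambda>k. N (G (X (r k)) - G u)) \<longlonglongrightarrow> 0" using X r by (intro G_cont) auto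
      then have "(\<lambda>k. N (G (X (r k)))) \<longlonglongrightarrow> N (G u)" using X r by (intro N_tendsto) auto
      moreover have "(\<lambda>k. N (G (X (r k)))) \<longlonglongrightarrow> 0" using LIMSEQ_subseq_LIMSEQ[OF g0 r(1)] by (simp add: o_def)
      ultimately have "N (G u) = 0" by (rule LIMSEQ_unique)
      then show False using no r \<open>\<Phi> u = c\<close> by blast
    qed
    then obtain e where e: "e > 0" "\<And>u. u \<in> V \<Longrightarrow> \<bar>\<Phi> u - c\<bar> \<le> e \<Longrightarrow> e \<le> N (G u)" by blast
    obtain R where R: "\<And>u. u \<in> V \<Longrightarrow> \<Phi> u \<le> c + 1 \<Longrightarrow> N u \<le> R" using coercive[of "c + 1"] by blast
    obtain L0 where L0: "\<And>u. u \<in> V \<Longrightarrow> N u \<le> R \<Longrightarrow> N (G u) \<le> L0" using G_bdd[of R] by blast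
    define L where "L = max L0 0 + 1"
    have L: "L > 0" "\<And>u. u \<in> V \<Longrightarrow> N u \<le> R \<Longrightarrow> N (G u) \<le> L"
      unfolding L_def by linarith (use L0 in fastforce)
    have "e / 2 > 0" using e by simp
    from G_uc[OF this, of "R + 1"] obtain d where d: "d > 0" "\<And>u v. u \<in> V \<Longrightarrow> v \<in> V \<Longrightarrow> N u \<le> R + 1 \<Longrightarrow> N v \<le> R + 1 \<Longrightarrow>
        N (u - v) \<le> d \<Longrightarrow> N (G u - G v) \<le> e / 2"
      by blast
    \<comment> \<open>The first bound keeps the step shorter than 1 and than \<open>d\<close>, so
      that it stays in the ball of radius \<open>R + 1\<close> and the gradient changes by at most
      \<open>e / 2\<close>. The second caps the possible increase
      \<open>\<tau> * e\<^sup>2 / 16\<close> by \<open>e / 2\<close>.\<close>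
    define \<tau> where "\<tau> = min (min 1 d / L) (8 / e)"
    have \<tau>: "\<tau> > 0" "\<tau> * L \<le> 1" "\<tau> * L \<le> d" "\<tau> * e\<^sup>2 / 16 \<le> e / 2"
    proof -
      show "\<tau> > 0" using L d e by (simp add: \<tau>_def)
      have "\<tau> * L \<le> min 1 d / L * L" using L by (intro mult_right_mono) (auto simp: \<tau>_def)
      then show "\<tau> * L \<le> 1" "\<tau> * L \<le> d" using L by auto
      have "\<tau> * e\<^sup>2 \<le> 8 / e * e\<^sup>2" by (intro mult_right_mono) (auto simp: \<tau>_def)
      then show "\<tau> * e\<^sup>2 / 16 \<le> e / 2" using e by (simp add: power2_eq_square)
    qed
    define S where "S u = u - \<tau> *\<^sub>R G u" for u
    have S_V: "S u \<in> V" if "u \<in> V" for u using that by (simp add: S_def)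
    have step: "\<Phi> (S u) \<le> \<Phi> u - \<tau> * ((N (G u))\<^sup>2 - e / 2 * N (G u))" if u: "u \<in> V" "\<Phi> u \<le> c + 1" for u
    proof -
      obtain z where z: "0 < z" "z < 1"
        "\<Phi> (u + (- \<tau>) *\<^sub>R G u) - \<Phi> u = B (G (u + z *\<^sub>R ((- \<tau>) *\<^sub>R G u))) ((- \<tau>) *\<^sub>R G u)"
        using mean_value[of u "(- \<tau>) *\<^sub>R G u"] u by auto
      define v where "v = u + z *\<^sub>R ((- \<tau>) *\<^sub>R G u)"
      have v: "v \<in> V" using u by (simp add: v_def)
      have Nu: "N u \<le> R" using R u by blast
      have "N (v - u) = z * (\<tau> * N (G u))" using u z \<tau> by (simp add: v_def N_scale N_minus)
      also have "\<dots> \<le> 1 * (\<tau> * L)" using z \<tau> u Nu by (intro mult_mono L) auto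
      finally have vu: "N (v - u) \<le> \<tau> * L" by simp
      have "N v \<le> R + 1" using N_diff_abs[OF v u(1)] vu \<tau> Nu by linarith
      then have "N (G v - G u) \<le> e / 2" using v u Nu vu \<tau> by (intro d) auto
      then have "N (G v - G u) * N (G u) \<le> e / 2 * N (G u)" using u by (intro mult_right_mono) auto
      moreover have "\<bar>B (G v - G u) (G u)\<bar> \<le> N (G v - G u) * N (G u)"
        using u v by (intro Cauchy_Schwarz) auto
      moreover have "B (G v) (G u) = (N (G u))\<^sup>2 + B (G v - G u) (G u)"
        using u v by (simp add: N_sq B_simps)
      ultimately have "(N (G u))\<^sup>2 - e / 2 * N (G u) \<le> B (G v) (G u)" by linarith
      then have "\<tau> * ((N (G u))\<^sup>2 - e / 2 * N (G u)) \<le> \<tau> * B (G v) (G u)"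
        using \<tau> by (intro mult_left_mono) auto
      moreover have "\<Phi> (S u) - \<Phi> u = - \<tau> * B (G v) (G u)"
        using z(3) u v unfolding v_def[symmetric] by (simp add: S_def B_simps)
      ultimately show ?thesis by simp
    qed
    \<comment> \<open>Inside the band the step gains at least \<open>\<tau> * e\<^sup>2 / 2\<close>,
      which pays for the excess \<open>\<eta>\<close> of the path over \<open>c\<close> and for the
      drop \<open>\<kappa>\<close> below it.\<close>
    define \<eta> where "\<eta> = min (min 1 e) (\<tau> * e\<^sup>2 / 4)"
    define \<kappa> where "\<kappa> = min (\<tau> * e\<^sup>2 / 4) (e / 2)"
    have pos: "\<eta> > 0" "\<kappa> > 0" using e \<tau> by (auto simp: \<eta>_def \<kappa>_def)
    obtain m where "m \<in> A" "m < c + \<eta>" using cInf_lessD[of A "c + \<eta>"] DA pos by (auto simp: c_def)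
    then obtain \<gamma> where \<gamma>: "path_between w1 w2 \<gamma>" and \<gamma>m: "\<And>t. t \<in> {0..1} \<Longrightarrow> \<Phi> (\<gamma> t) \<le> m"
      by (auto simp: A_def)
    have \<gamma>le: "\<Phi> (\<gamma> t) \<le> c + \<eta>" if "t \<in> {0..1}" for t
      using \<gamma>m[OF that] \<open>m < c + \<eta>\<close> by simp
    have \<gamma>V: "\<gamma> t \<in> V" for t using \<gamma> by (simp add: path_between_def)
    have low: "\<Phi> (S (\<gamma> t)) \<le> c - \<kappa>" if t: "t \<in> {0..1}" for t
    proof -
      let ?x = "N (G (\<gamma> t))"
      have st: "\<Phi> (S (\<gamma> t)) \<le> \<Phi> (\<gamma> t) - \<tau> * (?x\<^sup>2 - e / 2 * ?x)"
        using \<gamma>le[OF t] \<gamma>V by (intro step) (auto simp: \<eta>_def)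
      show ?thesis
      proof (cases "\<bar>\<Phi> (\<gamma> t) - c\<bar> \<le> e")
        case True
        then have x: "e \<le> ?x" using e \<gamma>V by blast
        have "e * (e / 2) \<le> ?x * (?x - e / 2)" using x e by (intro mult_mono) auto
        then have "\<tau> * (e\<^sup>2 / 2) \<le> \<tau> * (?x\<^sup>2 - e / 2 * ?x)"
          using \<tau> by (intro mult_left_mono) (auto simp: power2_eq_square algebra_simps)
        moreover have "\<eta> \<le> \<tau> * e\<^sup>2 / 4" "\<kappa> \<le> \<tau> * e\<^sup>2 / 4" by (auto simp: \<eta>_def \<kappa>_def)
        moreover have "\<tau> * (e\<^sup>2 / 2) = 2 * (\<tau> * e\<^sup>2 / 4)" by simp
        ultimately show ?thesis using st \<gamma>le[OF t] by linarith
      next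
        case False
        then have lt: "\<Phi> (\<gamma> t) < c - e" using \<gamma>le[OF t] by (auto simp: \<eta>_def)
        \<comment> \<open>Below the band the gradient may be small and the step may even raise the
          value, but by no more than \<open>e / 2\<close>, starting from less than
          \<open>c - e\<close>.\<close>
        have "0 \<le> (?x - e / 4)\<^sup>2" by simp
        then have "- (e\<^sup>2 / 16) \<le> ?x\<^sup>2 - e / 2 * ?x" by (simp add: power2_diff power_divide)
        then have "\<tau> * (- (e\<^sup>2 / 16)) \<le> \<tau> * (?x\<^sup>2 - e / 2 * ?x)"
          using \<tau> by (intro mult_left_mono) auto
        moreover have "\<kappa> \<le> e / 2" by (simp add: \<kappa>_def)
        ultimately show ?thesis using st lt \<tau>(4) by simp
      qed
    qed
    have "path_between w1 w2 (\<lambda>t. S (\<gamma> t))"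
      unfolding path_between_def
    proof (intro conjI allI ballI)
      show "S (\<gamma> t) \<in> V" for t using \<gamma>V S_V by blast
      have end_fixed: "N (S v - a) = 0" if "v \<in> V" "a \<in> V" "N (v - a) = 0" "N (G a) = 0" for v a
      proof -
        have "N (G v) \<le> 0" using G_null[of v a] N_diff_abs[of "G v" "G a"] that by simp
        then have "N (G v) = 0" using that by (intro antisym N_nonneg G_V)
        moreover have "N (S v - a) \<le> N (v - a) + \<tau> * N (G v)"
          using N_triangle_diff[of "v - a" "\<tau> *\<^sub>R G v"] that \<tau>
          by (simp add: S_def N_scale algebra_simps)
        ultimately have "N (S v - a) \<le> 0" using that by simp
        then show ?thesis using that S_V by (intro antisym N_nonneg) auto
      qed
      show "N (S (\<gamma> 0) - w1) = 0" "N (S (\<gamma> 1) - w2) = 0"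
        using \<gamma> \<gamma>V w crit by (auto intro!: end_fixed simp: path_between_def)
      fix t :: real assume t: "t \<in> {0..1}"
      let ?F = "at t within {0..1}"
      have c1: "((\<lambda>r. N (\<gamma> r - \<gamma> t)) \<longlongrightarrow> 0) ?F" using \<gamma> t by (auto simp: path_between_def)
      have c2: "((\<lambda>r. N (G (\<gamma> r) - G (\<gamma> t))) \<longlongrightarrow> 0) ?F" using c1 \<gamma>V by (intro G_cont) auto
      have c3: "((\<lambda>r. N (\<gamma> r - \<gamma> t) + \<tau> * N (G (\<gamma> r) - G (\<gamma> t))) \<longlongrightarrow> 0 + \<tau> * 0) ?F"
        by (intro tendsto_intros c1 c2)
      show "((\<lambda>r. N (S (\<gamma> r) - S (\<gamma> t))) \<longlongrightarrow> 0) ?F"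
      proof (rule tendsto_of_abs_diff_le)
        show "\<forall>\<^sub>F r in ?F. \<bar>N (S (\<gamma> r) - S (\<gamma> t)) - 0\<bar> \<le> N (\<gamma> r - \<gamma> t) + \<tau> * N (G (\<gamma> r) - G (\<gamma> t))"
        proof (rule always_eventually, rule allI)
          fix r
          have "S (\<gamma> r) - S (\<gamma> t) = (\<gamma> r - \<gamma> t) - \<tau> *\<^sub>R (G (\<gamma> r) - G (\<gamma> t))"
            by (simp add: S_def algebra_simps)
          then show "\<bar>N (S (\<gamma> r) - S (\<gamma> t)) - 0\<bar> \<le> N (\<gamma> r - \<gamma> t) + \<tau> * N (G (\<gamma> r) - G (\<gamma> t))"
            using N_triangle_diff[of "\<gamma> r - \<gamma> t" "\<tau> *\<^sub>R (G (\<gamma> r) - G (\<gamma> t))"] \<gamma>V S_V \<tau> by (simp add: N_scale)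
        qed
        show "((\<lambda>r. N (\<gamma> r - \<gamma> t) + \<tau> * N (G (\<gamma> r) - G (\<gamma> t))) \<longlongrightarrow> 0) ?F" using c3 by simp
      qed
    qed
    then have "c - \<kappa> \<in> A" using low by (auto simp: A_def)
    then show False using c_le pos by fastforce
  qed
  then show ?thesis using cb c_le[OF DA] by blast
qed

end

section \<open>Kirchhoff functionals with a compact nonlinearity\<close>

text \<open>Derivatives are taken within the half-line because \<open>M\<close> is continuous only
  there; at 0 they are one-sided. The resulting linear growth of \<open>P\<close> is the source of
  coercivity.\<close>

lemma derivative_lower_bound:
  fixes P :: "real \<Rightarrow> real"
  assumes deriv: "\<And>t. 0 \<le> t \<Longrightarrow> (P has_real_derivative M t) (at t within {0..})"
    and M: "\<And>t. 0 \<le> t \<Longrightarrow> m \<le> M t" and ab: "0 \<le> a" "a \<le> b"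
  shows "m * (b - a) \<le> P b - P a"
proof (cases "a = b")
  case False
  then have "a < b" using ab by simp
  have "\<exists>z\<in>{a<..<b}. P b - P a = M z * (b - a)"
  proof (rule mvt_simple[OF \<open>a < b\<close>, of P "\<lambda>z x. M z * x"])
    fix x assume "a \<le> x" "x \<le> b"
    then have "(P has_real_derivative M x) (at x within {a..b})"
      using deriv[of x] ab by (auto intro: DERIV_subset)
    then show "(P has_derivative (\<lambda>z x. M z * x) x) (at x within {a..b})"
      by (simp add: has_field_derivative_def)
  qed
  then obtain z where "a < z" "P b - P a = M z * (b - a)" by auto
  then show ?thesis using M[of z] ab by (simp add: mult_right_mono)
qed simp

context semi_hilbert begin

text \<open>Replaces explicit estimates by compactness: a sequence with
  \<open>N (g (X k)) > k\<close> has no subsequence along which these values stay bounded.\<close>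

lemma bounded_on_balls:
  assumes "\<And>X. (\<And>k. X k \<in> V) \<Longrightarrow> (\<And>k. N (X k) \<le> R) \<Longrightarrow>
    \<exists>r C. strict_mono (r :: nat \<Rightarrow> nat) \<and> (\<forall>\<^sub>F k in sequentially. N (g (X (r k))) \<le> C)"
  shows "\<exists>L. \<forall>u\<in>V. N u \<le> R \<longrightarrow> N (g u) \<le> L"
proof (rule ccontr)
  assume "\<not> ?thesis"
  then have "\<exists>u\<in>V. N u \<le> R \<and> real k < N (g u)" for k :: nat by (auto simp: not_le)
  then obtain X where X: "\<And>k. X k \<in> V" "\<And>k. N (X k) \<le> R" "\<And>k. real k < N (g (X k))" by metis
  from assms[of X, OF X(1,2)] obtain r C where r: "strict_mono r"
    and C: "\<forall>\<^sub>F k in sequentially. N (g (X (r k))) \<le> C" by blast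
  obtain n where n: "C < real n" using reals_Archimedean2 by blast
  from C have "\<forall>\<^sub>F k in sequentially. False"
    using eventually_ge_at_top[of n]
  proof eventually_elim
    case (elim k)
    have "n \<le> r k" using elim seq_suble[OF r, of k] by simp
    then have "real n \<le> real (r k)" by simp
    then show False using elim X(3)[of "r k"] n by linarith
  qed
  then show False by simp
qed

end

text \<open>
  The relation \<open>conv\<close> plays the role of weak convergence of bounded sequences; in the application it is
  convergence almost everywhere.
\<close>

locale kirchhoff = semi_hilbert V B N
  for V :: "'v::real_vector set" and B :: "'v \<Rightarrow> 'v \<Rightarrow> real" and N :: "'v \<Rightarrow> real" +
  fixes conv :: "(nat \<Rightarrow> 'v) \<Rightarrow> 'v \<Rightarrow> bool" and J :: "'v \<Rightarrow> real" and DJ :: "'v \<Rightarrow> 'v \<Rightarrow> real"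
    and M P E e :: "real \<Rightarrow> real" and \<alpha> \<beta> l S m :: real
  assumes conv_compact: "\<And>X R. (\<And>k :: nat. X k \<in> V) \<Longrightarrow> (\<And>k. N (X k) \<le> R) \<Longrightarrow>
        \<exists>(r :: nat \<Rightarrow> nat) u. strict_mono r \<and> u \<in> V \<and> conv (\<lambda>k. X (r k)) u"
    and conv_const: "\<And>u. conv (\<lambda>_. u) u"
    and conv_subseq: "\<And>X u r. conv X u \<Longrightarrow> strict_mono r \<Longrightarrow> conv (\<lambda>k. X (r k)) u"
    and conv_lsc: "\<And>X u R. (\<And>k. X k \<in> V) \<Longrightarrow> u \<in> V \<Longrightarrow> conv X u \<Longrightarrow> (\<And>k. N (X k) \<le> R) \<Longrightarrow> N u \<le> R"
    and conv_diff: "\<And>X Y u v. conv X u \<Longrightarrow> conv Y v \<Longrightarrow> conv (\<lambda>k. X k - Y k) (u - v)"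
    and conv_null: "\<And>X u v. conv X u \<Longrightarrow> u \<in> V \<Longrightarrow> v \<in> V \<Longrightarrow> N (u - v) = 0 \<Longrightarrow> conv X v"
    and J_conv: "\<And>X u R. (\<And>k. X k \<in> V) \<Longrightarrow> u \<in> V \<Longrightarrow> conv X u \<Longrightarrow> (\<And>k. N (X k) \<le> R) \<Longrightarrow> (\<lambda>k. J (X k)) \<longlonglongrightarrow> J u"
    and DJ_conv: "\<And>X u R d. (\<And>k. X k \<in> V) \<Longrightarrow> u \<in> V \<Longrightarrow> conv X u \<Longrightarrow> (\<And>k. N (X k) \<le> R) \<Longrightarrow> d > 0 \<Longrightarrow>
        \<forall>\<^sub>F k in sequentially. \<forall>w\<in>V. \<bar>DJ (X k) w - DJ u w\<bar> \<le> d * N w"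
    and DJ_add: "\<And>u v w. u \<in> V \<Longrightarrow> v \<in> V \<Longrightarrow> w \<in> V \<Longrightarrow> DJ u (v + w) = DJ u v + DJ u w"
    and DJ_scale: "\<And>u v c. u \<in> V \<Longrightarrow> v \<in> V \<Longrightarrow> DJ u (c *\<^sub>R v) = c * DJ u v"
    and DJ_bound: "\<And>u. u \<in> V \<Longrightarrow> \<exists>C. \<forall>v\<in>V. \<bar>DJ u v\<bar> \<le> C * N v"
    and J_deriv: "\<And>u v. u \<in> V \<Longrightarrow> v \<in> V \<Longrightarrow> ((\<lambda>t. J (u + t *\<^sub>R v)) has_real_derivative DJ u v) (at 0)"
    and J_range: "\<And>u. u \<in> V \<Longrightarrow> J u \<in> {\<alpha>..\<beta>}"
    and m_pos: "m > 0" and M_ge: "\<And>t. t \<ge> 0 \<Longrightarrow> m \<le> M t" and M_cont: "continuous_on {0..} M"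
    and P_deriv: "\<And>t. t \<ge> 0 \<Longrightarrow> (P has_real_derivative M t) (at t within {0..})" and P_0: "P 0 = 0"
    and E_deriv: "\<And>c. c \<in> {\<alpha>..\<beta>} \<Longrightarrow> (E has_real_derivative e c) (at c)"
    and e_cont: "continuous_on {\<alpha>..\<beta>} e"
    and E_range: "\<And>c. c \<in> {\<alpha>..\<beta>} \<Longrightarrow> E c \<in> {0..S}" and E_l: "E l = 0"
begin

text \<open>The gradient of \<open>J\<close>. The representative is determined only up to null
  vectors, hence the choice.\<close>

definition "gJ u = (SOME g. g \<in> V \<and> (\<forall>v\<in>V. DJ u v = B g v))"

lemma gJ:
  assumes "u \<in> V" shows "gJ u \<in> V" "\<And>v. v \<in> V \<Longrightarrow> B (gJ u) v = DJ u v"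
proof -
  obtain C where "\<forall>v\<in>V. \<bar>DJ u v\<bar> \<le> C * N v" using DJ_bound[OF assms] by blast
  then have bd: "\<bar>DJ u v\<bar> \<le> C * N v" if "v \<in> V" for v using that by blast
  have "\<exists>g\<in>V. \<forall>v\<in>V. DJ u v = B g v"
    by (rule riesz_representation[OF DJ_add[OF assms] DJ_scale[OF assms] bd])
  then have "\<exists>g. g \<in> V \<and> (\<forall>v\<in>V. DJ u v = B g v)" by blast
  then have "gJ u \<in> V \<and> (\<forall>v\<in>V. DJ u v = B (gJ u) v)" unfolding gJ_def by (rule someI_ex)
  then show "gJ u \<in> V" "\<And>v. v \<in> V \<Longrightarrow> B (gJ u) v = DJ u v" by auto
qed

text \<open>The gradient of \<open>J\<close> turns weak convergence into strong convergence. Since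
  \<open>DJ_conv\<close> is uniform in the test vector, it may be applied to the difference of the
  gradients itself.\<close>

lemma gJ_conv:
  assumes X: "\<And>k. X k \<in> V" "\<And>k. N (X k) \<le> R" and u: "u \<in> V" "conv X u"
  shows "(\<lambda>k. N (gJ (X k) - gJ u)) \<longlonglongrightarrow> 0"
proof (rule tendstoI)
  fix d :: real assume "d > 0"
  then have "d / 2 > 0" by simp
  from DJ_conv[OF X(1) u X(2) this]
  have "\<forall>\<^sub>F k in sequentially. \<forall>w\<in>V. \<bar>DJ (X k) w - DJ u w\<bar> \<le> d / 2 * N w" .
  then show "\<forall>\<^sub>F k in sequentially. dist (N (gJ (X k) - gJ u)) 0 < d"
  proof eventually_elim
    case (elim k)
    define w where "w = gJ (X k) - gJ u"
    have V: "gJ (X k) \<in> V" "gJ u \<in> V" using X(1) u(1) by (auto intro: gJ(1))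
    then have w: "w \<in> V" by (simp add: w_def)
    have "B w w = B (gJ (X k)) w - B (gJ u) w"
      using B_diff[OF V w] by (simp only: w_def)
    also have "\<dots> = DJ (X k) w - DJ u w" using w by (simp only: gJ(2)[OF X(1)] gJ(2)[OF u(1)])
    finally have "B w w = DJ (X k) w - DJ u w" .
    moreover have "\<bar>DJ (X k) w - DJ u w\<bar> \<le> d / 2 * N w" using elim w by blast
    ultimately have "(N w)\<^sup>2 \<le> d / 2 * N w" using w by (simp only: N_sq abs_le_iff)
    have "N w \<le> d / 2"
    proof (rule ccontr)
      assume "\<not> ?thesis"
      then have "d / 2 * N w < N w * N w" using \<open>d > 0\<close> by (intro mult_strict_right_mono) auto
      then show False using \<open>(N w)\<^sup>2 \<le> d / 2 * N w\<close> by (simp add: power2_eq_square)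
    qed
    then have "\<bar>N w\<bar> < d" using N_nonneg[OF w] \<open>d > 0\<close> by linarith
    then show ?case by (simp add: w_def)
  qed
qed

text \<open>The norms are made to converge as well, since \<open>M\<close> is evaluated at them.
  Their limit \<open>\<nu>\<close> need not be \<open>N u\<close>.\<close>

lemma weak_subsequence:
  fixes X :: "nat \<Rightarrow> 'v"
  assumes X: "\<And>k. X k \<in> V" "\<And>k. N (X k) \<le> R"
  obtains r :: "nat \<Rightarrow> nat" and u \<nu> where "strict_mono r" "u \<in> V"
    "conv (\<lambda>k. X (r k)) u" "(\<lambda>k. N (X (r k))) \<longlonglongrightarrow> \<nu>" "0 \<le> \<nu>"
proof -
  have "\<exists>(r :: nat \<Rightarrow> nat) u. strict_mono r \<and> u \<in> V \<and> conv (\<lambda>k. X (r k)) u" by (rule conv_compact) (rule X)+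
  then obtain r u where r: "strict_mono r" "u \<in> V" "conv (\<lambda>k. X (r k)) u" by blast
  have inR: "\<forall>k. N (X (r k)) \<in> {0..R}" using X by simp
  have "seq_compact {0..R}" by (simp add: compact_imp_seq_compact)
  then obtain \<nu> and q :: "nat \<Rightarrow> nat"
    where q: "\<nu> \<in> {0..R}" "strict_mono q" "((\<lambda>k. N (X (r k))) \<circ> q) \<longlonglongrightarrow> \<nu>"
    by (rule seq_compactE[OF _ inR])
  show ?thesis
  proof (rule that[of "r \<circ> q" u \<nu>])
    show "strict_mono (r \<circ> q)" using strict_mono_o[OF r(1) q(2)] .
    show "conv (\<lambda>k. X ((r \<circ> q) k)) u" using conv_subseq[OF r(3) q(2)] by simp
  qed (use r q in \<open>simp_all add: o_def\<close>)
qed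

lemma J_eq: "u \<in> V \<Longrightarrow> v \<in> V \<Longrightarrow> N (u - v) = 0 \<Longrightarrow> J u = J v"
  using J_conv[of "\<lambda>_. u" v "N u"] conv_null[OF conv_const, of u v] by (simp add: tendsto_const_iff)

text \<open>In the application \<open>P\<close> is the primitive of \<open>M\<close>, and
  \<open>E c\<close> is \<open>\<mu> * prim h (c - l)\<close> with derivative
  \<open>e c\<close>.\<close>

definition \<Phi> :: "'v \<Rightarrow> real" where "\<Phi> u = P ((N u)\<^sup>2) / 2 - E (J u)"
definition G :: "'v \<Rightarrow> 'v" where "G u = M ((N u)\<^sup>2) *\<^sub>R u - e (J u) *\<^sub>R gJ u"

lemma G_V': "u \<in> V \<Longrightarrow> G u \<in> V" by (simp add: G_def gJ)

lemma e_J_conv: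
  assumes X: "\<And>k. X k \<in> V" "\<And>k. N (X k) \<le> R" and u: "u \<in> V" "conv X u"
  shows "(\<lambda>k. e (J (X k))) \<longlonglongrightarrow> e (J u)"
  using continuous_on_tendsto_compose[OF e_cont J_conv[OF X(1) u X(2)]] J_range X(1) u(1) by simp

text \<open>The coefficients converge to \<open>M (\<nu>\<^sup>2)\<close> and
  \<open>e (J u)\<close>, and \<open>gJ\<close> converges strongly; the only term that need not
  converge is \<open>X k\<close> itself, now with a fixed coefficient.\<close>

lemma G_conv:
  assumes X: "\<And>k. X k \<in> V" "\<And>k. N (X k) \<le> R" and u: "u \<in> V" "conv X u"
    and \<nu>: "(\<lambda>k. N (X k)) \<longlonglongrightarrow> \<nu>" "0 \<le> \<nu>"
  shows "(\<lambda>k. N (G (X k) - (M (\<nu>\<^sup>2) *\<^sub>R X k - e (J u) *\<^sub>R gJ u))) \<longlonglongrightarrow> 0"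
proof (rule tendsto_of_abs_diff_le)
  let ?g = "\<lambda>k. \<bar>M ((N (X k))\<^sup>2) - M (\<nu>\<^sup>2)\<bar> * N (X k) +
    (\<bar>e (J (X k)) - e (J u)\<bar> * N (gJ (X k)) + \<bar>e (J u)\<bar> * N (gJ (X k) - gJ u))"
  have "(\<lambda>k. M ((N (X k))\<^sup>2)) \<longlonglongrightarrow> M (\<nu>\<^sup>2)"
    by (rule continuous_on_tendsto_compose[OF M_cont]) (auto intro!: tendsto_intros \<nu>)
  moreover have "(\<lambda>k. N (gJ (X k))) \<longlonglongrightarrow> N (gJ u)"
    using gJ_conv[OF X u] X u gJ by (intro N_tendsto) auto
  ultimately have "?g \<longlonglongrightarrow> \<bar>M (\<nu>\<^sup>2) - M (\<nu>\<^sup>2)\<bar> * \<nu> + (\<bar>e (J u) - e (J u)\<bar> * N (gJ u) + \<bar>e (J u)\<bar> * 0)"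
    by (intro tendsto_intros \<nu> e_J_conv[OF X u] gJ_conv[OF X u])
  then show "?g \<longlonglongrightarrow> 0" by simp
  show "\<forall>\<^sub>F k in sequentially. \<bar>N (G (X k) - (M (\<nu>\<^sup>2) *\<^sub>R X k - e (J u) *\<^sub>R gJ u)) - 0\<bar> \<le> ?g k"
  proof (rule always_eventually, rule allI)
    fix k
    let ?a = "(M ((N (X k))\<^sup>2) - M (\<nu>\<^sup>2)) *\<^sub>R X k"
    let ?b = "(e (J (X k)) - e (J u)) *\<^sub>R gJ (X k)" and ?c = "e (J u) *\<^sub>R (gJ (X k) - gJ u)"
    have V: "X k \<in> V" "gJ (X k) \<in> V" "gJ u \<in> V" "G (X k) \<in> V" using X u gJ G_V' by auto
    have "G (X k) - (M (\<nu>\<^sup>2) *\<^sub>R X k - e (J u) *\<^sub>R gJ u) = ?a - (?b + ?c)"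
      by (simp add: G_def algebra_simps)
    moreover have "N (?a - (?b + ?c)) \<le> N ?a + (N ?b + N ?c)"
      using N_triangle_diff[of ?a "?b + ?c"] N_triangle[of ?b ?c] V by simp
    ultimately show "\<bar>N (G (X k) - (M (\<nu>\<^sup>2) *\<^sub>R X k - e (J u) *\<^sub>R gJ u)) - 0\<bar> \<le> ?g k"
      using V by (simp add: N_scale)
  qed
qed

lemma gJ_bdd: "\<exists>L. \<forall>u\<in>V. N u \<le> R \<longrightarrow> N (gJ u) \<le> L"
proof (rule bounded_on_balls)
  fix X :: "nat \<Rightarrow> 'v" assume X: "\<And>k. X k \<in> V" "\<And>k. N (X k) \<le> R"
  have "\<exists>(r :: nat \<Rightarrow> nat) u. strict_mono r \<and> u \<in> V \<and> conv (\<lambda>k. X (r k)) u" by (rule conv_compact) (rule X)+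
  then obtain r u where r: "strict_mono r" "u \<in> V" "conv (\<lambda>k. X (r k)) u" by blast
  have "(\<lambda>k. N (gJ (X (r k)) - gJ u)) \<longlonglongrightarrow> 0" by (rule gJ_conv[OF X r(2,3)])
  then have "(\<lambda>k. N (gJ (X (r k)))) \<longlonglongrightarrow> N (gJ u)" using X r gJ by (intro N_tendsto) auto
  then have "\<forall>\<^sub>F k in sequentially. N (gJ (X (r k))) < N (gJ u) + 1" by (rule order_tendstoD) simp
  then show "\<exists>r C. strict_mono (r :: nat \<Rightarrow> nat) \<and> (\<forall>\<^sub>F k in sequentially. N (gJ (X (r k))) \<le> C)"
    using r(1) by (intro exI[of _ r] exI[of _ "N (gJ u) + 1"]) (auto elim: eventually_mono)
qed

lemma G_bdd': "\<exists>L. \<forall>u\<in>V. N u \<le> R \<longrightarrow> N (G u) \<le> L"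
proof (rule bounded_on_balls)
  fix X :: "nat \<Rightarrow> 'v" assume X: "\<And>k. X k \<in> V" "\<And>k. N (X k) \<le> R"
  obtain r u \<nu> where r: "strict_mono r" "u \<in> V" "conv (\<lambda>k. X (r k)) u" "(\<lambda>k. N (X (r k))) \<longlonglongrightarrow> \<nu>" "0 \<le> \<nu>"
    by (rule weak_subsequence[OF X])
  let ?z = "e (J u) *\<^sub>R gJ u"
  have z: "?z \<in> V" using r gJ by simp
  have "(\<lambda>k. N (G (X (r k)) - (M (\<nu>\<^sup>2) *\<^sub>R X (r k) - ?z))) \<longlonglongrightarrow> 0"
    by (rule G_conv[OF X r(2-5)])
  then have "\<forall>\<^sub>F k in sequentially. N (G (X (r k)) - (M (\<nu>\<^sup>2) *\<^sub>R X (r k) - ?z)) < 1"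
    by (rule order_tendstoD) simp
  then have "\<forall>\<^sub>F k in sequentially. N (G (X (r k))) \<le> 1 + (\<bar>M (\<nu>\<^sup>2)\<bar> * R + N ?z)"
  proof eventually_elim
    case (elim k)
    let ?y = "M (\<nu>\<^sup>2) *\<^sub>R X (r k) - ?z"
    have V: "G (X (r k)) \<in> V" "?y \<in> V" using X z G_V' by auto
    have "N ?y \<le> N (M (\<nu>\<^sup>2) *\<^sub>R X (r k)) + N ?z" using X z by (intro N_triangle_diff) auto
    also have "N (M (\<nu>\<^sup>2) *\<^sub>R X (r k)) \<le> \<bar>M (\<nu>\<^sup>2)\<bar> * R" using X by (simp add: N_scale mult_left_mono)
    finally show ?case using N_diff_abs[OF V] elim by linarith
  qed
  then show "\<exists>r C. strict_mono (r :: nat \<Rightarrow> nat) \<and> (\<forall>\<^sub>F k in sequentially. N (G (X (r k))) \<le> C)"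
    using r(1) by (intro exI[of _ r] exI[of _ "1 + (\<bar>M (\<nu>\<^sup>2)\<bar> * R + N ?z)"] conjI)
qed

text \<open>By contradiction: two bounded sequences at vanishing distance have, along a subsequence,
  the same weak limit and the same limit of norms. \<open>G_conv\<close> then describes both
  gradients with the same coefficients, and these differ by a multiple of the vanishing
  distance.\<close>

lemma G_uc':
  assumes "d > 0"
  shows "\<exists>a>0. \<forall>u\<in>V. \<forall>v\<in>V. N u \<le> R \<longrightarrow> N v \<le> R \<longrightarrow> N (u - v) \<le> a \<longrightarrow> N (G u - G v) \<le> d"
proof (rule ccontr)
  assume H: "\<not> ?thesis"
  have "\<exists>u\<in>V. \<exists>v\<in>V. N u \<le> R \<and> N v \<le> R \<and> N (u - v) \<le> 1 / real (Suc k) \<and> d < N (G u - G v)" for k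
    using H by (auto simp: not_le dest: spec[of _ "1 / real (Suc k)"])
  then obtain X Y where XY: "\<And>k. X k \<in> V" "\<And>k. Y k \<in> V" "\<And>k. N (X k) \<le> R" "\<And>k. N (Y k) \<le> R"
    "\<And>k. N (X k - Y k) \<le> 1 / real (Suc k)" "\<And>k. d < N (G (X k) - G (Y k))" by metis
  obtain r1 u \<nu> where r1: "strict_mono r1" "u \<in> V" "conv (\<lambda>k. X (r1 k)) u" "(\<lambda>k. N (X (r1 k))) \<longlonglongrightarrow> \<nu>" "0 \<le> \<nu>"
    by (rule weak_subsequence[OF XY(1,3)])
  have "\<exists>r v. strict_mono r \<and> v \<in> V \<and> conv (\<lambda>k. Y (r1 (r k))) v"
    by (rule conv_compact[of "\<lambda>k. Y (r1 k)"]) (rule XY)+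
  then obtain r2 v where r2: "strict_mono r2" "v \<in> V" "conv (\<lambda>k. Y (r1 (r2 k))) v" by blast
  define r where "r k = r1 (r2 k)" for k
  have r: "strict_mono r" using strict_mono_o[OF r1(1) r2(1)] by (simp add: r_def[abs_def] o_def)
  have cX: "conv (\<lambda>k. X (r k)) u" using conv_subseq[OF r1(3) r2(1)] by (simp add: r_def)
  have \<nu>X: "(\<lambda>k. N (X (r k))) \<longlonglongrightarrow> \<nu>" using LIMSEQ_subseq_LIMSEQ[OF r1(4) r2(1)] by (simp add: r_def o_def)
  have cY0: "conv (\<lambda>k. Y (r k)) v" using r2(3) by (simp add: r_def)
  have lim: "(\<lambda>k. 1 / real (Suc (r k))) \<longlonglongrightarrow> 0"
    using LIMSEQ_subseq_LIMSEQ[OF LIMSEQ_Suc[OF lim_1_over_n] r] by (simp add: o_def)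
  have XY0: "(\<lambda>k. N (X (r k) - Y (r k))) \<longlonglongrightarrow> 0"
    by (rule tendsto_of_abs_diff_le[OF always_eventually lim]) (use XY in auto)
  \<comment> \<open>Lower semicontinuity applied to the tail of the differences shows that the two
    weak limits differ by a null vector.\<close>
  have "N (u - v) \<le> a" if "a > 0" for a
  proof -
    have "\<forall>\<^sub>F k in sequentially. N (X (r k) - Y (r k)) < a" using XY0 that by (rule order_tendstoD)
    then obtain n where n: "\<And>k. k \<ge> n \<Longrightarrow> N (X (r k) - Y (r k)) < a" unfolding eventually_sequentially by blast
    have sm: "strict_mono (\<lambda>k. k + n)" by (simp add: strict_mono_def)
    have "conv (\<lambda>k. X (r (k + n)) - Y (r (k + n))) (u - v)"
      using conv_subseq[OF conv_diff[OF cX cY0] sm] .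
    moreover have "N (X (r (k + n)) - Y (r (k + n))) \<le> a" for k using n[of "k + n"] by simp
    moreover have "X (r (k + n)) - Y (r (k + n)) \<in> V" for k using XY(1,2) by (intro V_diff)
    moreover have "u - v \<in> V" using r1(2) r2(2) by (intro V_diff)
    ultimately show ?thesis using conv_lsc[of "\<lambda>k. X (r (k + n)) - Y (r (k + n))" "u - v" a] by simp
  qed
  then have "N (u - v) \<le> 0" by (rule field_le_epsilon) simp
  then have "N (v - u) \<le> 0" using N_diff_commute[OF r1(2) r2(2)] by simp
  then have uv: "N (v - u) = 0" using r1(2) r2(2) by (intro antisym N_nonneg V_diff)
  have cY: "conv (\<lambda>k. Y (r k)) u" using conv_null[OF cY0 r2(2) r1(2) uv] .
  have \<nu>Y: "(\<lambda>k. N (Y (r k))) \<longlonglongrightarrow> \<nu>"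
  proof -
    have "(\<lambda>k. N (Y (r k)) - N (X (r k))) \<longlonglongrightarrow> 0"
      by (rule tendsto_of_abs_diff_le[OF always_eventually XY0])
         (use N_diff_abs[OF XY(1,2)] in \<open>simp add: abs_minus_commute\<close>)
    from tendsto_add[OF this \<nu>X] show ?thesis by simp
  qed
  let ?Z = "\<lambda>W k. N (G (W (r k)) - (M (\<nu>\<^sup>2) *\<^sub>R W (r k) - e (J u) *\<^sub>R gJ u))"
  have "(\<lambda>k. ?Z X k + \<bar>M (\<nu>\<^sup>2)\<bar> * N (X (r k) - Y (r k)) + ?Z Y k) \<longlonglongrightarrow> 0 + \<bar>M (\<nu>\<^sup>2)\<bar> * 0 + 0"
    by (intro tendsto_intros XY0 G_conv[where R = R] XY r1 cX cY \<nu>X \<nu>Y)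
  then have "\<forall>\<^sub>F k in sequentially. ?Z X k + \<bar>M (\<nu>\<^sup>2)\<bar> * N (X (r k) - Y (r k)) + ?Z Y k < d"
    by (rule order_tendstoD) (use \<open>d > 0\<close> in simp)
  from eventually_happens'[OF sequentially_bot this]
  obtain k where k: "?Z X k + \<bar>M (\<nu>\<^sup>2)\<bar> * N (X (r k) - Y (r k)) + ?Z Y k < d" ..
  define z where "z = e (J u) *\<^sub>R gJ u"
  define x y where "x = X (r k)" and "y = Y (r k)"
  have V: "z \<in> V" "x \<in> V" "y \<in> V" "G x \<in> V" "G y \<in> V"
    using XY r1 gJ G_V' by (auto simp: z_def x_def y_def)
  let ?a = "G x - (M (\<nu>\<^sup>2) *\<^sub>R x - z)" and ?b = "M (\<nu>\<^sup>2) *\<^sub>R (x - y)" and ?c = "G y - (M (\<nu>\<^sup>2) *\<^sub>R y - z)"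
  have "G x - G y = ?a + ?b - ?c" by (simp add: algebra_simps)
  moreover have "N (?a + ?b - ?c) \<le> N ?a + N ?b + N ?c"
    using N_triangle_diff[of "?a + ?b" ?c] N_triangle[of ?a ?b] V by simp
  moreover have "N ?b = \<bar>M (\<nu>\<^sup>2)\<bar> * N (x - y)" using V by (simp add: N_scale)
  ultimately have "N (G x - G y) \<le> N ?a + \<bar>M (\<nu>\<^sup>2)\<bar> * N (x - y) + N ?c" by (simp only:)
  then show False using k XY(6)[of "r k"] unfolding x_def y_def z_def by linarith
qed

section \<open>Coercivity, differentiability and the Palais-Smale condition for the energy\<close>

lemma P_cont: "continuous_on {0..} P"
  using P_deriv by (auto simp: continuous_on_eq_continuous_within intro: DERIV_continuous)

lemma P_diff_ge: "0 \<le> a \<Longrightarrow> a \<le> b \<Longrightarrow> m * (b - a) \<le> P b - P a"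
  by (rule derivative_lower_bound[OF P_deriv M_ge])

lemma P_mono: assumes "0 \<le> a" "a \<le> b" shows "P a \<le> P b"
  using P_diff_ge[OF assms] m_pos assms by (smt (verit) mult_nonneg_nonneg)

text \<open>\<open>P\<close> grows at least linearly with slope \<open>m\<close>, while
  \<open>E\<close> never exceeds \<open>S\<close>. The bound does not involve \<open>l\<close>
  explicitly, and this is what makes the final radius uniform.\<close>

lemma N_le_of_\<Phi>:
  assumes "u \<in> V" "\<Phi> u \<le> c" shows "N u \<le> sqrt (2 * (c + S) / m)"
proof (rule real_le_rsqrt)
  have "m * (N u)\<^sup>2 \<le> P ((N u)\<^sup>2)" using P_diff_ge[of 0 "(N u)\<^sup>2"] P_0 by simp
  also have "\<dots> \<le> 2 * (c + S)" using assms E_range[OF J_range[OF assms(1)]] by (simp add: \<Phi>_def)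
  finally show "(N u)\<^sup>2 \<le> 2 * (c + S) / m" using m_pos by (simp add: field_simps)
qed

text \<open>\<open>P\<close> is differentiable only from the right at 0, so the chain rule is used
  relative to the range of \<open>?n\<close>, which lies in the half-line.\<close>

lemma \<Phi>_deriv:
  assumes "u \<in> V" "v \<in> V"
  shows "((\<lambda>t. \<Phi> (u + t *\<^sub>R v)) has_real_derivative B (G u) v) (at 0)"
proof -
  let ?n = "\<lambda>t. (N (u + t *\<^sub>R v))\<^sup>2"
  have n: "?n = (\<lambda>t. (N u)\<^sup>2 + 2 * t * B u v + t\<^sup>2 * (N v)\<^sup>2)"
    using assms by (auto simp: N_add_sq B_simps N_scale power_mult_distrib)
  have "(?n has_real_derivative 2 * B u v) (at 0)"
    unfolding n by (auto intro!: derivative_eq_intros)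
  moreover have "(P has_real_derivative M (?n 0)) (at (?n 0) within range ?n)"
    by (rule DERIV_subset[OF P_deriv]) auto
  ultimately have "(P \<circ> ?n has_real_derivative M (?n 0) * (2 * B u v)) (at 0)"
    by (intro DERIV_image_chain) simp_all
  then have 1: "((\<lambda>t. P (?n t)) has_real_derivative M ((N u)\<^sup>2) * (2 * B u v)) (at 0)"
    by (simp add: o_def)
  have "((\<lambda>t. E (J (u + t *\<^sub>R v))) has_real_derivative e (J (u + 0 *\<^sub>R v)) * DJ u v) (at 0)"
    by (rule DERIV_chain2[OF _ J_deriv[OF assms]]) 
       (use assms in \<open>auto intro: E_deriv J_range simp del: atLeastAtMost_iff\<close>)
  from DERIV_diff[OF DERIV_cdivide[OF 1, of 2] this]
  have "((\<lambda>t. P (?n t) / 2 - E (J (u + t *\<^sub>R v))) has_real_derivative M ((N u)\<^sup>2) * B u v - e (J u) * DJ u v) (at 0)"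
    by simp
  moreover have "B (G u) v = M ((N u)\<^sup>2) * B u v - e (J u) * DJ u v"
    using assms gJ[OF assms(1)] by (simp add: G_def B_simps)
  ultimately show ?thesis unfolding \<Phi>_def by simp
qed

text \<open>By \<open>G_conv\<close> the gradient is close to \<open>c *\<^sub>R X - z\<close> with
  \<open>c = M (\<nu>\<^sup>2) > 0\<close>. If it tends to 0, the sequence converges strongly to
  \<open>z\<close> divided by \<open>c\<close>.\<close>

lemma palais_smale':
  assumes X: "\<And>k::nat. X k \<in> V" "\<And>k. N (X k) \<le> R" and G0: "(\<lambda>k. N (G (X k))) \<longlonglongrightarrow> 0"
  shows "\<exists>r u. strict_mono r \<and> u \<in> V \<and> (\<lambda>k. N (X (r k) - u)) \<longlonglongrightarrow> 0"
proof -
  obtain r u \<nu> where r: "strict_mono r" "u \<in> V" "conv (\<lambda>k. X (r k)) u" "(\<lambda>k. N (X (r k))) \<longlonglongrightarrow> \<nu>" "0 \<le> \<nu>"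
    by (rule weak_subsequence[OF X])
  define z where "z = e (J u) *\<^sub>R gJ u"
  define c where "c = M (\<nu>\<^sup>2)"
  have z: "z \<in> V" using r gJ by (simp add: z_def)
  have c: "c > 0" using M_ge[of "\<nu>\<^sup>2"] m_pos by (simp add: c_def)
  have "(\<lambda>k. N (G (X (r k)) - (c *\<^sub>R X (r k) - z))) \<longlonglongrightarrow> 0"
    unfolding z_def c_def by (rule G_conv[OF X r(2-5)])
  moreover have "(\<lambda>k. N (G (X (r k)))) \<longlonglongrightarrow> 0"
    using LIMSEQ_subseq_LIMSEQ[OF G0 r(1)] by (simp add: o_def)
  ultimately have lim: "(\<lambda>k. (N (G (X (r k)) - (c *\<^sub>R X (r k) - z)) + N (G (X (r k)))) / c) \<longlonglongrightarrow> (0 + 0) / c"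
    by (intro tendsto_intros) (use c in auto)
  have "(\<lambda>k. N (X (r k) - (1 / c) *\<^sub>R z)) \<longlonglongrightarrow> 0"
  proof (rule tendsto_of_abs_diff_le[OF always_eventually])
    show "(\<lambda>k. (N (G (X (r k)) - (c *\<^sub>R X (r k) - z)) + N (G (X (r k)))) / c) \<longlonglongrightarrow> 0" using lim by simp
    show "\<forall>k. \<bar>N (X (r k) - (1 / c) *\<^sub>R z) - 0\<bar> \<le> (N (G (X (r k)) - (c *\<^sub>R X (r k) - z)) + N (G (X (r k)))) / c"
    proof
      fix k
      let ?x = "X (r k)"
      have V: "?x \<in> V" "G ?x \<in> V" using X G_V' by auto
      have "c * N (?x - (1 / c) *\<^sub>R z) = N (c *\<^sub>R (?x - (1 / c) *\<^sub>R z))" using c V z by (simp add: N_scale)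
      also have "c *\<^sub>R (?x - (1 / c) *\<^sub>R z) = c *\<^sub>R ?x - z" using c by (simp add: scaleR_diff_right)
      also have "N (c *\<^sub>R ?x - z) \<le> N (c *\<^sub>R ?x - z - G ?x) + N (G ?x)"
        using N_triangle[of "c *\<^sub>R ?x - z - G ?x" "G ?x"] V z by simp
      also have "N (c *\<^sub>R ?x - z - G ?x) = N (G ?x - (c *\<^sub>R ?x - z))" using V z by (intro N_diff_commute) auto
      finally have "N (?x - (1 / c) *\<^sub>R z) * c \<le> N (G ?x - (c *\<^sub>R ?x - z)) + N (G ?x)" by (simp add: mult.commute)
      then have "N (?x - (1 / c) *\<^sub>R z) \<le> (N (G ?x - (c *\<^sub>R ?x - z)) + N (G ?x)) / c"
        using c by (simp add: pos_le_divide_eq)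
      then show "\<bar>N (?x - (1 / c) *\<^sub>R z) - 0\<bar> \<le> (N (G ?x - (c *\<^sub>R ?x - z)) + N (G ?x)) / c"
        using V z by simp
    qed
  qed
  then show ?thesis using r(1) z by (intro exI[of _ r] exI[of _ "(1 / c) *\<^sub>R z"]) simp
qed

section \<open>Constrained minimisers and the three critical points\<close>

sublocale \<Phi>: C1_functional V B N \<Phi> G
proof
  show "\<exists>R. \<forall>u\<in>V. \<Phi> u \<le> c \<longrightarrow> N u \<le> R" for c using N_le_of_\<Phi>[of _ c] by blast
qed (fact G_V' \<Phi>_deriv G_bdd' G_uc' palais_smale')+

sublocale J: differentiable_functional V B N J gJ
proof
  fix u v assume "u \<in> V" "v \<in> V"
  then show "((\<lambda>t. J (u + t *\<^sub>R v)) has_real_derivative B (gJ u) v) (at 0)"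
    using J_deriv[of u v] gJ(2)[of u v] by simp
qed (fact gJ(1) gJ_bdd)+

text \<open>The direct method. A closed condition on \<open>J\<close> survives weak limits because
  \<open>J\<close> is weakly continuous; the \<open>M\<close> part of the energy can only drop,
  since \<open>N u\<close> is at most the limit \<open>\<nu>\<close> of the norms and
  \<open>P\<close> is monotone.\<close>

lemma constrained_minimum:
  assumes T: "closed T" and u0: "u0 \<in> V" "J u0 \<in> T"
  obtains w where "w \<in> V" "J w \<in> T" "\<And>v. v \<in> V \<Longrightarrow> J v \<in> T \<Longrightarrow> \<Phi> w \<le> \<Phi> v"
proof -
  define A where "A = {v \<in> V. J v \<in> T}"
  define c where "c = Inf (\<Phi> ` A)"
  have "- S \<le> \<Phi> v" if "v \<in> V" for v
    using P_mono[of 0 "(N v)\<^sup>2"] P_0 E_range[OF J_range[OF that]] by (simp add: \<Phi>_def)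
  then have bdd: "bdd_below (\<Phi> ` A)" by (auto simp: bdd_below_def A_def)
  have c_le: "c \<le> \<Phi> v" if "v \<in> A" for v
    unfolding c_def using bdd that by (auto intro: cInf_lower)
  have "\<exists>v\<in>A. \<Phi> v < c + 1 / real (Suc k)" for k
  proof -
    have "Inf (\<Phi> ` A) < c + 1 / real (Suc k)" by (simp add: c_def)
    moreover have "\<Phi> ` A \<noteq> {}" using u0 by (auto simp: A_def)
    ultimately show ?thesis using cInf_lessD[of "\<Phi> ` A"] by blast
  qed
  then obtain X where XA: "\<And>k. X k \<in> A" and Xc: "\<And>k. \<Phi> (X k) < c + 1 / real (Suc k)" by metis
  have X: "X k \<in> V" "J (X k) \<in> T" for k using XA by (auto simp: A_def)
  have XR: "N (X k) \<le> sqrt (2 * (c + 1 + S) / m)" for k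
  proof (rule N_le_of_\<Phi>[OF X(1)])
    have "1 / real (Suc k) \<le> 1" by simp
    then show "\<Phi> (X k) \<le> c + 1" using Xc[of k] by linarith
  qed
  obtain r u \<nu> where r: "strict_mono r" "u \<in> V" "conv (\<lambda>k. X (r k)) u" "(\<lambda>k. N (X (r k))) \<longlonglongrightarrow> \<nu>" "0 \<le> \<nu>"
    by (rule weak_subsequence[OF X(1) XR])
  have JX: "(\<lambda>k. J (X (r k))) \<longlonglongrightarrow> J u" by (rule J_conv[OF X(1) r(2,3) XR])
  then have JT: "J u \<in> T" using closed_sequentially[OF T, of "\<lambda>k. J (X (r k))"] X by blast
  \<comment> \<open>\<open>conv_lsc\<close> wants a bound valid for all indices, so it is applied to
    a tail of the sequence.\<close>
  have "N u \<le> \<nu> + d" if "d > 0" for d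
  proof -
    have "\<forall>\<^sub>F k in sequentially. N (X (r k)) < \<nu> + d" using r(4) by (rule order_tendstoD) (use that in simp)
    then obtain n where n: "\<And>k. k \<ge> n \<Longrightarrow> N (X (r k)) < \<nu> + d" by (auto simp: eventually_sequentially)
    have sm: "strict_mono (\<lambda>k. k + n)" by (simp add: strict_mono_def)
    show ?thesis
      by (rule conv_lsc[OF X(1) r(2) conv_subseq[OF r(3) sm]]) (use n in \<open>auto intro: less_imp_le\<close>)
  qed
  then have Nu: "N u \<le> \<nu>" by (rule field_le_epsilon)
  have "(\<lambda>k. P ((N (X (r k)))\<^sup>2)) \<longlonglongrightarrow> P (\<nu>\<^sup>2)"
    by (rule continuous_on_tendsto_compose[OF P_cont]) (auto intro!: tendsto_intros r(4))
  moreover have "(\<lambda>k. E (J (X (r k)))) \<longlonglongrightarrow> E (J u)"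
    using isCont_tendsto_compose[OF DERIV_isCont[OF E_deriv[OF J_range[OF r(2)]]] JX] .
  ultimately have "(\<lambda>k. \<Phi> (X (r k))) \<longlonglongrightarrow> P (\<nu>\<^sup>2) / 2 - E (J u)"
    unfolding \<Phi>_def by (intro tendsto_intros) simp_all
  moreover have "(\<lambda>k. c + 1 / real (Suc (r k))) \<longlonglongrightarrow> c + 0"
    using LIMSEQ_subseq_LIMSEQ[OF LIMSEQ_Suc[OF lim_1_over_n] r(1)] by (intro tendsto_intros) (simp add: o_def)
  ultimately have "P (\<nu>\<^sup>2) / 2 - E (J u) \<le> c + 0"
    by (rule LIMSEQ_le) (use Xc in \<open>auto intro: less_imp_le\<close>)
  moreover have "P ((N u)\<^sup>2) \<le> P (\<nu>\<^sup>2)" using Nu r by (intro P_mono power_mono) auto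
  ultimately have "\<Phi> u \<le> c" by (simp add: \<Phi>_def)
  show ?thesis
  proof (rule that)
    show "u \<in> V" "J u \<in> T" by fact+
    show "\<Phi> u \<le> \<Phi> v" if "v \<in> V" "J v \<in> T" for v
      using c_le[of v] that \<open>\<Phi> u \<le> c\<close> by (simp add: A_def)
  qed
qed

text \<open>Small moves in a fixed direction keep \<open>J\<close> in the open set, so the minimum
  is an unconstrained one along that line. The direction \<open>G w\<close> itself already gives the
  claim.\<close>

lemma interior_minimum_critical:
  assumes w: "w \<in> V" "J w \<in> U" and U: "open U"
    and min: "\<And>v. v \<in> V \<Longrightarrow> J v \<in> U \<Longrightarrow> \<Phi> w \<le> \<Phi> v"
  shows "N (G w) = 0"
proof -
  let ?v = "G w"
  have v: "?v \<in> V" using w G_V' by simp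
  have "isCont (\<lambda>t. J (w + t *\<^sub>R ?v)) 0" using J_deriv[OF w(1) v] by (rule DERIV_isCont)
  then have "\<forall>\<^sub>F t in at 0. J (w + t *\<^sub>R ?v) \<in> U"
    using w U by (intro topological_tendstoD) (auto simp: isCont_def)
  then obtain d where d: "d > 0" "\<And>t. t \<noteq> 0 \<Longrightarrow> \<bar>t\<bar> < d \<Longrightarrow> J (w + t *\<^sub>R ?v) \<in> U"
    by (auto simp: eventually_at dist_real_def)
  have "\<Phi> (w + 0 *\<^sub>R ?v) \<le> \<Phi> (w + t *\<^sub>R ?v)" if "\<bar>0 - t\<bar> < d" for t
    using min[of "w + t *\<^sub>R ?v"] d(2)[of t] w v that by (cases "t = 0") auto
  then have "B ?v ?v = 0" by (intro DERIV_local_min[OF \<Phi>_deriv[OF w(1) v] d(1)]) auto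
  then show ?thesis using v by (simp add: N_def)
qed

text \<open>The sides of the wall tell \<open>w1\<close> from \<open>w2\<close>, and the sign of
  \<open>\<Phi>\<close> tells both from \<open>w3\<close>. The bounds involve only \<open>S\<close>,
  \<open>m\<close> and \<open>P\<close>.\<close>

theorem three_critical_points:
  assumes u1: "u1 \<in> V" "J u1 < l" "\<Phi> u1 < 0" and u2: "u2 \<in> V" "l < J u2" "\<Phi> u2 < 0"
  shows "\<exists>w1\<in>V. \<exists>w2\<in>V. \<exists>w3\<in>V. N (G w1) = 0 \<and> N (G w2) = 0 \<and> N (G w3) = 0 \<and>
    J w1 < l \<and> l < J w2 \<and> \<Phi> w1 < 0 \<and> \<Phi> w2 < 0 \<and> 0 \<le> \<Phi> w3 \<and>
    N w1 \<le> sqrt (2 * S / m) \<and> N w2 \<le> sqrt (2 * S / m) \<and> N w3 \<le> sqrt ((P (2 * S / m) + 2 * S) / m)"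
proof -
  have wall: "0 \<le> \<Phi> v" if "J v = l" for v
    using that P_mono[of 0 "(N v)\<^sup>2"] P_0 E_l by (simp add: \<Phi>_def)
  obtain w1 where w1: "w1 \<in> V" "J w1 \<in> {..l}" "\<And>v. v \<in> V \<Longrightarrow> J v \<in> {..l} \<Longrightarrow> \<Phi> w1 \<le> \<Phi> v"
    by (rule constrained_minimum[of "{..l}" u1]) (use u1 in auto)
  obtain w2 where w2: "w2 \<in> V" "J w2 \<in> {l..}" "\<And>v. v \<in> V \<Longrightarrow> J v \<in> {l..} \<Longrightarrow> \<Phi> w2 \<le> \<Phi> v"
    by (rule constrained_minimum[of "{l..}" u2]) (use u2 in auto)
  have neg: "\<Phi> w1 < 0" "\<Phi> w2 < 0" using w1(3)[of u1] w2(3)[of u2] u1 u2 by auto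
  then have "J w1 \<noteq> l" "J w2 \<noteq> l" using wall by fastforce+
  then have Jw: "J w1 < l" "l < J w2" using w1 w2 by auto
  have crit: "N (G w1) = 0" "N (G w2) = 0"
    using w1 w2 Jw
    by (auto intro!: interior_minimum_critical[of w1 "{..<l}"] interior_minimum_critical[of w2 "{l<..}"])
  have S0: "0 \<le> S" using E_range[OF J_range[OF w1(1)]] by simp
  have Nw: "N w1 \<le> sqrt (2 * S / m)" "N w2 \<le> sqrt (2 * S / m)"
    using N_le_of_\<Phi>[of w1 0] N_le_of_\<Phi>[of w2 0] w1 w2 neg by auto
  have "\<exists>w\<in>V. N (G w) = 0 \<and> 0 \<le> \<Phi> w \<and> \<Phi> w \<le> P (2 * S / m) / 2"
  proof (rule \<Phi>.mountain_pass[OF w1(1) w2(1) crit])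
    fix \<gamma> assume p: "\<Phi>.path_between w1 w2 \<gamma>"
    then have \<gamma>: "\<And>t. \<gamma> t \<in> V" "N (\<gamma> 0 - w1) = 0" "N (\<gamma> 1 - w2) = 0"
      and lim: "\<And>t. t \<in> {0..1} \<Longrightarrow> ((\<lambda>r. N (\<gamma> r - \<gamma> t)) \<longlongrightarrow> 0) (at t within {0..1})"
      by (auto simp: \<Phi>.path_between_def)
    have "continuous_on {0..1} (\<lambda>t. J (\<gamma> t))"
      unfolding continuous_on_def by (intro ballI J.\<Phi>_cont[of \<gamma>] \<gamma>(1) lim)
    moreover have "J (\<gamma> 0) = J w1" "J (\<gamma> 1) = J w2" using \<gamma> w1 w2 by (auto intro: J_eq)
    ultimately obtain t where "0 \<le> t" "t \<le> 1" "J (\<gamma> t) = l"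
      using IVT'[of "\<lambda>t. J (\<gamma> t)" 0 l 1] Jw by auto
    then show "\<exists>t\<in>{0..1}. 0 \<le> \<Phi> (\<gamma> t)" using wall[of "\<gamma> t"] by (intro bexI[of _ t]) auto
  next
    fix t :: real assume t: "t \<in> {0..1}"
    let ?u = "w1 + t *\<^sub>R (w2 - w1)"
    have u: "?u \<in> V" using w1 w2 by simp
    \<comment> \<open>The segment stays in the ball that contains both minimisers. As
      \<open>E\<close> is nonnegative, this bounds the energy on it, hence the mountain pass level,
      and hence the norm of the third point.\<close>
    have "?u = (1 - t) *\<^sub>R w1 + t *\<^sub>R w2" by (simp add: algebra_simps)
    then have "N ?u \<le> (1 - t) * N w1 + t * N w2"
      using N_triangle[of "(1 - t) *\<^sub>R w1" "t *\<^sub>R w2"] w1 w2 t by (simp add: N_scale)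
    also have "\<dots> \<le> (1 - t) * sqrt (2 * S / m) + t * sqrt (2 * S / m)"
      using t Nw by (intro add_mono mult_left_mono) auto
    finally have "N ?u \<le> sqrt (2 * S / m)" by (simp add: algebra_simps)
    then have "(N ?u)\<^sup>2 \<le> (sqrt (2 * S / m))\<^sup>2" using u by (intro power_mono) auto
    then have "(N ?u)\<^sup>2 \<le> 2 * S / m" using S0 m_pos by simp
    then have "P ((N ?u)\<^sup>2) \<le> P (2 * S / m)" by (intro P_mono) auto
    then show "\<Phi> ?u \<le> P (2 * S / m) / 2" using E_range[OF J_range[OF u]] by (simp add: \<Phi>_def)
  qed
  then obtain w3 where w3: "w3 \<in> V" "N (G w3) = 0" "0 \<le> \<Phi> w3" "\<Phi> w3 \<le> P (2 * S / m) / 2" by blast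
  have "N w3 \<le> sqrt ((P (2 * S / m) + 2 * S) / m)" using N_le_of_\<Phi>[OF w3(1,4)] by simp
  then show ?thesis using w1(1) w2(1) w3 crit Jw neg Nw by blast
qed

lemma critical_point_equation:
  assumes "u \<in> V" "N (G u) = 0" "v \<in> V"
  shows "M ((N u)\<^sup>2) * B u v = e (J u) * DJ u v"
proof -
  have "B (G u) v = 0" using Cauchy_Schwarz[of "G u" v] assms G_V' by simp
  then show ?thesis using assms gJ[OF assms(1)] by (simp add: G_def B_simps)
qed

end

section \<open>The fractional Sobolev inequality\<close>

text \<open>The square of the Gagliardo seminorm, with values in the extended nonnegative reals so
  that it is defined for functions of infinite energy too.\<close>

definition gagliardo :: "real \<Rightarrow> ('a::euclidean_space \<Rightarrow> real) \<Rightarrow> ennreal" where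
  "gagliardo s u = (\<integral>\<^sup>+x. \<integral>\<^sup>+y. ennreal ((u x - u y)\<^sup>2 * norm (x - y) powr (- (real DIM('a) + 2 * s))) \<partial>lborel \<partial>lborel)"

text \<open>A ball of volume \<open>2 * m\<close> has radius
  \<open>r = (2 * m / w) powr (1 / n)\<close> with \<open>w\<close> the volume of the unit ball;
  this factor is what remains of \<open>r powr (- (n + 2 * s))\<close> once the power of
  \<open>m\<close> is split off.\<close>

definition sobolev_factor :: "real \<Rightarrow> nat \<Rightarrow> real" where
  "sobolev_factor s n = (2 / unit_ball_vol (real n)) powr (- (1 + 2 * s / real n))"

lemma sobolev_factor_pos: "0 < sobolev_factor s n"
  using unit_ball_vol_pos[of "real n"] by (simp add: sobolev_factor_def del: unit_ball_vol_pos)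

text \<open>
  Let \<open>t = \<bar>u x\<bar> / 2\<close>. By Markov's inequality \<open>\<bar>u\<bar> > t\<close> on a set of measure at most \<open>m = X / t powr p\<close>. In the
  ball around \<open>x\<close> of volume \<open>2 m\<close>, the difference \<open>\<bar>u x - u y\<bar>\<close> is thus at least \<open>t\<close> on a set of measure
  \<open>m\<close>.
\<close>

lemma fractional_energy_lower_bound:
  fixes u :: "'a::euclidean_space \<Rightarrow> real"
  defines "n \<equiv> real DIM('a)"
  assumes s: "0 < s" "2 * s < n" and p: "p = 2 * n / (n - 2 * s)"
    and u [measurable]: "u \<in> borel_measurable borel"
    and X: "(\<integral>\<^sup>+y. ennreal (\<bar>u y\<bar> powr p) \<partial>lborel) = ennreal X" "X > 0"
  shows "ennreal (sobolev_factor s DIM('a) * X powr (- (2 * s / n)) * (\<bar>u x\<bar> / 2) powr p)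
    \<le> (\<integral>\<^sup>+y. ennreal ((u x - u y)\<^sup>2 * norm (x - y) powr (- (n + 2 * s))) \<partial>lborel)"
proof (cases "u x = 0")
  case False
  define t where "t = \<bar>u x\<bar> / 2"
  have t: "t > 0" using False by (simp add: t_def)
  have n: "n > 0" by (simp add: n_def)
  have p0: "p > 0" using s n by (simp add: p)
  define m where "m = X / t powr p"
  have m: "m > 0" using X t by (simp add: m_def)
  define w where "w = unit_ball_vol n"
  have w: "w > 0" using n by (simp add: w_def)
  define r where "r = (2 * m / w) powr (1 / n)"
  have r: "r > 0" using m w by (simp add: r_def)
  define A where "A = {y. \<bar>u y\<bar> > t}"
  have A [measurable]: "A \<in> sets borel" unfolding A_def by measurable
  define D where "D = ball x r - A"
  have D [measurable]: "D \<in> sets borel" unfolding D_def by measurable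
  have "emeasure lborel A \<le> emeasure lborel {y \<in> space lborel. 1 \<le> ennreal (1 / t powr p) * ennreal (\<bar>u y\<bar> powr p)}"
  proof (intro emeasure_mono subsetI)
    fix y assume "y \<in> A"
    then have "t powr p \<le> \<bar>u y\<bar> powr p" using t p0 by (intro powr_mono2) (auto simp: A_def)
    then have "1 \<le> 1 / t powr p * \<bar>u y\<bar> powr p" using t by (simp add: field_simps)
    then show "y \<in> {y \<in> space lborel. 1 \<le> ennreal (1 / t powr p) * ennreal (\<bar>u y\<bar> powr p)}"
      by (simp flip: ennreal_mult)
  qed measurable
  also have "\<dots> \<le> ennreal (1 / t powr p) * (\<integral>\<^sup>+y. ennreal (\<bar>u y\<bar> powr p) * indicator (space lborel) y \<partial>lborel)"
    by (rule nn_integral_Markov_inequality) auto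
  also have "\<dots> = ennreal m" using X by (simp add: m_def flip: ennreal_mult)
  finally have eA: "emeasure lborel A \<le> ennreal m" .
  have "r ^ DIM('a) = 2 * m / w"
    using r m w n by (simp add: r_def n_def powr_powr flip: powr_realpow)
  then have eB: "emeasure lborel (ball x r) = ennreal (2 * m)"
    using r w by (simp add: emeasure_ball flip: w_def n_def)
  have "ennreal (2 * m) = emeasure lborel D + emeasure lborel (ball x r \<inter> A)"
    unfolding D_def eB[symmetric] by (subst plus_emeasure) (auto intro: arg_cong[where f = "emeasure lborel"])
  also have "\<dots> \<le> emeasure lborel D + ennreal m"
    using eA by (intro add_left_mono order_trans[OF emeasure_mono eA]) auto
  finally have "ennreal (2 * m) - ennreal m \<le> emeasure lborel D"
    by (simp add: ennreal_minus_le_iff add.commute)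
  then have eD: "ennreal m \<le> emeasure lborel D" using m by (simp add: ennreal_minus)
  \<comment> \<open>This identity singles out the critical exponent: the squared difference
    contributes 2 and the measure \<open>m\<close> contributes \<open>2 * s / n * p\<close>.\<close>
  have expo: "2 + 2 * s / n * p = p" using s n by (simp add: p field_simps)
  have "t\<^sup>2 * r powr (- (n + 2 * s)) * m = sobolev_factor s DIM('a) * X powr (- (2 * s / n)) * t powr p"
  proof -
    have "r powr (- (n + 2 * s)) = (2 * m / w) powr (- (1 + 2 * s / n))"
    proof -
      have "1 / n * (- (n + 2 * s)) = - (1 + 2 * s / n)" using n by (simp add: field_simps)
      then show ?thesis by (simp only: r_def powr_powr)
    qed
    also have "\<dots> = (2 / w) powr (- (1 + 2 * s / n)) * m powr (- (1 + 2 * s / n))"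
      using m w by (simp flip: powr_mult)
    also have "\<dots> * m = (2 / w) powr (- (1 + 2 * s / n)) * m powr (- (2 * s / n))"
    proof -
      have "m powr (- (1 + 2 * s / n)) * m = m powr (- (1 + 2 * s / n) + 1)"
        using m by (simp only: powr_add powr_one)
      then show ?thesis by simp
    qed
    also have "m powr (- (2 * s / n)) = X powr (- (2 * s / n)) * t powr (2 * s / n * p)"
      using X t by (simp add: m_def powr_divide powr_powr powr_minus field_simps)
    finally have "r powr (- (n + 2 * s)) * m = sobolev_factor s DIM('a) * X powr (- (2 * s / n)) * t powr (2 * s / n * p)"
      by (simp add: sobolev_factor_def w_def n_def)
    moreover have "t\<^sup>2 * t powr (2 * s / n * p) = t powr p"
      using t by (subst expo[symmetric], subst powr_add) simp
    ultimately show ?thesis by algebra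
  qed
  then have "ennreal (sobolev_factor s DIM('a) * X powr (- (2 * s / n)) * t powr p)
      = ennreal (t\<^sup>2 * r powr (- (n + 2 * s))) * ennreal m"
    using m by (simp flip: ennreal_mult)
  also have "\<dots> \<le> ennreal (t\<^sup>2 * r powr (- (n + 2 * s))) * emeasure lborel D"
    by (intro mult_left_mono eD) auto
  also have "\<dots> = (\<integral>\<^sup>+y. ennreal (t\<^sup>2 * r powr (- (n + 2 * s))) * indicator D y \<partial>lborel)"
    by (simp add: nn_integral_cmult_indicator)
  also have "\<dots> \<le> (\<integral>\<^sup>+y. ennreal ((u x - u y)\<^sup>2 * norm (x - y) powr (- (n + 2 * s))) \<partial>lborel)"
  proof (rule nn_integral_mono)
    fix y
    show "ennreal (t\<^sup>2 * r powr (- (n + 2 * s))) * indicator D y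
        \<le> ennreal ((u x - u y)\<^sup>2 * norm (x - y) powr (- (n + 2 * s)))"
    proof (cases "y \<in> D")
      case True
      then have uy: "\<bar>u y\<bar> \<le> t" and d: "norm (x - y) < r" by (auto simp: D_def A_def dist_norm)
      have "t \<le> \<bar>u x - u y\<bar>" using uy unfolding t_def by linarith
      then have "t\<^sup>2 \<le> (u x - u y)\<^sup>2" using t by (metis abs_le_square_iff abs_of_pos)
      moreover have "x \<noteq> y" using uy t by (auto simp: t_def)
      then have "r powr (- (n + 2 * s)) \<le> norm (x - y) powr (- (n + 2 * s))"
        using d s n by (intro powr_mono2') auto
      ultimately show ?thesis using True by (auto intro!: ennreal_leI mult_mono)
    qed simp
  qed
  finally show ?thesis by (simp add: t_def)
qed (use s in \<open>simp add: p n_def\<close>)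

text \<open>Integrating the pointwise bound over \<open>x\<close> gives a constant times
  \<open>X powr (1 - 2 * s / n)\<close>, that is \<open>X powr (2 / p)\<close>, on the left.
  Combining the powers of \<open>X\<close> presupposes that \<open>X\<close> is finite.\<close>

lemma sobolev_bounded:
  fixes u :: "'a::euclidean_space \<Rightarrow> real"
  defines "n \<equiv> real DIM('a)"
  assumes s: "0 < s" "2 * s < n" and p: "p = 2 * n / (n - 2 * s)"
    and u [measurable]: "u \<in> borel_measurable borel"
    and fin: "(\<integral>\<^sup>+y. ennreal (\<bar>u y\<bar> powr p) \<partial>lborel) < \<infinity>"
    and A: "gagliardo s u \<le> ennreal A" "0 \<le> A"
  shows "(\<integral>\<^sup>+y. ennreal (\<bar>u y\<bar> powr p) \<partial>lborel)
    \<le> ennreal ((2 powr p / sobolev_factor s DIM('a) * A) powr (p / 2))"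
proof -
  have n: "n > 0" by (simp add: n_def)
  have p0: "p > 0" using s n by (simp add: p)
  obtain X where X: "(\<integral>\<^sup>+y. ennreal (\<bar>u y\<bar> powr p) \<partial>lborel) = ennreal X" "X \<ge> 0"
    using fin by (auto simp: less_top_ennreal)
  show ?thesis
  proof (cases "X = 0")
    case False
    then have X0: "X > 0" using X by simp
    define c where "c = sobolev_factor s DIM('a)"
    have c: "c > 0" by (simp add: c_def sobolev_factor_pos)
    have "ennreal (c * X powr (- (2 * s / n)) / 2 powr p) * (\<integral>\<^sup>+x. ennreal (\<bar>u x\<bar> powr p) \<partial>lborel)
      = (\<integral>\<^sup>+x. ennreal (c * X powr (- (2 * s / n)) * (\<bar>u x\<bar> / 2) powr p) \<partial>lborel)"
      using c by (subst nn_integral_cmult[symmetric])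
        (auto intro!: nn_integral_cong simp: powr_divide simp flip: ennreal_mult)
    also have "\<dots> \<le> gagliardo s u"
      unfolding gagliardo_def c_def n_def
      by (intro nn_integral_mono fractional_energy_lower_bound) (use s p X X0 in \<open>auto simp: n_def\<close>)
    also have "\<dots> \<le> ennreal A" by fact
    finally have "c * X powr (- (2 * s / n)) / 2 powr p * X \<le> A"
      using X A c by (simp flip: ennreal_mult)
    then have "X powr (- (2 * s / n)) * X \<le> 2 powr p / c * A" using c by (simp add: field_simps)
    also have "X powr (- (2 * s / n)) * X = X powr (2 / p)"
    proof -
      have "X powr (- (2 * s / n)) * X = X powr (- (2 * s / n) + 1)" using X0 by (simp only: powr_add powr_one)
      also have "- (2 * s / n) + 1 = 2 / p" using n s by (simp add: p field_simps)
      finally show ?thesis .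
    qed
    finally have "(X powr (2 / p)) powr (p / 2) \<le> (2 powr p / c * A) powr (p / 2)"
      using p0 by (intro powr_mono2) auto
    then show ?thesis using p0 X X0 by (simp add: powr_powr c_def ennreal_leI)
  qed (use X in simp)
qed

text \<open>Truncation at height \<open>k\<close> makes the p-th power integrable, as the support is
  bounded. It does not increase the energy, being 1-Lipschitz, and Fatou's lemma removes it.\<close>

lemma sobolev_inequality:
  fixes u :: "'a::euclidean_space \<Rightarrow> real"
  defines "n \<equiv> real DIM('a)"
  assumes s: "0 < s" "2 * s < n" and p: "p = 2 * n / (n - 2 * s)"
    and u [measurable]: "u \<in> borel_measurable borel"
    and supp: "\<And>x. x \<notin> S \<Longrightarrow> u x = 0" "bounded S"
    and A: "gagliardo s u \<le> ennreal A" "0 \<le> A"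
  shows "(\<integral>\<^sup>+y. ennreal (\<bar>u y\<bar> powr p) \<partial>lborel)
    \<le> ennreal ((2 powr p / sobolev_factor s DIM('a) * A) powr (p / 2))" (is "_ \<le> ?C")
proof -
  have n: "n > 0" by (simp add: n_def)
  have p0: "p > 0" using s n by (simp add: p)
  define T where "T k x = max (- real k) (min (real k) (u x))" for k :: nat and x
  have T [measurable]: "T k \<in> borel_measurable borel" for k unfolding T_def by measurable
  have le: "(\<integral>\<^sup>+y. ennreal (\<bar>T k y\<bar> powr p) \<partial>lborel) \<le> ?C" for k
    unfolding n_def[symmetric]
  proof (rule sobolev_bounded)
    obtain a b where ab: "S \<subseteq> cbox a b" by (meson bounded_subset_cbox_symmetric supp(2))
    have "(\<integral>\<^sup>+y. ennreal (\<bar>T k y\<bar> powr p) \<partial>lborel) \<le> (\<integral>\<^sup>+y. ennreal (real k powr p) * indicator (cbox a b) y \<partial>lborel)"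
    proof (rule nn_integral_mono)
      fix y
      show "ennreal (\<bar>T k y\<bar> powr p) \<le> ennreal (real k powr p) * indicator (cbox a b) y"
      proof (cases "y \<in> cbox a b")
        case True
        have "\<bar>T k y\<bar> \<le> real k" by (auto simp: T_def)
        then show ?thesis using True p0 by (auto intro!: ennreal_leI powr_mono2)
      next
        case False
        then have "u y = 0" using supp(1)[of y] ab by blast
        then have "T k y = 0" by (simp add: T_def)
        then show ?thesis using p0 by simp
      qed
    qed
    also have "\<dots> < \<infinity>"
      using emeasure_bounded_finite[OF bounded_cbox[of a b]]
      by (simp add: nn_integral_cmult_indicator ennreal_mult_less_top)
    finally show "(\<integral>\<^sup>+y. ennreal (\<bar>T k y\<bar> powr p) \<partial>lborel) < \<infinity>" .
    have "gagliardo s (T k) \<le> gagliardo s u"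
      unfolding gagliardo_def
    proof (intro nn_integral_mono ennreal_leI mult_right_mono)
      fix x y
      have "\<bar>T k x - T k y\<bar> \<le> \<bar>u x - u y\<bar>" by (auto simp: T_def)
      then show "(T k x - T k y)\<^sup>2 \<le> (u x - u y)\<^sup>2" by (simp add: abs_le_square_iff)
    qed simp
    then show "gagliardo s (T k) \<le> ennreal A" using A by simp
  qed (use s p A in \<open>auto simp: n_def\<close>)
  have lim: "(\<lambda>k. ennreal (\<bar>T k y\<bar> powr p)) \<longlonglongrightarrow> ennreal (\<bar>u y\<bar> powr p)" for y
  proof (rule tendsto_eventually)
    obtain m where m: "\<bar>u y\<bar> \<le> real m" using real_arch_simple by blast
    show "\<forall>\<^sub>F k in sequentially. ennreal (\<bar>T k y\<bar> powr p) = ennreal (\<bar>u y\<bar> powr p)"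
      using eventually_ge_at_top[of m]
    proof eventually_elim
      case (elim k)
      then have "\<bar>u y\<bar> \<le> real k" using m by simp
      then have "T k y = u y" by (auto simp: T_def)
      then show ?case by simp
    qed
  qed
  have "(\<integral>\<^sup>+y. ennreal (\<bar>u y\<bar> powr p) \<partial>lborel) = (\<integral>\<^sup>+y. liminf (\<lambda>k. ennreal (\<bar>T k y\<bar> powr p)) \<partial>lborel)"
    using lim_imp_Liminf[OF _ lim] by simp
  also have "\<dots> \<le> liminf (\<lambda>k. \<integral>\<^sup>+y. ennreal (\<bar>T k y\<bar> powr p) \<partial>lborel)"
    by (rule nn_integral_liminf) measurable
  also have "\<dots> \<le> ?C"
    using le by (intro Liminf_le) auto
  finally show ?thesis .
qed

section \<open>A Poincare inequality on grid cells\<close>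

abbreviation kernel :: "real \<Rightarrow> ('a::real_normed_vector \<Rightarrow> real) \<Rightarrow> 'a \<Rightarrow> 'a \<Rightarrow> ennreal" where
  "kernel q w x y \<equiv> ennreal ((w x - w y)\<^sup>2 * norm (x - y) powr (- q))"

lemma sum_eq_single:
  assumes "finite Z" "d \<in> Z" "\<And>e. e \<in> Z \<Longrightarrow> e \<noteq> d \<Longrightarrow> f e = 0"
  shows "sum f Z = f d"
  using assms by (simp add: sum.remove[of Z d])

text \<open>
  On a set \<open>D\<close> of measure \<open>a\<close>, the double integral of \<open>(w x - w y)\<^sup>2\<close> over \<open>D \<times> D\<close> equals \<open>2 a\<close> times the
  integral of \<open>w\<^sup>2\<close> minus twice the square of the integral of \<open>w\<close>.
\<close>

lemma cell_poincare:
  fixes w :: "'a::euclidean_space \<Rightarrow> real"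
  assumes w [measurable]: "w \<in> borel_measurable borel" and w2: "integrable lborel (\<lambda>x. (w x)\<^sup>2)"
    and D [measurable]: "D \<in> sets borel" and a: "emeasure lborel D = ennreal a" "a > 0"
    and d: "\<And>x y. x \<in> D \<Longrightarrow> y \<in> D \<Longrightarrow> norm (x - y) \<le> d" and q: "q > 0"
  shows "ennreal (LINT x:D|lborel. (w x)\<^sup>2) \<le> ennreal ((LINT x:D|lborel. w x)\<^sup>2 / a) +
    ennreal (d powr q / (2 * a)) *
      (\<integral>\<^sup>+x. \<integral>\<^sup>+y. kernel q w x y * indicator D x * indicator D y \<partial>lborel \<partial>lborel)"
proof -
  define v where "v x = indicator D x * w x" for x
  have [measurable]: "v \<in> borel_measurable borel" unfolding v_def by measurable
  define W where "W = (LINT x|lborel. (v x)\<^sup>2)"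
  define I where "I = (LINT x|lborel. v x)"
  have D1: "integrable lborel (indicator D :: 'a \<Rightarrow> real)"
    using a by (intro integrable_real_indicator) auto
  have v2eq: "(v x)\<^sup>2 = indicator D x * (w x)\<^sup>2" for x by (simp add: v_def indicator_def)
  have v2: "integrable lborel (\<lambda>x. (v x)\<^sup>2)"
    unfolding v2eq by (rule Bochner_Integration.integrable_bound[OF w2]) (auto simp: indicator_def)
  have v1: "integrable lborel v"
  proof (rule Bochner_Integration.integrable_bound)
    show "integrable lborel (\<lambda>x. indicator D x + (v x)\<^sup>2)" using D1 v2 by simp
    have "\<bar>t\<bar> \<le> 1 + t\<^sup>2" for t :: real by (sos)
    then show "AE x in lborel. norm (v x) \<le> norm (indicator D x + (v x)\<^sup>2)"
      by (auto simp: v_def indicator_def)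
  qed simp
  have mD: "(LINT x|lborel. indicator D x :: real) = a" using a by (simp add: measure_def)
  have inner: "(\<integral>\<^sup>+y. ennreal ((w x - w y)\<^sup>2) * indicator D y \<partial>lborel) = ennreal (a * (w x)\<^sup>2 - 2 * w x * I + W)" for x
  proof -
    have eq: "(w x - w y)\<^sup>2 * indicator D y = (w x)\<^sup>2 * indicator D y - 2 * w x * v y + (v y)\<^sup>2" for y
      by (simp add: v_def indicator_def power2_diff)
    have "(\<integral>\<^sup>+y. ennreal ((w x - w y)\<^sup>2) * indicator D y \<partial>lborel)
      = (\<integral>\<^sup>+y. ennreal ((w x - w y)\<^sup>2 * indicator D y) \<partial>lborel)"
      by (intro nn_integral_cong) (simp add: indicator_def)
    also have "\<dots> = ennreal (LINT y|lborel. (w x - w y)\<^sup>2 * indicator D y)"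
    proof (rule nn_integral_eq_integral)
      show "integrable lborel (\<lambda>y. (w x - w y)\<^sup>2 * indicator D y)" unfolding eq using D1 v1 v2 by simp
    qed simp
    also have "(LINT y|lborel. (w x - w y)\<^sup>2 * indicator D y) = a * (w x)\<^sup>2 - 2 * w x * I + W"
      using D1 v1 v2 mD unfolding eq by (simp add: I_def W_def)
    finally show ?thesis .
  qed
  have nonneg: "0 \<le> a * (w x)\<^sup>2 - 2 * w x * I + W" for x
  proof -
    have "0 \<le> (LINT y|lborel. (w x - w y)\<^sup>2 * indicator D y)" by simp
    also have "(\<lambda>y. (w x - w y)\<^sup>2 * indicator D y) = (\<lambda>y. (w x)\<^sup>2 * indicator D y - 2 * w x * v y + (v y)\<^sup>2)"
      by (auto simp: v_def indicator_def power2_diff)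
    also have "(LINT y|lborel. (w x)\<^sup>2 * indicator D y - 2 * w x * v y + (v y)\<^sup>2) = a * (w x)\<^sup>2 - 2 * w x * I + W"
      using D1 v1 v2 mD by (simp add: I_def W_def)
    finally show ?thesis .
  qed
  have "(\<integral>\<^sup>+x. \<integral>\<^sup>+y. ennreal ((w x - w y)\<^sup>2) * indicator D x * indicator D y \<partial>lborel \<partial>lborel)
    = (\<integral>\<^sup>+x. ennreal (indicator D x * (a * (w x)\<^sup>2 - 2 * w x * I + W)) \<partial>lborel)"
  proof (rule nn_integral_cong)
    fix x
    have "(\<integral>\<^sup>+y. ennreal ((w x - w y)\<^sup>2) * indicator D x * indicator D y \<partial>lborel)
      = (\<integral>\<^sup>+y. indicator D x * (ennreal ((w x - w y)\<^sup>2) * indicator D y) \<partial>lborel)"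
      by (simp add: mult_ac)
    also have "\<dots> = indicator D x * ennreal (a * (w x)\<^sup>2 - 2 * w x * I + W)"
      by (subst nn_integral_cmult) (auto simp: inner)
    finally show "(\<integral>\<^sup>+y. ennreal ((w x - w y)\<^sup>2) * indicator D x * indicator D y \<partial>lborel)
      = ennreal (indicator D x * (a * (w x)\<^sup>2 - 2 * w x * I + W))"
      by (simp add: indicator_def)
  qed
  also have "(\<lambda>x. indicator D x * (a * (w x)\<^sup>2 - 2 * w x * I + W)) = (\<lambda>x. a * (v x)\<^sup>2 - 2 * I * v x + W * indicator D x)"
    by (auto simp: v_def indicator_def algebra_simps)
  also have "(\<integral>\<^sup>+x. ennreal (a * (v x)\<^sup>2 - 2 * I * v x + W * indicator D x) \<partial>lborel)
      = ennreal (LINT x|lborel. a * (v x)\<^sup>2 - 2 * I * v x + W * indicator D x)"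
  proof (rule nn_integral_eq_integral)
    show "AE x in lborel. 0 \<le> a * (v x)\<^sup>2 - 2 * I * v x + W * indicator D x"
    proof (rule AE_I2)
      fix x show "0 \<le> a * (v x)\<^sup>2 - 2 * I * v x + W * indicator D x"
        using nonneg[of x] by (simp add: v_def indicator_def algebra_simps)
    qed
  qed (use D1 v1 v2 in simp)
  finally have "(\<integral>\<^sup>+x. \<integral>\<^sup>+y. ennreal ((w x - w y)\<^sup>2) * indicator D x * indicator D y \<partial>lborel \<partial>lborel)
    = ennreal (LINT x|lborel. a * (v x)\<^sup>2 - 2 * I * v x + W * indicator D x)" .
  moreover have "(LINT x|lborel. a * (v x)\<^sup>2 - 2 * I * v x + W * indicator D x) = 2 * (a * W - I\<^sup>2)"
    using D1 v1 v2 mD by (simp add: I_def W_def power2_eq_square)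
  moreover have pos: "0 \<le> a * W - I\<^sup>2"
  proof -
    have "0 \<le> (LINT x|lborel. a * (v x)\<^sup>2 - 2 * I * v x + W * indicator D x)"
    proof (rule integral_nonneg_AE, rule AE_I2)
      fix x show "0 \<le> a * (v x)\<^sup>2 - 2 * I * v x + W * indicator D x"
        using nonneg[of x] by (simp add: v_def indicator_def algebra_simps)
    qed
    also have "\<dots> = 2 * (a * W - I\<^sup>2)" by fact
    finally show ?thesis by simp
  qed
  ultimately have eq: "(\<integral>\<^sup>+x. \<integral>\<^sup>+y. ennreal ((w x - w y)\<^sup>2) * indicator D x * indicator D y \<partial>lborel \<partial>lborel) = ennreal (2 * (a * W - I\<^sup>2))" by simp
  define g where "g = (\<integral>\<^sup>+x. \<integral>\<^sup>+y. kernel q w x y * indicator D x * indicator D y \<partial>lborel \<partial>lborel)"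
  \<comment> \<open>Within \<open>D\<close> distances are at most \<open>d\<close>, so the weight
    costs a factor \<open>d powr q\<close>; on the diagonal both integrands vanish.\<close>
  have "ennreal (2 * (a * W - I\<^sup>2)) \<le> (\<integral>\<^sup>+x. \<integral>\<^sup>+y. ennreal (d powr q) *
      (kernel q w x y * indicator D x * indicator D y) \<partial>lborel \<partial>lborel)"
    unfolding eq[symmetric]
  proof (intro nn_integral_mono)
    fix x y
    show "ennreal ((w x - w y)\<^sup>2) * indicator D x * indicator D y \<le>
      ennreal (d powr q) * (kernel q w x y * indicator D x * indicator D y)"
    proof (cases "x \<in> D \<and> y \<in> D \<and> x \<noteq> y")
      case True
      then have xy: "0 < norm (x - y)" "norm (x - y) \<le> d" using d by auto
      have "1 = norm (x - y) powr q * norm (x - y) powr (- q)"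
        using xy by (simp add: powr_minus)
      also have "\<dots> \<le> d powr q * norm (x - y) powr (- q)"
        using xy q by (intro mult_right_mono powr_mono2) auto
      finally have "(w x - w y)\<^sup>2 * 1 \<le> (w x - w y)\<^sup>2 * (d powr q * norm (x - y) powr (- q))"
        by (intro mult_left_mono) auto
      then show ?thesis using True by (simp add: mult_ac flip: ennreal_mult)
    qed (auto simp: indicator_def)
  qed
  also have "\<dots> = ennreal (d powr q) * g"
    unfolding g_def by (simp add: nn_integral_cmult)
  finally have main: "ennreal (2 * (a * W - I\<^sup>2)) \<le> ennreal (d powr q) * g" .
  have "W = I\<^sup>2 / a + 1 / (2 * a) * (2 * (a * W - I\<^sup>2))" using a by (simp add: field_simps)
  also have "ennreal \<dots> = ennreal (I\<^sup>2 / a) + ennreal (1 / (2 * a) * (2 * (a * W - I\<^sup>2)))"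
    using a pos by (intro ennreal_plus) auto
  also have "\<dots> = ennreal (I\<^sup>2 / a) + ennreal (1 / (2 * a)) * ennreal (2 * (a * W - I\<^sup>2))"
    using a by (subst ennreal_mult') auto
  also have "\<dots> \<le> ennreal (I\<^sup>2 / a) + ennreal (1 / (2 * a)) * (ennreal (d powr q) * g)"
    by (intro add_left_mono mult_left_mono main) simp
  also have "ennreal (1 / (2 * a)) * (ennreal (d powr q) * g) = ennreal (d powr q / (2 * a)) * g"
    using a by (simp add: mult.assoc[symmetric] flip: ennreal_mult)
  finally have "ennreal W \<le> ennreal (I\<^sup>2 / a) + ennreal (d powr q / (2 * a)) * g" .
  moreover have "W = (LINT x:D|lborel. (w x)\<^sup>2)" "I = (LINT x:D|lborel. w x)"
    by (auto simp: W_def I_def set_lebesgue_integral_def v2eq) (simp add: v_def)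
  ultimately show ?thesis by (simp add: g_def)
qed

section \<open>The partition of space into half-open cubes\<close>

definition corner :: "real \<Rightarrow> 'a::euclidean_space \<Rightarrow> 'a" where
  "corner \<delta> x = (\<Sum>i\<in>Basis. (\<delta> * of_int \<lfloor>(x \<bullet> i) / \<delta>\<rfloor>) *\<^sub>R i)"

text \<open>Cells are fibres of the map to the lower corner, so they are disjoint by construction.
  Every cell that meets \<open>S\<close> is taken whole, which gives all of them the same
  volume.\<close>

definition grid_cells :: "real \<Rightarrow> 'a::euclidean_space set \<Rightarrow> 'a set set" where
  "grid_cells \<delta> S = (\<lambda>c. corner \<delta> -` {c}) ` corner \<delta> ` S"

lemma corner_inner: "i \<in> Basis \<Longrightarrow> corner \<delta> x \<bullet> i = \<delta> * of_int \<lfloor>(x \<bullet> i) / \<delta>\<rfloor>"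
  by (simp add: corner_def)

lemma corner_bounds:
  assumes "\<delta> > 0" "i \<in> Basis"
  shows "corner \<delta> x \<bullet> i \<le> x \<bullet> i" "x \<bullet> i < corner \<delta> x \<bullet> i + \<delta>"
proof -
  have "of_int \<lfloor>(x \<bullet> i) / \<delta>\<rfloor> \<le> (x \<bullet> i) / \<delta>" "(x \<bullet> i) / \<delta> < of_int \<lfloor>(x \<bullet> i) / \<delta>\<rfloor> + 1" by linarith+
  from this(1) mult_strict_left_mono[OF this(2) assms(1)]
  have "\<delta> * of_int \<lfloor>(x \<bullet> i) / \<delta>\<rfloor> \<le> \<delta> * ((x \<bullet> i) / \<delta>)"
    "\<delta> * ((x \<bullet> i) / \<delta>) < \<delta> * (of_int \<lfloor>(x \<bullet> i) / \<delta>\<rfloor> + 1)"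
    using assms(1) by (simp_all only: mult_le_cancel_left_pos)
  then show "corner \<delta> x \<bullet> i \<le> x \<bullet> i" "x \<bullet> i < corner \<delta> x \<bullet> i + \<delta>"
    using assms by (simp_all add: corner_inner distrib_left)
qed

lemma corner_measurable [measurable]: "corner \<delta> \<in> borel_measurable borel"
  unfolding corner_def by measurable

lemma cell_measurable [measurable]: "corner \<delta> -` {c} \<in> sets borel"
  using measurable_sets[OF corner_measurable, of "{c}"] by simp

text \<open>The cell lies between an open and a closed box of equal volume.\<close>

lemma emeasure_cell:
  fixes z :: "'a::euclidean_space"
  assumes \<delta>: "\<delta> > 0"
  shows "emeasure lborel (corner \<delta> -` {corner \<delta> z}) = ennreal (\<delta> ^ DIM('a))"
proof -
  define c where "c = corner \<delta> z"
  have ci: "c \<bullet> i = \<delta> * of_int \<lfloor>(z \<bullet> i) / \<delta>\<rfloor>" if "i \<in> Basis" for i using that by (simp add: c_def corner_inner)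
  have One: "(c + \<delta> *\<^sub>R One - c) \<bullet> i = \<delta>" if "i \<in> Basis" for i using that by (simp add: inner_simps)
  have sub1: "box c (c + \<delta> *\<^sub>R One) \<subseteq> corner \<delta> -` {c}"
  proof
    fix x assume x: "x \<in> box c (c + \<delta> *\<^sub>R One)"
    have "corner \<delta> x = c"
    proof (rule euclidean_eqI)
      fix i :: 'a assume i: "i \<in> Basis"
      have "c \<bullet> i < x \<bullet> i" "x \<bullet> i < c \<bullet> i + \<delta>" using x i by (auto simp: mem_box inner_simps)
      then have "\<lfloor>(x \<bullet> i) / \<delta>\<rfloor> = \<lfloor>(z \<bullet> i) / \<delta>\<rfloor>"
        using \<delta> by (intro floor_unique) (auto simp: ci[OF i] field_simps)
      then show "corner \<delta> x \<bullet> i = c \<bullet> i" using i by (simp add: corner_inner ci)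
    qed
    then show "x \<in> corner \<delta> -` {c}" by simp
  qed
  have sub2: "corner \<delta> -` {c} \<subseteq> cbox c (c + \<delta> *\<^sub>R One)"
    using corner_bounds[OF \<delta>] by (fastforce simp: mem_box inner_simps intro: less_imp_le)
  have "emeasure lborel (box c (c + \<delta> *\<^sub>R One)) = ennreal (\<delta> ^ DIM('a))"
    using \<delta> One by (subst emeasure_lborel_box) (auto simp: inner_simps)
  moreover have "emeasure lborel (cbox c (c + \<delta> *\<^sub>R One)) = ennreal (\<delta> ^ DIM('a))"
    using \<delta> One by (subst emeasure_lborel_cbox) (auto simp: inner_simps)
  moreover have "emeasure lborel (box c (c + \<delta> *\<^sub>R One)) \<le> emeasure lborel (corner \<delta> -` {c})"
    using sub1 by (intro emeasure_mono) auto
  moreover have "emeasure lborel (corner \<delta> -` {c}) \<le> emeasure lborel (cbox c (c + \<delta> *\<^sub>R One))"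
    using sub2 by (intro emeasure_mono) auto
  ultimately show ?thesis by (simp add: c_def)
qed

lemma cell_diameter:
  fixes x y :: "'a::euclidean_space"
  assumes \<delta>: "\<delta> > 0" and "corner \<delta> x = corner \<delta> y"
  shows "norm (x - y) \<le> real DIM('a) * \<delta>"
proof -
  have "norm (x - y) \<le> (\<Sum>i\<in>Basis. \<bar>(x - y) \<bullet> i\<bar>)" by (rule norm_le_l1)
  also have "\<dots> \<le> (\<Sum>i\<in>(Basis :: 'a set). \<delta>)"
  proof (rule sum_mono)
    fix i :: 'a assume i: "i \<in> Basis"
    show "\<bar>(x - y) \<bullet> i\<bar> \<le> \<delta>"
      using corner_bounds[OF \<delta> i, of x] corner_bounds[OF \<delta> i, of y] assms(2) by (simp add: inner_diff_left)
  qed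
  finally show ?thesis by simp
qed

lemma finite_grid_cells:
  fixes S :: "'a::euclidean_space set"
  assumes S: "bounded S" and \<delta>: "\<delta> > 0"
  shows "finite (grid_cells \<delta> S)"
proof -
  obtain R where R: "\<And>x. x \<in> S \<Longrightarrow> norm x \<le> R" using S by (auto simp: bounded_iff)
  define m where "m = \<lceil>R / \<delta>\<rceil> + 1"
  define F where "F c = restrict (\<lambda>i. c \<bullet> i) Basis" for c :: 'a
  have "F ` corner \<delta> ` S \<subseteq> PiE Basis (\<lambda>_. (\<lambda>k. \<delta> * of_int k) ` {- m..m})"
  proof (clarsimp simp: F_def)
    fix x and i :: 'a assume x: "x \<in> S" and i: "i \<in> Basis"
    have "\<bar>x \<bullet> i\<bar> \<le> R" using Basis_le_norm[OF i, of x] R[OF x] by simp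
    then have "\<bar>(x \<bullet> i) / \<delta>\<bar> \<le> R / \<delta>" using \<delta> by (simp add: divide_right_mono)
    then have "- (R / \<delta>) \<le> (x \<bullet> i) / \<delta>" "(x \<bullet> i) / \<delta> \<le> R / \<delta>" by linarith+
    then have "- m \<le> \<lfloor>(x \<bullet> i) / \<delta>\<rfloor>" "\<lfloor>(x \<bullet> i) / \<delta>\<rfloor> \<le> m" unfolding m_def by linarith+
    then have "\<lfloor>(x \<bullet> i) / \<delta>\<rfloor> \<in> {- m..m}" by simp
    then show "corner \<delta> x \<bullet> i \<in> (\<lambda>k. \<delta> * of_int k) ` {- m..m}"
      using i by (auto simp: corner_inner)
  qed
  then have "finite (F ` corner \<delta> ` S)" by (rule finite_subset) (auto intro!: finite_PiE)
  moreover have "inj_on F (corner \<delta> ` S)"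
  proof (rule inj_onI)
    fix c d assume "F c = F d"
    then have "c \<bullet> i = d \<bullet> i" if "i \<in> Basis" for i
      using that by (auto simp: F_def fun_eq_iff restrict_def split: if_splits)
    then show "c = d" by (rule euclidean_eqI)
  qed
  ultimately have "finite (corner \<delta> ` S)" by (rule finite_imageD)
  then show ?thesis by (simp add: grid_cells_def)
qed

text \<open>The cell inequality is summed with \<open>d = n * \<delta>\<close>. The constant
  \<open>(n * \<delta>) powr q / (2 * \<delta> ^ n)\<close> is of order
  \<open>\<delta> powr (2 * s)\<close>, so on a fine grid the mean square is controlled by finitely
  many cell integrals up to a small multiple of the energy.\<close>

lemma grid_poincare:
  fixes w :: "'a::euclidean_space \<Rightarrow> real"
  assumes w [measurable]: "w \<in> borel_measurable borel" and w2: "integrable lborel (\<lambda>x. (w x)\<^sup>2)"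
    and supp: "\<And>x. x \<notin> S \<Longrightarrow> w x = 0" "bounded S"
    and A: "gagliardo s w \<le> ennreal A" "0 \<le> A" and s: "s > 0" and \<delta>: "\<delta> > 0"
  shows "(LINT x|lborel. (w x)\<^sup>2) \<le> (\<Sum>D\<in>grid_cells \<delta> S. (LINT x:D|lborel. w x)\<^sup>2 / \<delta> ^ DIM('a))
    + real DIM('a) powr (real DIM('a) + 2 * s) * \<delta> powr (2 * s) * A"
proof -
  define n where "n = real DIM('a)"
  define q where "q = n + 2 * s"
  define a where "a = \<delta> ^ DIM('a)"
  define Z where "Z = grid_cells \<delta> S"
  define g where "g D = (\<integral>\<^sup>+x. \<integral>\<^sup>+y. kernel q w x y * indicator D x * indicator D y \<partial>lborel \<partial>lborel)" for D
  have n: "n > 0" by (simp add: n_def)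
  have q: "q > 0" using s n by (simp add: q_def)
  have a: "a > 0" using \<delta> by (simp add: a_def)
  have Z: "finite Z" unfolding Z_def using supp \<delta> by (intro finite_grid_cells)
  have ZD: "D \<in> sets borel" "emeasure lborel D = ennreal a" "x \<in> D \<Longrightarrow> y \<in> D \<Longrightarrow> norm (x - y) \<le> n * \<delta>"
    if "D \<in> Z" for D x y
    using that \<delta> by (auto simp: Z_def grid_cells_def a_def n_def emeasure_cell intro: cell_diameter)
  \<comment> \<open>The products of a cell with itself are pairwise disjoint, so the local energies
    add up to at most the full one.\<close>
  have Zind: "(\<Sum>D\<in>Z. indicator D x * indicator D y) \<le> (1::ennreal)" for x y
  proof -
    show ?thesis
    proof (cases "\<exists>D\<in>Z. x \<in> D")
      case True
      then obtain D where D: "D \<in> Z" "x \<in> D" by blast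
      have "x \<notin> E" if "E \<in> Z" "E \<noteq> D" for E using that D by (auto simp: Z_def grid_cells_def)
      then have "(\<Sum>E\<in>Z. indicator E x * indicator E y) = (indicator D x * indicator D y :: ennreal)"
        by (intro sum_eq_single Z D(1)) simp
      then show ?thesis by (simp add: indicator_def)
    next
      case False
      then have "(\<Sum>E\<in>Z. indicator E x * indicator E y) = (0::ennreal)" by (intro sum.neutral) auto
      then show ?thesis by simp
    qed
  qed
  have Zcover: "(w x)\<^sup>2 = (\<Sum>D\<in>Z. indicator D x * (w x)\<^sup>2)" for x
  proof (cases "x \<in> S")
    case True
    define D where "D = corner \<delta> -` {corner \<delta> x}"
    have D: "D \<in> Z" "x \<in> D" using True by (auto simp: Z_def grid_cells_def D_def)
    have *: "x \<notin> E" if "E \<in> Z" "E \<noteq> D" for E using that by (auto simp: Z_def grid_cells_def D_def)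
    have "(\<Sum>E\<in>Z. indicator E x * (w x)\<^sup>2) = indicator D x * (w x)\<^sup>2"
      by (rule sum_eq_single[OF Z D(1)]) (simp add: *)
    also have "\<dots> = (w x)\<^sup>2" using D by (simp only: indicator_simps mult_1)
    finally show ?thesis by (rule sym)
  next
    case False
    then have "w x = 0" by (rule supp)
    then show ?thesis by (simp only: mult_zero_right zero_power2 sum.neutral_const)
  qed
  have int: "integrable lborel (\<lambda>x. indicator D x * (w x)\<^sup>2)" if "D \<in> Z" for D
    using ZD(1)[OF that] by (intro Bochner_Integration.integrable_bound[OF w2]) (auto simp: indicator_def)
  have sum_g: "(\<Sum>D\<in>Z. g D) \<le> gagliardo s w"
  proof -
    define h where "h D x y = kernel q w x y * indicator D x * indicator D y" for D and x y :: 'a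
    have h1: "(\<lambda>y. h D x y) \<in> borel_measurable lborel"
      and h2: "(\<lambda>x. \<integral>\<^sup>+y. h D x y \<partial>lborel) \<in> borel_measurable lborel" if "D \<in> Z" for D x
    proof -
      have [measurable]: "D \<in> sets borel" using ZD(1) that .
      show "(\<lambda>y. h D x y) \<in> borel_measurable lborel" unfolding h_def by measurable
      show "(\<lambda>x. \<integral>\<^sup>+y. h D x y \<partial>lborel) \<in> borel_measurable lborel" unfolding h_def by measurable
    qed
    have "(\<Sum>D\<in>Z. g D) = (\<integral>\<^sup>+x. (\<Sum>D\<in>Z. \<integral>\<^sup>+y. h D x y \<partial>lborel) \<partial>lborel)"
      unfolding g_def h_def[symmetric] by (rule nn_integral_sum[symmetric]) (rule h2)
    also have "\<dots> = (\<integral>\<^sup>+x. \<integral>\<^sup>+y. (\<Sum>D\<in>Z. h D x y) \<partial>lborel \<partial>lborel)"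
      by (rule nn_integral_cong, rule nn_integral_sum[symmetric]) (rule h1)
    also have "\<dots> = (\<integral>\<^sup>+x. \<integral>\<^sup>+y. (\<Sum>D\<in>Z. kernel q w x y * indicator D x * indicator D y) \<partial>lborel \<partial>lborel)"
      unfolding h_def ..
    also have "\<dots> \<le> (\<integral>\<^sup>+x. \<integral>\<^sup>+y. kernel q w x y * 1 \<partial>lborel \<partial>lborel)"
    proof (intro nn_integral_mono)
      fix x y
      have "(\<Sum>D\<in>Z. kernel q w x y * indicator D x * indicator D y)
        = kernel q w x y * (\<Sum>D\<in>Z. indicator D x * indicator D y)"
        by (simp only: sum_distrib_left mult.assoc)
      also have "\<dots> \<le> kernel q w x y * 1"
        by (intro mult_left_mono Zind) simp
      finally show "(\<Sum>D\<in>Z. kernel q w x y * indicator D x * indicator D y)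
        \<le> kernel q w x y * 1" .
    qed
    finally show ?thesis by (simp add: gagliardo_def q_def n_def)
  qed
  have "(LINT x|lborel. (w x)\<^sup>2) = (LINT x|lborel. (\<Sum>D\<in>Z. indicator D x * (w x)\<^sup>2))"
    by (rule Bochner_Integration.integral_cong[OF refl Zcover])
  also have "\<dots> = (\<Sum>D\<in>Z. LINT x|lborel. indicator D x * (w x)\<^sup>2)"
    by (rule Bochner_Integration.integral_sum) (rule int)
  also have "\<dots> = (\<Sum>D\<in>Z. LINT x:D|lborel. (w x)\<^sup>2)" by (simp add: set_lebesgue_integral_def)
  also have "ennreal \<dots> = (\<Sum>D\<in>Z. ennreal (LINT x:D|lborel. (w x)\<^sup>2))"
    by (subst sum_ennreal) (auto simp: set_lebesgue_integral_def)
  also have "\<dots> \<le> (\<Sum>D\<in>Z. ennreal ((LINT x:D|lborel. w x)\<^sup>2 / a) + ennreal ((n * \<delta>) powr q / (2 * a)) * g D)"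
    unfolding g_def using ZD a q by (intro sum_mono cell_poincare w w2) auto
  also have "\<dots> = ennreal (\<Sum>D\<in>Z. (LINT x:D|lborel. w x)\<^sup>2 / a) + ennreal ((n * \<delta>) powr q / (2 * a)) * (\<Sum>D\<in>Z. g D)"
    using a by (simp add: sum.distrib sum_distrib_left sum_ennreal)
  also have "\<dots> \<le> ennreal (\<Sum>D\<in>Z. (LINT x:D|lborel. w x)\<^sup>2 / a) + ennreal ((n * \<delta>) powr q / (2 * a)) * ennreal A"
    by (intro add_left_mono mult_left_mono order_trans[OF sum_g A(1)]) simp
  also have "ennreal (\<Sum>D\<in>Z. (LINT x:D|lborel. w x)\<^sup>2 / a) + ennreal ((n * \<delta>) powr q / (2 * a)) * ennreal A
    = ennreal ((\<Sum>D\<in>Z. (LINT x:D|lborel. w x)\<^sup>2 / a) + (n * \<delta>) powr q / (2 * a) * A)"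
    using a A by (simp add: sum_nonneg flip: ennreal_mult ennreal_plus)
  finally have "(LINT x|lborel. (w x)\<^sup>2) \<le> (\<Sum>D\<in>Z. (LINT x:D|lborel. w x)\<^sup>2 / a) + (n * \<delta>) powr q / (2 * a) * A"
    using a A by (subst (asm) ennreal_le_iff) (auto intro!: add_nonneg_nonneg sum_nonneg)
  also have "(n * \<delta>) powr q / (2 * a) = n powr q * \<delta> powr (2 * s) / 2"
    using \<delta> n by (simp add: powr_mult q_def powr_add a_def n_def powr_realpow)
  also have "n powr q * \<delta> powr (2 * s) / 2 * A \<le> n powr q * \<delta> powr (2 * s) * A"
    using A by (intro mult_right_mono) auto
  finally show ?thesis by (simp add: Z_def n_def q_def a_def)
qed

section \<open>The function space as a semi-inner product space\<close>

text \<open>Turns functions into vectors, so that X0 becomes a \<open>subspace\<close> to which the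
  abstract results apply.\<close>

instantiation "fun" :: (type, real_vector) real_vector
begin

definition scaleR_fun_def: "c *\<^sub>R f = (\<lambda>x. c *\<^sub>R f x)"

instance
  by standard (simp_all add: fun_eq_iff scaleR_fun_def scaleR_add_right scaleR_add_left)

end

lemma scaleR_fun_apply [simp]: "(c *\<^sub>R f) x = c *\<^sub>R f x"
  by (simp add: scaleR_fun_def)

section \<open>Null sets and Lebesgue measurability on product spaces\<close>

lemma null_sets_vimage_fst:
  assumes "N \<in> null_sets (lborel :: 'a::euclidean_space measure)"
  shows "(fst -` N :: ('a \<times> 'b::euclidean_space) set) \<in> null_sets lborel"
proof -
  have N: "N \<in> sets borel" "emeasure lborel N = 0" using assms by (auto simp: null_sets_def)
  have eq: "fst -` N = N \<times> (UNIV :: 'b set)" by auto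
  have "emeasure (lborel \<Otimes>\<^sub>M lborel) (N \<times> (UNIV :: 'b set)) = 0"
    using N by (subst lborel.emeasure_pair_measure_Times) auto
  moreover have "N \<times> (UNIV :: 'b set) \<in> sets (lborel \<Otimes>\<^sub>M lborel)" using N by auto
  ultimately show ?thesis unfolding eq lborel_prod[symmetric] by (rule null_setsI)
qed

lemma null_sets_vimage_snd:
  assumes "N \<in> null_sets (lborel :: 'b::euclidean_space measure)"
  shows "(snd -` N :: ('a::euclidean_space \<times> 'b) set) \<in> null_sets lborel"
proof -
  have N: "N \<in> sets borel" "emeasure lborel N = 0" using assms by (auto simp: null_sets_def)
  have eq: "snd -` N = (UNIV :: 'a set) \<times> N" by auto
  have "emeasure (lborel \<Otimes>\<^sub>M lborel) ((UNIV :: 'a set) \<times> N) = 0"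
    using N by (subst lborel.emeasure_pair_measure_Times) auto
  moreover have "(UNIV :: 'a set) \<times> N \<in> sets (lborel \<Otimes>\<^sub>M lborel)" using N by auto
  ultimately show ?thesis unfolding eq lborel_prod[symmetric] by (rule null_setsI)
qed

text \<open>Each slice of the preimage is a reflected translate of \<open>N\<close>, hence null, and
  Tonelli's theorem applies.\<close>

lemma null_sets_vimage_minus:
  assumes "N \<in> null_sets (lborel :: 'a::euclidean_space measure)"
  shows "((\<lambda>(x, y). x - y) -` N :: ('a \<times> 'a) set) \<in> null_sets lborel"
proof -
  have N [measurable]: "N \<in> sets borel" and N0: "emeasure lborel N = 0" using assms by (auto simp: null_sets_def)
  let ?A = "(\<lambda>(x, y). x - y) -` N :: ('a \<times> 'a) set"
  have "(\<lambda>(x, y). x - y) \<in> (borel \<Otimes>\<^sub>M borel :: ('a \<times> 'a) measure) \<rightarrow>\<^sub>M borel" by measurable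
  from measurable_sets[OF this N] have A: "?A \<in> sets (lborel \<Otimes>\<^sub>M lborel)"
    by (simp add: space_pair_measure cong: sets_pair_measure_cong)
  have slice: "emeasure lborel (Pair x -` ?A) = 0" for x
  proof -
    let ?f = "\<lambda>y::'a. x + (-1) *\<^sub>R y"
    have "lborel = density (distr lborel borel ?f) (\<lambda>_. ennreal (\<bar>-1\<bar> ^ DIM('a)))"
      by (rule lborel_affine) simp
    then have "lborel = distr lborel borel ?f" by (simp add: density_1)
    then have "emeasure lborel N = emeasure (distr lborel borel ?f) N" by (rule arg_cong)
    also have "\<dots> = emeasure lborel (?f -` N \<inter> space lborel)"
      by (rule emeasure_distr) auto
    also have "?f -` N \<inter> space lborel = Pair x -` ?A" by auto
    finally show ?thesis using N0 by simp
  qed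
  have "emeasure (lborel \<Otimes>\<^sub>M lborel) ?A = 0"
    using lborel.emeasure_pair_measure_alt[OF A] slice by simp
  then show ?thesis using A unfolding lborel_prod[symmetric] by (rule null_setsI)
qed

text \<open>A Lebesgue set is a Borel set up to a null set, so a Borel map pulls it back to a
  Lebesgue set as soon as it pulls null sets back to null sets. Used for the coordinates and for
  \<open>x - y\<close>, since \<open>u\<close> and \<open>K\<close> are only Lebesgue
  measurable.\<close>

lemma lebesgue_measurable_of_null_vimage:
  fixes f :: "'a::euclidean_space \<Rightarrow> 'b::euclidean_space"
  assumes [measurable]: "f \<in> borel_measurable borel" and null: "\<And>N. N \<in> null_sets lborel \<Longrightarrow> f -` N \<in> null_sets lborel"
  shows "f \<in> lebesgue \<rightarrow>\<^sub>M lebesgue"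
proof (rule completion.measurable_completion2)
  show f: "f \<in> lebesgue \<rightarrow>\<^sub>M lborel" by (rule measurable_completion) simp
  show "null_sets lborel \<subseteq> null_sets (distr lebesgue lborel f)"
  proof
    fix N :: "'b set" assume N: "N \<in> null_sets lborel"
    then have "f -` N \<in> null_sets lebesgue" using null null_sets_completionI by blast
    then show "N \<in> null_sets (distr lebesgue lborel f)"
      using null_setsD2[OF N] by (simp add: null_sets_distr_iff[OF f])
  qed
qed

lemma lebesgue_measurable_fst: "fst \<in> (lebesgue :: ('a::euclidean_space \<times> 'b::euclidean_space) measure) \<rightarrow>\<^sub>M lebesgue"
proof (rule lebesgue_measurable_of_null_vimage)
  show "fst \<in> borel_measurable (borel :: ('a \<times> 'b) measure)"
    unfolding borel_prod[symmetric] by (rule measurable_fst)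
qed (rule null_sets_vimage_fst)

lemma lebesgue_measurable_snd: "snd \<in> (lebesgue :: ('a::euclidean_space \<times> 'b::euclidean_space) measure) \<rightarrow>\<^sub>M lebesgue"
proof (rule lebesgue_measurable_of_null_vimage)
  show "snd \<in> borel_measurable (borel :: ('a \<times> 'b) measure)"
    unfolding borel_prod[symmetric] by (rule measurable_snd)
qed (rule null_sets_vimage_snd)

lemma lebesgue_measurable_minus: "(\<lambda>(x, y). x - y) \<in> (lebesgue :: ('a::euclidean_space \<times> 'a) measure) \<rightarrow>\<^sub>M lebesgue"
  by (rule lebesgue_measurable_of_null_vimage)
     (auto intro!: null_sets_vimage_minus borel_measurable_continuous_onI continuous_intros simp: case_prod_beta)

lemma AE_lebesgue_of_null_vimage:
  assumes null: "\<And>N. N \<in> null_sets lborel \<Longrightarrow> f -` N \<in> null_sets lborel"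
    and "AE x in lebesgue. P x"
  shows "AE p in lebesgue. P (f p)"
proof -
  have "AE x in lborel. P x" using assms(2) by (simp add: AE_completion_iff)
  then obtain N where N: "{x. \<not> P x} \<subseteq> N" "N \<in> null_sets lborel"
    by (auto simp: eventually_ae_filter)
  have "AE p in lborel. P (f p)"
    by (rule AE_I'[OF null[OF N(2)]]) (use N(1) in auto)
  then show ?thesis by (rule AE_completion)
qed

lemma AE_lebesgue_fst:
  "AE x in lebesgue. P x \<Longrightarrow>
    AE p in (lebesgue :: ('a::euclidean_space \<times> 'b::euclidean_space) measure). P (fst p)"
  by (rule AE_lebesgue_of_null_vimage[OF null_sets_vimage_fst])

lemma AE_lebesgue_snd:
  "AE x in lebesgue. P x \<Longrightarrow>
    AE p in (lebesgue :: ('a::euclidean_space \<times> 'b::euclidean_space) measure). P (snd p)"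
  by (rule AE_lebesgue_of_null_vimage[OF null_sets_vimage_snd])

lemma integrable_mult_of_squares:
  fixes f g :: "'a \<Rightarrow> real"
  assumes [measurable]: "f \<in> borel_measurable M" "g \<in> borel_measurable M"
    and "integrable M (\<lambda>x. (f x)\<^sup>2)" "integrable M (\<lambda>x. (g x)\<^sup>2)"
  shows "integrable M (\<lambda>x. f x * g x)"
proof (rule Bochner_Integration.integrable_bound)
  show "integrable M (\<lambda>x. (f x)\<^sup>2 + (g x)\<^sup>2)" using assms by simp
  have "\<bar>a * b\<bar> \<le> a\<^sup>2 + b\<^sup>2" for a b :: real
  proof -
    have "0 \<le> (\<bar>a\<bar> - \<bar>b\<bar>)\<^sup>2" by simp
    then have "2 * (\<bar>a\<bar> * \<bar>b\<bar>) \<le> a\<^sup>2 + b\<^sup>2" by (simp add: power2_diff)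
    moreover have "0 \<le> \<bar>a\<bar> * \<bar>b\<bar>" by simp
    ultimately show ?thesis unfolding abs_mult by linarith
  qed
  then show "AE x in M. norm (f x * g x) \<le> norm ((f x)\<^sup>2 + (g x)\<^sup>2)" by simp
qed measurable

lemma integrable_square_add:
  fixes f g :: "'a \<Rightarrow> real"
  assumes "f \<in> borel_measurable M" "g \<in> borel_measurable M"
    and "integrable M (\<lambda>x. (f x)\<^sup>2)" "integrable M (\<lambda>x. (g x)\<^sup>2)"
  shows "integrable M (\<lambda>x. (f x + g x)\<^sup>2)"
  using assms integrable_mult_of_squares[OF assms] by (simp add: power2_sum mult.assoc)

section \<open>The energy form on X0 and Borel representatives\<close>

locale nonlocal_space =
  fixes s b :: real and \<Omega> :: "(real^'n) set" and K :: "real^'n \<Rightarrow> real"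
  assumes s_pos: "0 < s" and s_less: "2 * s < real CARD('n)"
    and open_\<Omega>: "open \<Omega>" and bounded_\<Omega>: "bounded \<Omega>"
    and K_pos: "\<And>x. x \<noteq> 0 \<Longrightarrow> K x > 0"
    and K_int: "integrable lebesgue (\<lambda>x. min ((norm x)\<^sup>2) 1 * K x)"
    and b_pos: "b > 0"
    and K_lower: "\<And>x. x \<noteq> 0 \<Longrightarrow> b * norm x powr (- (real CARD('n) + 2 * s)) \<le> K x"
begin

abbreviation "V \<equiv> space_X0 K \<Omega>"
abbreviation "N \<equiv> norm_X0 K \<Omega>"
abbreviation "Q \<equiv> Q_set \<Omega>"

text \<open>Fixes the value at the origin, where \<open>K\<close> is arbitrary and could be negative
  under the square root.\<close>

definition K0 :: "real^'n \<Rightarrow> real" where "K0 z = (if z = 0 then 0 else K z)"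

lemma K0_nonneg: "0 \<le> K0 z" using K_pos[of z] by (auto simp: K0_def intro: less_imp_le)

text \<open>Measurability is known only for the product of the weight with \<open>K\<close>, so the
  weight is divided out; at the origin the quotient \<open>0 / 0 = 0\<close> agrees with
  \<open>K0\<close>.\<close>

lemma K0_measurable: "K0 \<in> borel_measurable lebesgue"
proof -
  have "K0 = (\<lambda>x. (min ((norm x)\<^sup>2) 1 * K x) / min ((norm x)\<^sup>2) 1)"
    by (auto simp: K0_def min_def)
  moreover have "(\<lambda>x. (min ((norm x)\<^sup>2) 1 * K x) / min ((norm x)\<^sup>2) 1) \<in> borel_measurable lebesgue"
  proof (rule borel_measurable_divide)
    show "(\<lambda>x. min ((norm x)\<^sup>2) 1 * K x) \<in> borel_measurable lebesgue" using K_int by auto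
    show "(\<lambda>x. min ((norm x)\<^sup>2) 1) \<in> borel_measurable lebesgue" by (rule measurable_completion) measurable
  qed
  ultimately show ?thesis by simp
qed

lemma Q_measurable: "Q \<in> sets borel"
proof -
  have "closed ((- \<Omega>) \<times> (- \<Omega>))" using open_\<Omega> by (intro closed_Times) auto
  then show ?thesis by (auto simp: Q_set_def)
qed

lemma Q_iff: "(x, y) \<in> Q \<longleftrightarrow> x \<in> \<Omega> \<or> y \<in> \<Omega>" by (auto simp: Q_set_def)

text \<open>The integrand behind the norm, extended by 0 off \<open>Q\<close>. The form
  \<open>B\<close> is the L2 product of \<open>D u\<close> and \<open>D v\<close> over the whole
  product space, and \<open>D\<close> is linear.\<close>

definition D :: "(real^'n \<Rightarrow> real) \<Rightarrow> (real^'n) \<times> (real^'n) \<Rightarrow> real" where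
  "D u p = indicator Q p * ((u (fst p) - u (snd p)) * sqrt (K0 (fst p - snd p)))"

lemma D_measurable:
  assumes "u \<in> borel_measurable lebesgue" shows "D u \<in> borel_measurable lebesgue"
proof -
  have [measurable]: "(\<lambda>p. u (fst p)) \<in> borel_measurable (lebesgue :: ((real^'n) \<times> (real^'n)) measure)"
    "(\<lambda>p. u (snd p)) \<in> borel_measurable (lebesgue :: ((real^'n) \<times> (real^'n)) measure)"
    using measurable_compose[OF lebesgue_measurable_fst assms]
      measurable_compose[OF lebesgue_measurable_snd assms] by auto
  have [measurable]: "(\<lambda>p. K0 (fst p - snd p)) \<in> borel_measurable lebesgue"
    using measurable_compose[OF lebesgue_measurable_minus K0_measurable] by (simp add: case_prod_beta)
  have [measurable]: "Q \<in> sets lebesgue" using Q_measurable by auto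
  show ?thesis unfolding D_def by measurable
qed

lemma D_add: "D (u + v) p = D u p + D v p" by (simp add: D_def algebra_simps)
lemma D_diff: "D (u - v) p = D u p - D v p" by (simp add: D_def algebra_simps)
lemma D_scale: "D (c *\<^sub>R u) p = c * D u p" by (simp add: D_def algebra_simps)

lemma D_mult: "D u p * D v p = indicator Q p * ((u (fst p) - u (snd p)) * (v (fst p) - v (snd p)) * K (fst p - snd p))"
proof (cases "fst p = snd p")
  case False
  then have "sqrt (K0 (fst p - snd p)) * sqrt (K0 (fst p - snd p)) = K (fst p - snd p)"
    using K0_nonneg[of "fst p - snd p"] by (simp add: K0_def)
  then show ?thesis by (simp add: D_def indicator_def)
qed (simp add: D_def)

lemma D_sq: "(D u p)\<^sup>2 = indicator Q p * ((u (fst p) - u (snd p))\<^sup>2 * K (fst p - snd p))"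
  using D_mult[of u p u] by (simp add: power2_eq_square)

text \<open>Functions in X0 vanish almost everywhere off \<Omega>, so the integral over \<Omega>
  becomes one over the whole space.\<close>

lemma V_iff:
  "u \<in> V \<longleftrightarrow> u \<in> borel_measurable lebesgue \<and> integrable lebesgue (\<lambda>x. (u x)\<^sup>2) \<and>
    integrable lebesgue (\<lambda>p. (D u p)\<^sup>2) \<and> (AE x in lebesgue. x \<notin> \<Omega> \<longrightarrow> u x = 0)"
proof (cases "u \<in> borel_measurable lebesgue \<and> (AE x in lebesgue. x \<notin> \<Omega> \<longrightarrow> u x = 0)")
  case True
  then have [measurable]: "u \<in> borel_measurable lebesgue" by simp
  have \<Omega>_m [measurable]: "\<Omega> \<in> sets lebesgue" using open_\<Omega> by auto
  have "set_integrable lebesgue \<Omega> (\<lambda>x. (u x)\<^sup>2) \<longleftrightarrow> integrable lebesgue (\<lambda>x. (u x)\<^sup>2)"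
    unfolding set_integrable_def
  proof (rule integrable_cong_AE)
    have "AE x in lebesgue. x \<notin> \<Omega> \<longrightarrow> u x = 0" using True by simp
    then show "AE x in lebesgue. indicator \<Omega> x *\<^sub>R (u x)\<^sup>2 = (u x)\<^sup>2"
      by eventually_elim (auto simp: indicator_def)
  qed measurable
  moreover have "set_borel_measurable lebesgue \<Omega> u" unfolding set_borel_measurable_def by measurable
  moreover have meq: "indicator Q p *\<^sub>R (case p of (x, y) \<Rightarrow> (u x - u y) * sqrt (K (x - y))) = D u p" for p
    by (cases p) (auto simp: D_def K0_def)
  have "set_borel_measurable lebesgue Q (\<lambda>(x, y). (u x - u y) * sqrt (K (x - y)))"
    unfolding set_borel_measurable_def meq using True by (intro D_measurable) simp
  moreover have "indicator Q p *\<^sub>R (case p of (x, y) \<Rightarrow> (u x - u y) * sqrt (K (x - y)))\<^sup>2 = (D u p)\<^sup>2" for p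
    by (cases p) (auto simp: D_def K0_def indicator_def)
  then have "set_integrable lebesgue Q (\<lambda>p. (case p of (x, y) \<Rightarrow> (u x - u y) * sqrt (K (x - y)))\<^sup>2) \<longleftrightarrow>
    integrable lebesgue (\<lambda>p. (D u p)\<^sup>2)"
    unfolding set_integrable_def by simp
  ultimately show ?thesis using True
    by (simp add: space_X0_def space_X_def square_integrable_on_def)
qed (auto simp: space_X0_def space_X_def)

lemma V_measurable: "u \<in> V \<Longrightarrow> u \<in> borel_measurable lebesgue" by (simp add: V_iff)
lemma V_square: "u \<in> V \<Longrightarrow> integrable lebesgue (\<lambda>x. (u x)\<^sup>2)" by (simp add: V_iff)
lemma V_D: "u \<in> V \<Longrightarrow> integrable lebesgue (\<lambda>p. (D u p)\<^sup>2)" by (simp add: V_iff)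
lemma V_zero: "u \<in> V \<Longrightarrow> AE x in lebesgue. x \<notin> \<Omega> \<longrightarrow> u x = 0" by (simp add: V_iff)

definition B :: "(real^'n \<Rightarrow> real) \<Rightarrow> (real^'n \<Rightarrow> real) \<Rightarrow> real" where
  "B u v = set_lebesgue_integral lebesgue Q (\<lambda>(x, y). (u x - u y) * (v x - v y) * K (x - y))"

lemma B_eq: "B u v = (LINT p|lebesgue. D u p * D v p)"
  unfolding B_def set_lebesgue_integral_def D_mult by (simp add: case_prod_beta)

lemma D_mult_integrable: "u \<in> V \<Longrightarrow> v \<in> V \<Longrightarrow> integrable lebesgue (\<lambda>p. D u p * D v p)"
  by (intro integrable_mult_of_squares D_measurable V_measurable V_D)

lemma N_eq: "N u = sqrt (B u u)"
  unfolding norm_X0_def B_def by (simp add: power2_eq_square abs_mult_self_eq)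

lemma B_nonneg: "0 \<le> B u u"
  unfolding B_eq by (simp add: integral_nonneg_AE)

lemma N_sq: "(N u)\<^sup>2 = (LINT p|lebesgue. (D u p)\<^sup>2)"
  using B_nonneg[of u] by (simp add: N_eq B_eq power2_eq_square)

lemma N_nonneg: "0 \<le> N u" using B_nonneg by (simp add: N_eq)

lemma subspace_V: "subspace V"
proof (rule subspaceI)
  show "0 \<in> V" by (simp add: V_iff D_def zero_fun_def)
next
  fix u v assume u: "u \<in> V" and v: "v \<in> V"
  have "AE x in lebesgue. x \<notin> \<Omega> \<longrightarrow> u x + v x = 0"
    using V_zero[OF u] V_zero[OF v] by eventually_elim auto
  moreover have "u + v \<in> borel_measurable lebesgue"
    unfolding plus_fun_def using V_measurable[OF u] V_measurable[OF v] by simp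
  ultimately show "u + v \<in> V"
    using integrable_square_add[OF V_measurable[OF u] V_measurable[OF v] V_square[OF u] V_square[OF v]]
      integrable_square_add[OF D_measurable[OF V_measurable[OF u]] D_measurable[OF V_measurable[OF v]]
        V_D[OF u] V_D[OF v]]
    by (simp add: V_iff D_add)
next
  fix c u assume u: "u \<in> V"
  have "AE x in lebesgue. x \<notin> \<Omega> \<longrightarrow> c * u x = 0" using V_zero[OF u] by eventually_elim auto
  moreover have "c *\<^sub>R u \<in> borel_measurable lebesgue"
    unfolding scaleR_fun_def using V_measurable[OF u] by simp
  ultimately show "c *\<^sub>R u \<in> V"
    using V_square[OF u] V_D[OF u] by (simp add: V_iff D_scale power_mult_distrib)
qed

lemma V_add: "u \<in> V \<Longrightarrow> v \<in> V \<Longrightarrow> u + v \<in> V" using subspace_V by (rule subspace_add)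
lemma V_diff: "u \<in> V \<Longrightarrow> v \<in> V \<Longrightarrow> u - v \<in> V" using subspace_V by (rule subspace_diff)
lemma V_scale: "u \<in> V \<Longrightarrow> c *\<^sub>R u \<in> V" using subspace_V by (rule subspace_scale)

lemma B_sym: "B u v = B v u" unfolding B_eq by (simp add: mult.commute)
lemma B_add: "u \<in> V \<Longrightarrow> v \<in> V \<Longrightarrow> w \<in> V \<Longrightarrow> B (u + v) w = B u w + B v w"
  unfolding B_eq by (simp add: D_add distrib_right D_mult_integrable)
lemma B_scale: "B (c *\<^sub>R u) v = c * B u v"
  unfolding B_eq by (simp add: D_scale mult.assoc)

text \<open>The Sobolev and Poincare inequalities are proved for Borel functions that vanish at
  every point off \<Omega>. Changing \<open>u\<close> on a null set achieves this, and
  \<open>K_lower\<close> compares the Gagliardo energy with the norm.\<close>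

lemma borel_representative:
  assumes u: "u \<in> V"
  obtains v where "v \<in> borel_measurable borel" "AE x in lborel. u x = v x" "\<And>x. x \<notin> \<Omega> \<Longrightarrow> v x = 0"
    "gagliardo s v \<le> ennreal ((N u)\<^sup>2 / b)"
proof -
  obtain g where g [measurable]: "g \<in> borel_measurable lborel" "AE x in lborel. u x = g x"
    using completion_ex_borel_measurable_real[OF V_measurable[OF u]] by auto
  define v where "v x = indicator \<Omega> x * g x" for x
  have [measurable]: "\<Omega> \<in> sets borel" using open_\<Omega> by auto
  have v [measurable]: "v \<in> borel_measurable borel" using g(1) unfolding v_def by simp
  have v0: "v x = 0" if "x \<notin> \<Omega>" for x using that by (simp add: v_def)
  have "AE x in lborel. x \<notin> \<Omega> \<longrightarrow> u x = 0" using V_zero[OF u] by (simp add: AE_completion_iff)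
  then have uv: "AE x in lborel. u x = v x" using g(2) by eventually_elim (auto simp: v_def indicator_def)
  then have uvl: "AE x in lebesgue. u x = v x" by (rule AE_completion)
  let ?k = "\<lambda>x y. ennreal ((v x - v y)\<^sup>2 * norm (x - y) powr (- (real CARD('n) + 2 * s)))"
  have "gagliardo s v = (\<integral>\<^sup>+x. \<integral>\<^sup>+y. ?k x y \<partial>lborel \<partial>lborel)" by (simp add: gagliardo_def)
  also have "\<dots> = (\<integral>\<^sup>+p. ?k (fst p) (snd p) \<partial>(lborel \<Otimes>\<^sub>M lborel))"
    by (subst lborel.nn_integral_fst[symmetric]) (auto simp: case_prod_beta)
  also have "\<dots> = (\<integral>\<^sup>+p. ?k (fst p) (snd p) \<partial>lebesgue)"
    by (simp add: lborel_prod nn_integral_completion)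
  also have "\<dots> \<le> (\<integral>\<^sup>+p. ennreal ((D u p)\<^sup>2 / b) \<partial>lebesgue)"
  proof (rule nn_integral_mono_AE)
    show "AE p in lebesgue. ?k (fst p) (snd p) \<le> ennreal ((D u p)\<^sup>2 / b)"
      using AE_lebesgue_fst[OF uvl] AE_lebesgue_snd[OF uvl]
    proof eventually_elim
      case (elim p)
      obtain x y where p: "p = (x, y)" by (cases p)
      have e: "v x = u x" "v y = u y" using elim p by auto
      show ?case
      proof (cases "x = y \<or> p \<notin> Q")
        case True
        \<comment> \<open>Off \<open>Q\<close> both points lie outside \<Omega>, where
          \<open>v\<close> is 0; there \<open>D u\<close> carries no energy.\<close>
        then have "v x - v y = 0" using v0 by (auto simp: p Q_iff)
        then show ?thesis by (simp add: p)
      next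
        case False
        then have "b * norm (x - y) powr (- (real CARD('n) + 2 * s)) \<le> K (x - y)" by (intro K_lower) auto
        then have "norm (x - y) powr (- (real CARD('n) + 2 * s)) \<le> K (x - y) / b"
          using b_pos by (simp add: pos_le_divide_eq mult.commute)
        then have "(u x - u y)\<^sup>2 * norm (x - y) powr (- (real CARD('n) + 2 * s)) \<le> (u x - u y)\<^sup>2 * (K (x - y) / b)"
          by (intro mult_left_mono) auto
        then show ?thesis using False by (intro ennreal_leI) (simp add: D_sq p e)
      qed
    qed
  qed
  also have "\<dots> = ennreal ((N u)\<^sup>2 / b)"
    using V_D[OF u] b_pos by (subst nn_integral_eq_integral) (auto simp: N_sq)
  finally show ?thesis using that[OF v uv v0] by blast
qed

end

section \<open>Compactness and completeness\<close>

lemma powr_le_1_add_powr: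
  fixes t :: real assumes "0 \<le> t" "0 \<le> q" "q \<le> r" shows "t powr q \<le> 1 + t powr r"
proof (cases "t \<le> 1")
  case True
  then have "t powr q \<le> 1" using assms powr_mono2[of q t 1] by simp
  moreover have "0 \<le> t powr r" by simp
  ultimately show ?thesis by linarith
next
  case False
  then have "t powr q \<le> t powr r" using assms by (intro powr_mono) auto
  then show ?thesis by simp
qed

lemma integrable_of_nn_integral_le:
  fixes g :: "'a \<Rightarrow> real"
  assumes "g \<in> borel_measurable M" "\<And>x. 0 \<le> g x" "0 \<le> C" and le: "(\<integral>\<^sup>+x. ennreal (g x) \<partial>M) \<le> ennreal C"
  shows "integrable M g" "(LINT x|M. g x) \<le> C"
proof -
  show i: "integrable M g"
    using assms by (intro integrableI_bounded) (auto simp: le_less_trans ennreal_less_top)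
  have "ennreal (LINT x|M. g x) \<le> ennreal C"
    using le i assms(2) by (subst nn_integral_eq_integral[symmetric]) auto
  then show "(LINT x|M. g x) \<le> C" using assms(3) by (simp add: ennreal_le_iff)
qed

lemma fatou_square:
  fixes g :: "'a \<Rightarrow> real" and Y :: "nat \<Rightarrow> 'a \<Rightarrow> real"
  assumes g [measurable]: "g \<in> borel_measurable M" and Y [measurable]: "\<And>k. Y k \<in> borel_measurable M"
    and lim: "AE x in M. (\<lambda>k. Y k x) \<longlonglongrightarrow> g x" and int: "\<And>k. integrable M (\<lambda>x. (Y k x)\<^sup>2)"
    and le: "\<And>k. (LINT x|M. (Y k x)\<^sup>2) \<le> C" and C: "0 \<le> C"
  shows "integrable M (\<lambda>x. (g x)\<^sup>2)" "(LINT x|M. (g x)\<^sup>2) \<le> C"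
proof -
  have "(\<integral>\<^sup>+x. ennreal ((g x)\<^sup>2) \<partial>M) = (\<integral>\<^sup>+x. liminf (\<lambda>k. ennreal ((Y k x)\<^sup>2)) \<partial>M)"
  proof (rule nn_integral_cong_AE)
    show "AE x in M. ennreal ((g x)\<^sup>2) = liminf (\<lambda>k. ennreal ((Y k x)\<^sup>2))"
      using lim
    proof eventually_elim
      case (elim x)
      then have "(\<lambda>k. ennreal ((Y k x)\<^sup>2)) \<longlonglongrightarrow> ennreal ((g x)\<^sup>2)" by (intro tendsto_intros)
      then show ?case by (rule lim_imp_Liminf[OF sequentially_bot, symmetric])
    qed
  qed
  also have "\<dots> \<le> liminf (\<lambda>k. \<integral>\<^sup>+x. ennreal ((Y k x)\<^sup>2) \<partial>M)" by (rule nn_integral_liminf) measurable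
  also have "\<dots> \<le> ennreal C"
  proof (rule Liminf_le)
    show "\<forall>\<^sub>F k in sequentially. (\<integral>\<^sup>+x. ennreal ((Y k x)\<^sup>2) \<partial>M) \<le> ennreal C"
      using int le by (intro always_eventually allI) (subst nn_integral_eq_integral, auto intro: ennreal_leI)
  qed simp
  finally have "(\<integral>\<^sup>+x. ennreal ((g x)\<^sup>2) \<partial>M) \<le> ennreal C" .
  from integrable_of_nn_integral_le[OF _ _ C this]
  show "integrable M (\<lambda>x. (g x)\<^sup>2)" "(LINT x|M. (g x)\<^sup>2) \<le> C" by auto
qed

section \<open>Embedding, compactness and completeness of X0\<close>

context nonlocal_space begin

definition p :: real where "p = 2 * real CARD('n) / (real CARD('n) - 2 * s)"
abbreviation Lp :: "(real^'n \<Rightarrow> real) \<Rightarrow> real" where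
  "Lp u \<equiv> LINT x|lebesgue. \<bar>u x\<bar> powr p"
text \<open>The Sobolev constant for the energy bound \<open>(N u)\<^sup>2 / b\<close>, with
  \<open>N u powr p\<close> split off.\<close>

definition Cs :: real where "Cs = (2 powr p / (sobolev_factor s CARD('n) * b)) powr (p / 2)"

lemma p_gt_2: "2 < p"
  using s_pos s_less by (simp add: p_def field_simps)

lemma Cs_nonneg: "0 \<le> Cs" by (simp add: Cs_def)

lemma sobolev_V:
  assumes u: "u \<in> V"
  shows "integrable lebesgue (\<lambda>x. \<bar>u x\<bar> powr p)" "Lp u \<le> Cs * N u powr p"
proof -
  obtain v where v: "v \<in> borel_measurable borel" "AE x in lborel. u x = v x" "\<And>x. x \<notin> \<Omega> \<Longrightarrow> v x = 0"
    "gagliardo s v \<le> ennreal ((N u)\<^sup>2 / b)" using borel_representative[OF u] by blast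
  have C: "(2 powr p / sobolev_factor s CARD('n) * ((N u)\<^sup>2 / b)) powr (p / 2) = Cs * N u powr p"
  proof -
    have "(2 powr p / sobolev_factor s CARD('n) * ((N u)\<^sup>2 / b)) = 2 powr p / (sobolev_factor s CARD('n) * b) * (N u)\<^sup>2" by simp
    moreover have "((N u)\<^sup>2) powr (p / 2) = N u powr p"
    proof (cases "N u = 0")
      case False
      then have "(N u)\<^sup>2 = N u powr 2" using N_nonneg[of u] by simp
      then show ?thesis by (simp add: powr_powr)
    qed (use p_gt_2 in simp)
    ultimately show ?thesis by (simp only: Cs_def powr_mult)
  qed
  have "(\<integral>\<^sup>+x. ennreal (\<bar>u x\<bar> powr p) \<partial>lebesgue) = (\<integral>\<^sup>+x. ennreal (\<bar>v x\<bar> powr p) \<partial>lborel)"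
    unfolding nn_integral_completion using v(2) by (intro nn_integral_cong_AE) (auto elim: eventually_mono)
  also have "\<dots> \<le> ennreal ((2 powr p / sobolev_factor s DIM(real^'n) * ((N u)\<^sup>2 / b)) powr (p / 2))"
    by (rule sobolev_inequality[OF _ _ _ v(1,3) bounded_\<Omega> v(4)]) (use s_pos s_less b_pos in \<open>auto simp: p_def\<close>)
  also have "\<dots> = ennreal (Cs * N u powr p)" using C by (simp only: DIM_cart DIM_real mult_1_right)
  finally have le: "(\<integral>\<^sup>+x. ennreal (\<bar>u x\<bar> powr p) \<partial>lebesgue) \<le> ennreal (Cs * N u powr p)" .
  have [measurable]: "u \<in> borel_measurable lebesgue" using u by (rule V_measurable)
  from integrable_of_nn_integral_le[OF _ _ _ le]
  show "integrable lebesgue (\<lambda>x. \<bar>u x\<bar> powr p)" "Lp u \<le> Cs * N u powr p"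
    using Cs_nonneg by auto
qed

lemma poincare_V:
  assumes u: "u \<in> V" and \<delta>: "\<delta> > 0"
  shows "(LINT x|lebesgue. (u x)\<^sup>2) \<le> (\<Sum>E\<in>grid_cells \<delta> \<Omega>. (LINT x:E|lebesgue. u x)\<^sup>2 / \<delta> ^ CARD('n))
    + real CARD('n) powr (real CARD('n) + 2 * s) * \<delta> powr (2 * s) * ((N u)\<^sup>2 / b)"
proof -
  obtain v where v: "v \<in> borel_measurable borel" "AE x in lborel. u x = v x" "\<And>x. x \<notin> \<Omega> \<Longrightarrow> v x = 0"
    "gagliardo s v \<le> ennreal ((N u)\<^sup>2 / b)" using borel_representative[OF u] by blast
  have [measurable]: "u \<in> borel_measurable lebesgue" using u by (rule V_measurable)
  have [measurable]: "v \<in> borel_measurable lebesgue" using measurable_completion[of v lborel borel] v(1) by simp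
  have uv: "AE x in lebesgue. u x = v x" using v(2) by (rule AE_completion)
  have sq: "(LINT x|lebesgue. (u x)\<^sup>2) = (LINT x|lborel. (v x)\<^sup>2)"
  proof -
    have "(LINT x|lebesgue. (u x)\<^sup>2) = (LINT x|lebesgue. (v x)\<^sup>2)"
      by (rule integral_cong_AE) (use uv in \<open>auto elim: eventually_mono\<close>)
    then show ?thesis using v(1) by (simp add: integral_completion)
  qed
  have cell: "(LINT x:E|lebesgue. u x) = (LINT x:E|lborel. v x)" if "E \<in> grid_cells \<delta> \<Omega>" for E
  proof -
    have [measurable]: "E \<in> sets borel" using that by (auto simp: grid_cells_def)
    then have [measurable]: "E \<in> sets lebesgue" by auto
    have "(LINT x:E|lebesgue. u x) = (LINT x:E|lebesgue. v x)"
      unfolding set_lebesgue_integral_def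
      by (rule integral_cong_AE) (use uv in \<open>auto elim: eventually_mono\<close>)
    also have "\<dots> = (LINT x:E|lborel. v x)"
      unfolding set_lebesgue_integral_def using v(1) by (intro integral_completion) simp
    finally show ?thesis .
  qed
  have "integrable lebesgue (\<lambda>x. (v x)\<^sup>2)"
    by (rule integrable_cong_AE_imp[OF V_square[OF u]]) (use uv in \<open>auto elim: eventually_mono\<close>)
  then have "integrable lborel (\<lambda>x. (v x)\<^sup>2)" using v(1) by (simp add: integrable_completion)
  from grid_poincare[OF v(1) this v(3) bounded_\<Omega> v(4) _ s_pos \<delta>]
  show ?thesis using b_pos by (simp add: sq cell)
qed

definition \<Omega>_vol :: real where "\<Omega>_vol = measure lebesgue \<Omega>"

lemma \<Omega>_sets: "\<Omega> \<in> sets lebesgue" using open_\<Omega> by auto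

lemma \<Omega>_finite: "emeasure lebesgue \<Omega> < \<infinity>"
  using emeasure_bounded_finite[OF bounded_\<Omega>] open_\<Omega> by simp

lemma integrable_indicator_\<Omega>: "integrable lebesgue (indicator \<Omega> :: _ \<Rightarrow> real)"
  using \<Omega>_sets \<Omega>_finite by (intro integrable_real_indicator) auto

lemma integral_indicator_\<Omega>: "(LINT x|lebesgue. indicator \<Omega> x) = \<Omega>_vol"
  using \<Omega>_sets by (simp add: \<Omega>_vol_def)

lemma \<Omega>_vol_nonneg: "0 \<le> \<Omega>_vol" by (simp add: \<Omega>_vol_def)

text \<open>A crude substitute for Hoelder's inequality on the bounded set \<Omega>: lower powers
  are at most 1 plus the critical power.\<close>

lemma V_powr:
  assumes u: "u \<in> V" and q: "0 < q" "q \<le> p"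
  shows "integrable lebesgue (\<lambda>x. \<bar>u x\<bar> powr q)" "(LINT x|lebesgue. \<bar>u x\<bar> powr q) \<le> \<Omega>_vol + Cs * N u powr p"
proof -
  have [measurable]: "u \<in> borel_measurable lebesgue" using u by (rule V_measurable)
  have bd: "AE x in lebesgue. \<bar>u x\<bar> powr q \<le> indicator \<Omega> x + \<bar>u x\<bar> powr p"
    using V_zero[OF u]
  proof eventually_elim
    case (elim x)
    then show ?case using powr_le_1_add_powr[of "\<bar>u x\<bar>" q p] q p_gt_2 by (cases "x \<in> \<Omega>") auto
  qed
  have int: "integrable lebesgue (\<lambda>x. indicator \<Omega> x + \<bar>u x\<bar> powr p)"
    using integrable_indicator_\<Omega> sobolev_V[OF u] by simp
  show i: "integrable lebesgue (\<lambda>x. \<bar>u x\<bar> powr q)"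
    by (rule Bochner_Integration.integrable_bound[OF int]) (use bd in \<open>auto elim: eventually_mono\<close>)
  have "(LINT x|lebesgue. \<bar>u x\<bar> powr q) \<le> (LINT x|lebesgue. indicator \<Omega> x + \<bar>u x\<bar> powr p)"
    by (rule integral_mono_AE[OF i int bd])
  also have "\<dots> = \<Omega>_vol + Lp u"
    using integrable_indicator_\<Omega> sobolev_V[OF u] integral_indicator_\<Omega> by simp
  finally show "(LINT x|lebesgue. \<bar>u x\<bar> powr q) \<le> \<Omega>_vol + Cs * N u powr p" using sobolev_V[OF u] by simp
qed

lemma V_abs:
  assumes u: "u \<in> V"
  shows "integrable lebesgue (\<lambda>x. \<bar>u x\<bar>)" "(LINT x|lebesgue. \<bar>u x\<bar>) \<le> \<Omega>_vol + Cs * N u powr p"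
    "integrable lebesgue u"
proof -
  show "integrable lebesgue (\<lambda>x. \<bar>u x\<bar>)" "(LINT x|lebesgue. \<bar>u x\<bar>) \<le> \<Omega>_vol + Cs * N u powr p"
    using V_powr[OF u, of 1] p_gt_2 by auto
  then show "integrable lebesgue u" using V_measurable[OF u] by (simp add: integrable_abs_iff)
qed

lemma Cs_mono: "N u \<le> r \<Longrightarrow> Cs * N u powr p \<le> Cs * r powr p"
  using N_nonneg[of u] Cs_nonneg p_gt_2 by (intro mult_left_mono powr_mono2) auto

lemma V_square_le: "u \<in> V \<Longrightarrow> N u \<le> r \<Longrightarrow> (LINT x|lebesgue. (u x)\<^sup>2) \<le> \<Omega>_vol + Cs * r powr p"
  using V_powr(2)[of u 2] p_gt_2 Cs_mono[of u r] by simp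

definition conv :: "(nat \<Rightarrow> real^'n \<Rightarrow> real) \<Rightarrow> (real^'n \<Rightarrow> real) \<Rightarrow> bool" where
  "conv X u \<longleftrightarrow> (AE x in lebesgue. (\<lambda>k. X k x) \<longlonglongrightarrow> u x)"

text \<open>Fatou's lemma, applied to the functions and to their difference quotients
  \<open>D\<close>; the second use is the lower semicontinuity of the norm.\<close>

lemma V_closed:
  assumes X: "\<And>k. X k \<in> V" "\<And>k. N (X k) \<le> R" and u [measurable]: "u \<in> borel_measurable lebesgue" and lim: "conv X u"
  shows "u \<in> V" "N u \<le> R"
proof -
  have R: "0 \<le> R" using N_nonneg[of "X 0"] X(2)[of 0] by simp
  have X_m [measurable]: "X k \<in> borel_measurable lebesgue" for k using X(1) by (rule V_measurable)
  have lim: "AE x in lebesgue. (\<lambda>k. X k x) \<longlonglongrightarrow> u x" using lim by (simp add: conv_def)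
  have limD: "AE q in lebesgue. (\<lambda>k. D (X k) q) \<longlonglongrightarrow> D u q"
    using AE_lebesgue_fst[OF lim] AE_lebesgue_snd[OF lim]
    unfolding D_def by eventually_elim (intro tendsto_intros)
  have "(LINT q|lebesgue. (D (X k) q)\<^sup>2) \<le> R\<^sup>2" for k
    unfolding N_sq[symmetric] using X(2) N_nonneg by (intro power_mono)
  note 1 = fatou_square[OF D_measurable[OF u] D_measurable[OF X_m] limD V_D[OF X(1)] this zero_le_power2]
  have "integrable lebesgue (\<lambda>x. (u x)\<^sup>2)"
    by (rule fatou_square(1)[OF u X_m lim V_square[OF X(1)] V_square_le[OF X]])
       (simp add: \<Omega>_vol_nonneg Cs_nonneg)
  have "AE x in lebesgue. \<forall>k. x \<notin> \<Omega> \<longrightarrow> X k x = 0" unfolding AE_all_countable using V_zero[OF X(1)] by blast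
  then have z: "AE x in lebesgue. x \<notin> \<Omega> \<longrightarrow> u x = 0"
    using lim
  proof eventually_elim
    case (elim x)
    show ?case
    proof
      assume "x \<notin> \<Omega>"
      then have "(\<lambda>k. X k x) = (\<lambda>_. 0)" using elim by auto
      then show "u x = 0" using elim(2) by (simp add: LIMSEQ_const_iff)
    qed
  qed
  show "u \<in> V" unfolding V_iff using 1(1) u z \<open>integrable lebesgue (\<lambda>x. (u x)\<^sup>2)\<close> by blast
  have "(N u)\<^sup>2 \<le> R\<^sup>2" using 1(2) by (simp add: N_sq)
  then show "N u \<le> R" using R by (rule power2_le_imp_le)
qed

text \<open>Pointwise on \<Omega>, \<open>\<bar>w\<bar>\<close> is at most \<open>\<eta>\<close> or
  at most \<open>w\<^sup>2 / \<eta>\<close>. This passes from mean square to mean, where Cauchy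
  sequences have subsequences that are Cauchy almost everywhere.\<close>

lemma L1_small:
  fixes w :: "real^'n \<Rightarrow> real"
  assumes w: "w \<in> V" and \<eta>: "\<eta> > 0"
  shows "(LINT x|lebesgue. \<bar>w x\<bar>) \<le> \<eta> * \<Omega>_vol + (LINT x|lebesgue. (w x)\<^sup>2) / \<eta>"
proof -
  have "(LINT x|lebesgue. \<bar>w x\<bar>) \<le> (LINT x|lebesgue. \<eta> * indicator \<Omega> x + (w x)\<^sup>2 / \<eta>)"
  proof (rule integral_mono_AE)
    show "integrable lebesgue (\<lambda>x. \<bar>w x\<bar>)" using V_abs[OF w] by simp
    show "integrable lebesgue (\<lambda>x. \<eta> * indicator \<Omega> x + (w x)\<^sup>2 / \<eta>)"
      using integrable_indicator_\<Omega> V_square[OF w] by simp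
    show "AE x in lebesgue. \<bar>w x\<bar> \<le> \<eta> * indicator \<Omega> x + (w x)\<^sup>2 / \<eta>"
      using V_zero[OF w]
    proof eventually_elim
      case (elim x)
      have "\<eta> * \<bar>w x\<bar> \<le> \<eta> * \<eta> + (w x)\<^sup>2"
      proof (cases "\<bar>w x\<bar> \<le> \<eta>")
        case True
        then have "\<eta> * \<bar>w x\<bar> \<le> \<eta> * \<eta>" using \<eta> by (intro mult_left_mono) auto
        then show ?thesis by (simp add: add_increasing2)
      next
        case False
        then have "\<eta> * \<bar>w x\<bar> \<le> \<bar>w x\<bar> * \<bar>w x\<bar>" by (intro mult_right_mono) auto
        moreover have "0 \<le> \<eta> * \<eta>" by simp
        ultimately show ?thesis unfolding power2_eq_square abs_mult_self_eq by linarith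
      qed
      then have "\<bar>w x\<bar> \<le> \<eta> + (w x)\<^sup>2 / \<eta>" using \<eta> by (simp add: field_simps)
      then show ?case using elim \<eta> by (cases "x \<in> \<Omega>") auto
    qed
  qed
  also have "\<dots> = \<eta> * \<Omega>_vol + (LINT x|lebesgue. (w x)\<^sup>2) / \<eta>"
    using integrable_indicator_\<Omega> V_square[OF w] integral_indicator_\<Omega> by simp
  finally show ?thesis .
qed

text \<open>
  Along a subsequence for which the integrals over all cells of all the grids converge, the Poincare
  inequality makes the sequence Cauchy in mean.
\<close>

lemma ex_cell_convergent_subsequence:
  assumes X: "\<And>k::nat. X k \<in> V" "\<And>k. N (X k) \<le> R"
  shows "\<exists>r. strict_mono r \<and> (\<forall>m. \<forall>E\<in>grid_cells (1 / real (Suc m)) \<Omega>. convergent (\<lambda>k. LINT x:E|lebesgue. X (r k) x))"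
proof -
  \<comment> \<open>The empty set is added so that the countable family can be enumerated even if
    there are no cells.\<close>
  define F where "F = insert {} (\<Union>m. grid_cells (1 / real (Suc m)) \<Omega>)"
  have "countable (grid_cells (1 / real (Suc m)) \<Omega>)" for m
    by (intro countable_finite finite_grid_cells bounded_\<Omega>) simp
  then have "countable F" unfolding F_def by (intro countable_insert countable_UN countableI_type)
  then have F: "range (from_nat_into F) = F" by (intro range_from_nat_into) (auto simp: F_def)
  define a where "a n k = (LINT x:from_nat_into F n|lebesgue. X k x)" for n k
  have a_bd: "\<bar>a n k\<bar> \<le> \<Omega>_vol + Cs * R powr p" for n k
  proof -
    have "from_nat_into F n \<in> F" using F by blast
    then have E [measurable]: "from_nat_into F n \<in> sets lebesgue" by (auto simp: F_def grid_cells_def)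
    have "\<bar>a n k\<bar> \<le> (LINT x|lebesgue. \<bar>indicator (from_nat_into F n) x * X k x\<bar>)"
      unfolding a_def set_lebesgue_integral_def real_scaleR_def by (rule integral_abs_bound)
    also have "\<dots> \<le> (LINT x|lebesgue. \<bar>X k x\<bar>)"
    proof (rule integral_mono)
      show "integrable lebesgue (\<lambda>x. \<bar>indicator (from_nat_into F n) x * X k x\<bar>)"
        using V_measurable[OF X(1)[of k]]
        by (intro Bochner_Integration.integrable_bound[OF V_abs(1)[OF X(1)[of k]]]) (auto simp: indicator_def)
    qed (use V_abs[OF X(1)] in \<open>auto simp: indicator_def\<close>)
    also have "\<dots> \<le> \<Omega>_vol + Cs * N (X k) powr p" using V_abs[OF X(1)] by simp
    also have "\<dots> \<le> \<Omega>_vol + Cs * R powr p" using Cs_mono[OF X(2)] by simp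
    finally show ?thesis .
  qed
  interpret subseqs "\<lambda>n r. convergent (\<lambda>k. a n (r k))"
  proof
    fix n and q :: "nat \<Rightarrow> nat"
    have "bounded (range (\<lambda>k. a n (q k)))"
      using a_bd[of n] by (auto intro!: boundedI)
    then obtain l r where "strict_mono (r :: nat \<Rightarrow> nat)" "((\<lambda>k. a n (q k)) \<circ> r) \<longlonglongrightarrow> l"
      using bounded_imp_convergent_subsequence by blast
    then show "\<exists>r. strict_mono r \<and> convergent (\<lambda>k. a n ((q \<circ> r) k))"
      by (auto simp: o_def convergent_def)
  qed
  \<comment> \<open>The diagonal argument needs the property to pass to subsequences.\<close>
  have stable: "convergent (\<lambda>k. a n ((q \<circ> r) k))"
    if "strict_mono r" "convergent (\<lambda>k. a n (q k))" for r q :: "nat \<Rightarrow> nat" and n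
    using convergent_subseq_convergent[OF that(2,1)] by (simp add: o_def)
  have conv: "convergent (\<lambda>k. a n (diagseq k))" for n
  proof -
    \<comment> \<open>The diagonal sequence is a subsequence of the n-th one only from index
      \<open>Suc n\<close> on.\<close>
    have "convergent (\<lambda>k. a n ((diagseq \<circ> (+) (Suc n)) k))" by (rule diagseq_holds) (rule stable)
    then have "convergent (\<lambda>k. a n (diagseq (k + Suc n)))" by (simp add: o_def add.commute)
    then show ?thesis by (rule iffD1[OF convergent_ignore_initial_segment])
  qed
  show ?thesis
  proof (intro exI conjI allI ballI)
    show "strict_mono diagseq" by (rule subseq_diagseq)
    fix m E assume "E \<in> grid_cells (1 / real (Suc m)) \<Omega>"
    then have "E \<in> F" by (auto simp: F_def)
    then obtain n where "E = from_nat_into F n" using F by blast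
    then show "convergent (\<lambda>k. LINT x:E|lebesgue. X (diagseq k) x)" using conv[of n] by (simp add: a_def)
  qed
qed

text \<open>Once the cell integrals converge, the differences \<open>Y i - Y j\<close> are small in
  mean. A further subsequence then converges almost everywhere, and \<open>V_closed\<close> puts the
  limit in X0.\<close>

lemma V_compact:
  assumes X: "\<And>k::nat. X k \<in> V" "\<And>k. N (X k) \<le> R"
  shows "\<exists>(r :: nat \<Rightarrow> nat) u. strict_mono r \<and> u \<in> V \<and> conv (\<lambda>k. X (r k)) u"
proof -
  have R: "0 \<le> R" using N_nonneg[of "X 0"] X(2)[of 0] by simp
  have "\<exists>r. strict_mono r \<and> (\<forall>m. \<forall>E\<in>grid_cells (1 / real (Suc m)) \<Omega>. convergent (\<lambda>k. LINT x:E|lebesgue. X (r k) x))"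
    by (rule ex_cell_convergent_subsequence) (rule X)+
  then obtain r where r: "strict_mono r"
    and cells: "\<forall>m. \<forall>E\<in>grid_cells (1 / real (Suc m)) \<Omega>. convergent (\<lambda>k. LINT x:E|lebesgue. X (r k) x)"
    by (elim exE conjE)
  define Y where "Y k = X (r k)" for k
  have Y: "Y k \<in> V" "N (Y k) \<le> R" for k using X by (auto simp: Y_def)
  have Ydiff: "Y i - Y j \<in> V" "N (Y i - Y j) \<le> 2 * R" for i j
  proof -
    show d: "Y i - Y j \<in> V" using Y by (intro V_diff)
    have i: "integrable lebesgue (\<lambda>q. (D (Y i) q)\<^sup>2)" "integrable lebesgue (\<lambda>q. (D (Y j) q)\<^sup>2)"
      by (rule V_D[OF Y(1)])+
    have pw: "(D (Y i - Y j) q)\<^sup>2 \<le> 2 * (D (Y i) q)\<^sup>2 + 2 * (D (Y j) q)\<^sup>2" for q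
      using zero_le_power2[of "D (Y i) q + D (Y j) q"] unfolding D_diff power2_sum power2_diff by linarith
    have "(N (Y i - Y j))\<^sup>2 \<le> (LINT q|lebesgue. 2 * (D (Y i) q)\<^sup>2 + 2 * (D (Y j) q)\<^sup>2)"
      unfolding N_sq by (rule integral_mono[OF V_D[OF d] _ pw]) (use i in simp)
    also have "\<dots> = 2 * (N (Y i))\<^sup>2 + 2 * (N (Y j))\<^sup>2" using i by (simp add: N_sq)
    also have "\<dots> \<le> 2 * R\<^sup>2 + 2 * R\<^sup>2"
      using power_mono[OF Y(2)[of i] N_nonneg, of 2] power_mono[OF Y(2)[of j] N_nonneg, of 2] by linarith
    also have "\<dots> = (2 * R)\<^sup>2" by (simp add: power_mult_distrib)
    finally show "N (Y i - Y j) \<le> 2 * R" by (rule power2_le_imp_le) (use R in simp)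
  qed
  have cauchy: "\<exists>n0. \<forall>i\<ge>n0. \<forall>j\<ge>n0. (LINT x|lebesgue. norm (Y i x - Y j x)) < e" if e: "e > 0" for e
  proof -
    \<comment> \<open>The budget: \<open>\<eta> * \<Omega>_vol\<close> is at most
      \<open>e / 4\<close>, and a mean square below \<open>\<eta> * e / 2\<close> contributes less
      than \<open>e / 2\<close>. Adding 1 to the volume keeps the division meaningful.\<close>
    define \<eta> where "\<eta> = e / 4 / (\<Omega>_vol + 1)"
    have \<eta>: "\<eta> > 0" using e \<Omega>_vol_nonneg by (simp add: \<eta>_def)
    have \<eta>v: "\<eta> * \<Omega>_vol \<le> e / 4"
    proof -
      have "\<eta> * \<Omega>_vol \<le> \<eta> * (\<Omega>_vol + 1)" using \<eta> by simp
      also have "\<dots> = e / 4"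
      proof -
        have "\<Omega>_vol + 1 \<noteq> 0" using \<Omega>_vol_nonneg by linarith
        moreover have "c / d * d = c" if "d \<noteq> 0" for c d :: real using that by simp
        ultimately show ?thesis unfolding \<eta>_def by blast
      qed
      finally show ?thesis .
    qed
    define C where "C = real CARD('n) powr (real CARD('n) + 2 * s) * ((2 * R)\<^sup>2 / b)"
    have C: "0 \<le> C" using b_pos by (simp add: C_def)
    have "(\<lambda>m. C * (1 / real (Suc m)) powr (2 * s)) \<longlonglongrightarrow> C * 0 powr (2 * s)"
      by (rule tendsto_mult_left, rule tendsto_powr'[OF LIMSEQ_Suc[OF lim_1_over_n] tendsto_const]) (use s_pos in auto)
    then have "(\<lambda>m. C * (1 / real (Suc m)) powr (2 * s)) \<longlonglongrightarrow> 0" using s_pos by simp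
    then have "\<forall>\<^sub>F m in sequentially. C * (1 / real (Suc m)) powr (2 * s) < \<eta> * e / 4"
      by (rule order_tendstoD) (use \<eta> e in simp)
    then obtain m where m: "C * (1 / real (Suc m)) powr (2 * s) < \<eta> * e / 4"
      using eventually_happens'[OF sequentially_bot] by blast
    define \<delta> where "\<delta> = 1 / real (Suc m)"
    have \<delta>: "\<delta> > 0" by (simp add: \<delta>_def)
    define Z where "Z = grid_cells \<delta> \<Omega>"
    have Z: "finite Z" unfolding Z_def using bounded_\<Omega> \<delta> by (rule finite_grid_cells)
    define a where "a E k = (LINT x:E|lebesgue. Y k x)" for E k
    have a_conv: "convergent (a E)" if "E \<in> Z" for E
      using cells that by (simp add: a_def[abs_def] Y_def Z_def \<delta>_def)
    \<comment> \<open>With cell integrals this close, the cell sum of the Poincare inequality is at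
      most \<open>\<eta> * e / 4\<close>; the other \<open>\<eta> * e / 4\<close> is the energy
      term, made small by the choice of \<open>m\<close>.\<close>
    define \<theta> where "\<theta> = sqrt (\<eta> * e / 4 * \<delta> ^ CARD('n) / (real (card Z) + 1))"
    have \<theta>: "\<theta> > 0" using \<eta> e \<delta> by (simp add: \<theta>_def)
    have "\<forall>E\<in>Z. \<exists>n0. \<forall>i\<ge>n0. \<forall>j\<ge>n0. \<bar>a E i - a E j\<bar> < \<theta>"
    proof
      fix E assume "E \<in> Z"
      then have "Cauchy (a E)" using a_conv by (simp add: Cauchy_convergent_iff)
      then show "\<exists>n0. \<forall>i\<ge>n0. \<forall>j\<ge>n0. \<bar>a E i - a E j\<bar> < \<theta>"
        using \<theta> by (auto simp: Cauchy_def dist_real_def)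
    qed
    from bchoice[OF this] obtain n0
      where n0: "\<And>E i j. E \<in> Z \<Longrightarrow> i \<ge> n0 E \<Longrightarrow> j \<ge> n0 E \<Longrightarrow> \<bar>a E i - a E j\<bar> < \<theta>" by blast
    define n1 where "n1 = Max (insert 0 (n0 ` Z))"
    have n1: "n0 E \<le> n1" if "E \<in> Z" for E unfolding n1_def using Z that by (intro Max_ge) auto
    have "(LINT x|lebesgue. norm (Y i x - Y j x)) < e" if ij: "i \<ge> n1" "j \<ge> n1" for i j
    proof -
      have cell: "(LINT x:E|lebesgue. (Y i - Y j) x)\<^sup>2 / \<delta> ^ CARD('n) \<le> \<eta> * e / 4 / (real (card Z) + 1)" if E: "E \<in> Z" for E
      proof -
        have [measurable]: "E \<in> sets lebesgue" using E by (auto simp: Z_def grid_cells_def)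
        have si: "set_integrable lebesgue E (Y k)" for k
          unfolding set_integrable_def using V_measurable[OF Y(1)[of k]]
          by (intro Bochner_Integration.integrable_bound[OF V_abs(1)[OF Y(1)[of k]]]) (auto simp: indicator_def)
        have "(LINT x:E|lebesgue. (Y i - Y j) x) = a E i - a E j"
          unfolding a_def using set_integral_diff(2)[OF si si] by (simp add: fun_diff_def)
        moreover have "\<bar>a E i - a E j\<bar> \<le> \<theta>" 
          using n0[OF E order_trans[OF n1[OF E] ij(1)] order_trans[OF n1[OF E] ij(2)]] by simp
        then have "(a E i - a E j)\<^sup>2 \<le> \<theta>\<^sup>2" using abs_le_square_iff[of "a E i - a E j" \<theta>] \<theta> by simp
        moreover have "\<theta>\<^sup>2 = \<eta> * e / 4 * \<delta> ^ CARD('n) / (real (card Z) + 1)"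
          unfolding \<theta>_def using \<eta> e \<delta> by (intro real_sqrt_pow2) auto
        ultimately show ?thesis using \<delta> by (simp add: divide_le_eq)
      qed
      have "(LINT x|lebesgue. ((Y i - Y j) x)\<^sup>2) \<le> (\<Sum>E\<in>Z. (LINT x:E|lebesgue. (Y i - Y j) x)\<^sup>2 / \<delta> ^ CARD('n))
        + real CARD('n) powr (real CARD('n) + 2 * s) * \<delta> powr (2 * s) * ((N (Y i - Y j))\<^sup>2 / b)"
        unfolding Z_def by (rule poincare_V[OF Ydiff(1) \<delta>])
      also have "(\<Sum>E\<in>Z. (LINT x:E|lebesgue. (Y i - Y j) x)\<^sup>2 / \<delta> ^ CARD('n)) \<le> (\<Sum>E\<in>Z. \<eta> * e / 4 / (real (card Z) + 1))"
        by (rule sum_mono) (rule cell)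
      also have "(\<Sum>E\<in>Z. \<eta> * e / 4 / (real (card Z) + 1)) \<le> \<eta> * e / 4"
      proof -
        have "(\<Sum>E\<in>Z. \<eta> * e / 4 / (real (card Z) + 1)) = \<eta> * e / 4 * (real (card Z) / (real (card Z) + 1))" by simp
        also have "\<dots> \<le> \<eta> * e / 4 * 1" using \<eta> e by (intro mult_left_mono) auto
        finally show ?thesis by simp
      qed
      also have "real CARD('n) powr (real CARD('n) + 2 * s) * \<delta> powr (2 * s) * ((N (Y i - Y j))\<^sup>2 / b) \<le> C * \<delta> powr (2 * s)"
      proof -
        have "(N (Y i - Y j))\<^sup>2 / b \<le> (2 * R)\<^sup>2 / b"
          using Ydiff(2) N_nonneg b_pos by (intro divide_right_mono power_mono) auto
        then have "real CARD('n) powr (real CARD('n) + 2 * s) * \<delta> powr (2 * s) * ((N (Y i - Y j))\<^sup>2 / b)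
          \<le> real CARD('n) powr (real CARD('n) + 2 * s) * \<delta> powr (2 * s) * ((2 * R)\<^sup>2 / b)"
          by (intro mult_left_mono) auto
        then show ?thesis by (simp add: C_def mult_ac)
      qed
      also have "C * \<delta> powr (2 * s) < \<eta> * e / 4" using m by (simp add: \<delta>_def)
      finally have "(LINT x|lebesgue. ((Y i - Y j) x)\<^sup>2) < \<eta> * e / 4 + \<eta> * e / 4" by simp
      then have "(LINT x|lebesgue. ((Y i - Y j) x)\<^sup>2) / \<eta> < e / 2" using \<eta> by (simp add: divide_less_eq mult.commute)
      moreover have "(LINT x|lebesgue. \<bar>(Y i - Y j) x\<bar>) \<le> \<eta> * \<Omega>_vol + (LINT x|lebesgue. ((Y i - Y j) x)\<^sup>2) / \<eta>"
        by (rule L1_small[OF Ydiff(1) \<eta>])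
      ultimately have "(LINT x|lebesgue. \<bar>(Y i - Y j) x\<bar>) < e" using \<eta>v e by linarith
      then show ?thesis by simp
    qed
    then show ?thesis by blast
  qed
  obtain q where q: "strict_mono q" "AE x in lebesgue. Cauchy (\<lambda>i. Y (q i) x)"
    by (rule cauchy_L1_AE_cauchy_subseq[of lebesgue Y, OF V_abs(3)[OF Y(1)] cauchy])
  define u where "u x = lim (\<lambda>i. Y (q i) x)" for x
  have u_m: "u \<in> borel_measurable lebesgue"
    unfolding u_def using V_measurable[OF Y(1)] by (intro borel_measurable_lim_metric)
  have lim: "conv (\<lambda>k. Y (q k)) u"
    unfolding conv_def using q(2)
  proof eventually_elim
    case (elim x)
    then have "convergent (\<lambda>i. Y (q i) x)" by (simp add: Cauchy_convergent_iff)
    then show ?case by (simp add: u_def convergent_LIMSEQ_iff)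
  qed
  have "u \<in> V" by (rule V_closed(1)[of "\<lambda>k. Y (q k)" R, OF _ _ u_m lim]) (rule Y)+
  then show ?thesis
    using strict_mono_o[OF r q(1)] lim by (intro exI[of _ "r \<circ> q"] exI[of _ u]) (simp add: Y_def)
qed

lemma conv_const: "conv (\<lambda>_. u) u" by (simp add: conv_def)

lemma conv_subseq: "conv X u \<Longrightarrow> strict_mono r \<Longrightarrow> conv (\<lambda>k. X (r k)) u"
  unfolding conv_def by (erule eventually_mono) (drule LIMSEQ_subseq_LIMSEQ, auto simp: o_def)

lemma conv_diff: "conv X u \<Longrightarrow> conv Y v \<Longrightarrow> conv (\<lambda>k. X k - Y k) (u - v)"
  unfolding conv_def fun_diff_def
proof -
  assume "AE x in lebesgue. (\<lambda>k. X k x) \<longlonglongrightarrow> u x" "AE x in lebesgue. (\<lambda>k. Y k x) \<longlonglongrightarrow> v x"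
  then show "AE x in lebesgue. (\<lambda>k. X k x - Y k x) \<longlonglongrightarrow> u x - v x"
    by eventually_elim (rule tendsto_diff)
qed

text \<open>Completeness follows from compactness: the sequence has a subsequence converging almost
  everywhere to some \<open>u\<close> in X0, and lower semicontinuity along
  \<open>X m - X (r k)\<close> turns the Cauchy estimate into one for
  \<open>X m - u\<close>.\<close>

lemma V_complete:
  assumes X: "\<And>k::nat. X k \<in> V" and cauchy: "\<And>e. e > 0 \<Longrightarrow> \<exists>n0. \<forall>m\<ge>n0. \<forall>n\<ge>n0. N (X m - X n) < e"
    and bdd: "\<And>k. N (X k) \<le> R"
  shows "\<exists>u\<in>V. (\<lambda>k. N (X k - u)) \<longlonglongrightarrow> 0"
proof -
  have "\<exists>(r :: nat \<Rightarrow> nat) u. strict_mono r \<and> u \<in> V \<and> conv (\<lambda>k. X (r k)) u"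
    by (rule V_compact) (rule X bdd)+
  then obtain r u where r: "strict_mono (r :: nat \<Rightarrow> nat)" "u \<in> V" "conv (\<lambda>k. X (r k)) u"
    by blast
  have "(\<lambda>k. N (X k - u)) \<longlonglongrightarrow> 0"
  proof (rule tendstoI)
    fix e :: real assume "e > 0"
    then have "e / 2 > 0" by simp
    from cauchy[OF this] obtain n0 where n0: "\<And>m n. m \<ge> n0 \<Longrightarrow> n \<ge> n0 \<Longrightarrow> N (X m - X n) < e / 2" by blast
    have "N (X m - u) \<le> e / 2" if m: "m \<ge> n0" for m
    proof -
      have sm: "strict_mono (\<lambda>k. k + n0)" by (simp add: strict_mono_def)
      have c: "conv (\<lambda>k. X m - X (r (k + n0))) (X m - u)"
        by (rule conv_diff[OF conv_const conv_subseq[OF r(3) sm]])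
      have le: "N (X m - X (r (k + n0))) \<le> e / 2" for k
      proof -
        have "n0 \<le> r (k + n0)" using seq_suble[OF r(1), of "k + n0"] by simp
        then show ?thesis using n0[OF m] less_imp_le by blast
      qed
      show ?thesis
        by (rule V_closed(2)[of "\<lambda>k. X m - X (r (k + n0))", OF _ _ V_measurable[OF V_diff[OF X r(2)]] c])
           (rule V_diff X le)+
    qed
    then show "\<forall>\<^sub>F k in sequentially. dist (N (X k - u)) 0 < e"
      using \<open>e > 0\<close> N_nonneg by (intro eventually_sequentiallyI[of n0]) fastforce
  qed
  then show ?thesis using r(2) by blast
qed

end

section \<open>The potential and its derivative\<close>

lemma prim_has_derivative_within:
  assumes "a \<le> 0" "0 \<le> b" "continuous_on {a..b} g" "t \<in> {a..b}"
  shows "(prim g has_real_derivative g t) (at t within {a..b})"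
  using interval_integral_FTC2[OF assms(1,2,3), of t] assms(4)
  by (simp add: prim_def[abs_def] has_real_derivative_iff_has_vector_derivative zero_ereal_def)

lemma prim_0 [simp]: "prim g 0 = 0"
  by (simp add: prim_def zero_ereal_def)

lemma prim_zero_fun [simp]: "prim (\<lambda>_. 0) t = 0"
  by (simp add: prim_def)

lemma prim_has_derivative:
  assumes "a < 0" "0 < b" "continuous_on {a<..<b} g" "t \<in> {a<..<b}"
  shows "(prim g has_real_derivative g t) (at t)"
proof -
  \<comment> \<open>A compact interval inside the open one, containing both 0, where the primitive
    starts, and \<open>t\<close> in its interior.\<close>
  define c d where "c = (a + min 0 t) / 2" and "d = (b + max 0 t) / 2"
  have cd: "a < c" "c < 0" "c < t" "0 < d" "t < d" "d < b" using assms by (auto simp: c_def d_def min_def max_def)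
  have "continuous_on {c..d} g" using cd by (intro continuous_on_subset[OF assms(3)]) auto
  then have "(prim g has_real_derivative g t) (at t within {c..d})"
    using cd by (intro prim_has_derivative_within) auto
  moreover have "at t within {c..d} = at t" using cd by (intro at_within_interior) simp
  ultimately show ?thesis by simp
qed

lemma prim_has_derivative_UNIV:
  assumes "continuous_on UNIV g" shows "(prim g has_real_derivative g t) (at t)"
proof (rule prim_has_derivative[of "- \<bar>t\<bar> - 1" "\<bar>t\<bar> + 1"])
  show "continuous_on {- \<bar>t\<bar> - 1<..<\<bar>t\<bar> + 1} g" using assms by (rule continuous_on_subset) simp
qed auto

lemma prim_has_derivative_atLeast:
  assumes "continuous_on {0..} g" "0 \<le> t"
  shows "(prim g has_real_derivative g t) (at t within {0..})"
proof -
  have "(prim g has_real_derivative g t) (at t within {0..t + 1})"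
    using assms by (intro prim_has_derivative_within continuous_on_subset[OF assms(1)]) auto
  moreover have "at t within {0..t + 1} = at t within {0..}"
    by (rule at_within_nhd[of _ "{..<t + 1}"]) auto
  ultimately show ?thesis by simp
qed

text \<open>Rounding \<open>t\<close> down to a multiple of \<open>1 / Suc k\<close> leaves only
  countably many values, for which measurability in \<open>x\<close> suffices; continuity in
  \<open>t\<close> gives the limit.\<close>

lemma borel_measurable_caratheodory:
  fixes g :: "'a \<Rightarrow> real \<Rightarrow> real"
  assumes meas: "\<And>t. (\<lambda>x. g x t) \<in> borel_measurable M" and cont: "\<And>x. x \<in> space M \<Longrightarrow> continuous_on UNIV (g x)"
  shows "(\<lambda>q. g (fst q) (snd q)) \<in> borel_measurable (M \<Otimes>\<^sub>M borel)"
proof (rule borel_measurable_LIMSEQ_real)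
  let ?h = "\<lambda>k t. of_int \<lfloor>real (Suc k) * t\<rfloor> / real (Suc k)"
  show "(\<lambda>q. g (fst q) (?h k (snd q))) \<in> borel_measurable (M \<Otimes>\<^sub>M borel)" for k
  proof (rule measurable_compose_countable[where f = "\<lambda>i q. g (fst q) (of_int i / real (Suc k))"
        and g = "\<lambda>q. \<lfloor>real (Suc k) * snd q\<rfloor>"])
    show "(\<lambda>q. g (fst q) (of_int i / real (Suc k))) \<in> borel_measurable (M \<Otimes>\<^sub>M borel)" for i
      by (rule measurable_compose[OF measurable_fst meas])
    show "(\<lambda>q. \<lfloor>real (Suc k) * snd q\<rfloor>) \<in> M \<Otimes>\<^sub>M borel \<rightarrow>\<^sub>M count_space UNIV" by measurable
  qed
  fix q :: "'a \<times> real" assume q: "q \<in> space (M \<Otimes>\<^sub>M borel)"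
  have "(\<lambda>k. ?h k (snd q)) \<longlonglongrightarrow> snd q"
  proof (rule tendsto_of_abs_diff_le[OF always_eventually LIMSEQ_Suc[OF lim_1_over_n]], rule allI)
    fix k
    have "real (Suc k) * snd q - 1 < of_int \<lfloor>real (Suc k) * snd q\<rfloor>" "of_int \<lfloor>real (Suc k) * snd q\<rfloor> \<le> real (Suc k) * snd q"
      by linarith+
    then have "\<bar>of_int \<lfloor>real (Suc k) * snd q\<rfloor> - real (Suc k) * snd q\<bar> \<le> 1" by linarith
    then have "\<bar>(of_int \<lfloor>real (Suc k) * snd q\<rfloor> - real (Suc k) * snd q) / real (Suc k)\<bar> \<le> 1 / real (Suc k)"
      by (simp add: abs_divide divide_right_mono del: of_nat_Suc)
    moreover have "(of_int \<lfloor>real (Suc k) * snd q\<rfloor> - real (Suc k) * snd q) / real (Suc k) = ?h k (snd q) - snd q"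
      by (simp add: diff_divide_distrib del: of_nat_Suc)
    ultimately show "\<bar>?h k (snd q) - snd q\<bar> \<le> 1 / real (Suc k)" by (simp only:)
  qed
  moreover have "isCont (g (fst q)) (snd q)"
    using cont[of "fst q"] q by (simp add: space_pair_measure continuous_on_eq_continuous_at mem_Times_iff)
  ultimately show "(\<lambda>k. g (fst q) (?h k (snd q))) \<longlonglongrightarrow> g (fst q) (snd q)"
    by (rule isCont_tendsto_compose[rotated])
qed

lemma borel_measurable_superposition:
  fixes g :: "'a \<Rightarrow> real \<Rightarrow> real"
  assumes meas: "\<And>t. (\<lambda>x. g x t) \<in> borel_measurable M" and cont: "\<And>x. x \<in> space M \<Longrightarrow> continuous_on UNIV (g x)"
    and u: "u \<in> borel_measurable M"
  shows "(\<lambda>x. g x (u x)) \<in> borel_measurable M"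
proof -
  have "(\<lambda>x. (x, u x)) \<in> M \<rightarrow>\<^sub>M M \<Otimes>\<^sub>M borel" using u by measurable
  from measurable_compose[OF this borel_measurable_caratheodory[OF meas cont]] show ?thesis by simp
qed

text \<open>The primitive is a parameter integral of a jointly measurable function; the two cases
  are the two orientations of the interval.\<close>

lemma borel_measurable_prim:
  fixes g :: "'a \<Rightarrow> real \<Rightarrow> real"
  assumes meas: "\<And>t. (\<lambda>x. g x t) \<in> borel_measurable M" and cont: "\<And>x. x \<in> space M \<Longrightarrow> continuous_on UNIV (g x)"
  shows "(\<lambda>x. prim (g x) t) \<in> borel_measurable M"
proof -
  have [measurable]: "(\<lambda>q. g (fst q) (snd q)) \<in> borel_measurable (M \<Otimes>\<^sub>M lborel)"
    using borel_measurable_caratheodory[OF meas cont] by (simp cong: measurable_cong_sets sets_pair_measure_cong)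
  have *: "(\<lambda>x. LINT y|lborel. indicator S y * g x y) \<in> borel_measurable M" if "S \<in> sets borel" for S
  proof (rule lborel.borel_measurable_lebesgue_integral)
    have [measurable]: "(\<lambda>q. indicator S (snd q) :: real) \<in> borel_measurable (M \<Otimes>\<^sub>M lborel)"
      using that by measurable
    show "(\<lambda>(x, y). indicator S y * g x y) \<in> borel_measurable (M \<Otimes>\<^sub>M lborel)"
      by (simp add: case_prod_beta)
  qed
  show ?thesis
    unfolding prim_def interval_lebesgue_integral_def set_lebesgue_integral_def real_scaleR_def
    by (cases "0 \<le> t") (auto intro!: * borel_measurable_uminus)
qed

lemma powr_add_le:
  fixes a b r :: real
  assumes "0 \<le> a" "0 \<le> b" "0 \<le> r"
  shows "(a + b) powr r \<le> 2 powr r * (a powr r + b powr r)"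
proof -
  have "(a + b) powr r \<le> (2 * max a b) powr r" using assms by (intro powr_mono2) auto
  also have "\<dots> = 2 powr r * max a b powr r" by (simp add: powr_mult)
  also have "max a b powr r \<le> a powr r + b powr r" by (auto simp: max_def)
  finally show ?thesis by (simp add: mult_left_mono)
qed

locale nonlocal_potential = nonlocal_space s b \<Omega> K
  for s b and \<Omega> :: "(real^'n) set" and K :: "real^'n \<Rightarrow> real" +
  fixes f :: "real^'n \<Rightarrow> real \<Rightarrow> real" and q C F0 :: real
  assumes cara: "caratheodory \<Omega> f" and q: "1 \<le> q" "q < 2 * real CARD('n) / (real CARD('n) - 2 * s)"
    and C_nonneg: "0 \<le> C" and growth_f: "\<And>x t. x \<in> \<Omega> \<Longrightarrow> \<bar>f x t\<bar> \<le> C * (1 + \<bar>t\<bar> powr (q - 1))"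
    and F0_nonneg: "0 \<le> F0" and bound_F: "\<And>x t. x \<in> \<Omega> \<Longrightarrow> \<bar>prim (f x) t\<bar> \<le> F0"
begin

lemma q_less: "q < p" using q by (simp add: p_def)

text \<open>Discards the null set of points at which \<open>f x\<close> is not continuous.\<close>

definition g :: "real^'n \<Rightarrow> real \<Rightarrow> real" where
  "g x t = (if x \<in> \<Omega> \<and> continuous_on UNIV (f x) then f x t else 0)"

lemma g_outside: "x \<notin> \<Omega> \<Longrightarrow> g x t = 0" by (simp add: g_def)

lemma f_eq_g: "AE x in lebesgue. x \<in> \<Omega> \<longrightarrow> f x = g x"
proof -
  have "AE x in lebesgue_on \<Omega>. continuous_on UNIV (f x)" using cara by (simp add: caratheodory_def)
  then have "AE x in lebesgue. x \<in> \<Omega> \<longrightarrow> continuous_on UNIV (f x)" using \<Omega>_sets by (simp add: AE_restrict_space_iff)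
  then show ?thesis by eventually_elim (simp add: g_def fun_eq_iff)
qed

lemma g_cont: "continuous_on UNIV (g x)"
  by (cases "x \<in> \<Omega> \<and> continuous_on UNIV (f x)") (auto simp: g_def[abs_def])

lemma g_measurable: "(\<lambda>x. g x t) \<in> borel_measurable lebesgue"
proof (rule borel_measurable_AE)
  have "(\<lambda>x. f x t) \<in> borel_measurable (lebesgue_on \<Omega>)" using cara by (simp add: caratheodory_def)
  then show "(\<lambda>x. if x \<in> \<Omega> then f x t else 0) \<in> borel_measurable lebesgue"
    using \<Omega>_sets by (simp add: borel_measurable_if)
  show "AE x in lebesgue. (if x \<in> \<Omega> then f x t else 0) = g x t"
    using f_eq_g by eventually_elim (simp add: g_outside)
qed

lemma g_growth: "\<bar>g x t\<bar> \<le> C * (1 + \<bar>t\<bar> powr (q - 1))"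
  using growth_f[of x t] C_nonneg by (auto simp: g_def)

definition F :: "real^'n \<Rightarrow> real \<Rightarrow> real" where "F x t = prim (g x) t"

lemma F_deriv: "(F x has_real_derivative g x t) (at t)"
  unfolding F_def[abs_def] by (rule prim_has_derivative_UNIV[OF g_cont])

lemma F_cont: "continuous_on UNIV (F x)"
  by (intro continuous_at_imp_continuous_on ballI DERIV_isCont[OF F_deriv])

lemma F_measurable: "(\<lambda>x. F x t) \<in> borel_measurable lebesgue"
  unfolding F_def by (rule borel_measurable_prim[of g lebesgue, OF g_measurable g_cont])

lemma F_bound: "\<bar>F x t\<bar> \<le> F0 * indicator \<Omega> x"
proof (cases "x \<in> \<Omega> \<and> continuous_on UNIV (f x)")
  case True
  then have "g x = f x" by (simp add: g_def[abs_def])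
  then show ?thesis using True bound_F by (simp add: F_def)
next
  case False
  then have "g x = (\<lambda>_. 0)" by (auto simp: g_def[abs_def])
  then show ?thesis using F0_nonneg by (simp add: F_def)
qed

lemma g_super: "u \<in> borel_measurable lebesgue \<Longrightarrow> (\<lambda>x. g x (u x)) \<in> borel_measurable lebesgue"
  by (rule borel_measurable_superposition[of g lebesgue, OF g_measurable g_cont])

lemma F_super: "u \<in> borel_measurable lebesgue \<Longrightarrow> (\<lambda>x. F x (u x)) \<in> borel_measurable lebesgue"
  by (rule borel_measurable_superposition[of F lebesgue, OF F_measurable F_cont])

section \<open>Weak continuity and differentiability of the potential\<close>

abbreviation "J \<equiv> potential \<Omega> f"
definition "DJ u v = (LINT x|lebesgue. g x (u x) * v x)"

lemma J_eq: assumes u: "u \<in> V" shows "J u = (LINT x|lebesgue. F x (u x))"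
  unfolding potential_def set_lebesgue_integral_def
proof (rule integral_cong_AE)
  show ae: "AE x in lebesgue. indicator \<Omega> x *\<^sub>R prim (f x) (u x) = F x (u x)"
    using f_eq_g
  proof eventually_elim
    case (elim x)
    then show ?case using F_bound[of x "u x"] by (cases "x \<in> \<Omega>") (auto simp: F_def)
  qed
  show F: "(\<lambda>x. F x (u x)) \<in> borel_measurable lebesgue" using u by (intro F_super V_measurable)
  show "(\<lambda>x. indicator \<Omega> x *\<^sub>R prim (f x) (u x)) \<in> borel_measurable lebesgue"
    by (rule borel_measurable_AE[OF F]) (use ae in \<open>auto elim: eventually_mono\<close>)
qed

lemma DJ_eq: assumes u: "u \<in> V" and v: "v \<in> V" shows "(LINT x:\<Omega>|lebesgue. f x (u x) * v x) = DJ u v"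
  unfolding DJ_def set_lebesgue_integral_def
proof (rule integral_cong_AE)
  show ae: "AE x in lebesgue. indicator \<Omega> x *\<^sub>R (f x (u x) * v x) = g x (u x) * v x"
    using f_eq_g by eventually_elim (simp add: g_outside indicator_def)
  have [measurable]: "(\<lambda>x. g x (u x)) \<in> borel_measurable lebesgue" "v \<in> borel_measurable lebesgue"
    using u v by (auto intro: g_super V_measurable)
  show m: "(\<lambda>x. g x (u x) * v x) \<in> borel_measurable lebesgue" by measurable
  show "(\<lambda>x. indicator \<Omega> x *\<^sub>R (f x (u x) * v x)) \<in> borel_measurable lebesgue"
    by (rule borel_measurable_AE[OF m]) (use ae in \<open>auto elim: eventually_mono\<close>)
qed

lemma F_integrable: "u \<in> V \<Longrightarrow> integrable lebesgue (\<lambda>x. F x (u x))"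
  by (rule Bochner_Integration.integrable_bound[where f = "\<lambda>x. F0 * indicator \<Omega> x"])
     (use F_bound F0_nonneg integrable_indicator_\<Omega> in \<open>auto intro: F_super V_measurable simp: abs_mult\<close>)

lemma J_bound: assumes "u \<in> V" shows "\<bar>J u\<bar> \<le> F0 * \<Omega>_vol"
proof -
  have "\<bar>J u\<bar> \<le> (LINT x|lebesgue. \<bar>F x (u x)\<bar>)" unfolding J_eq[OF assms] by (rule integral_abs_bound)
  also have "\<dots> \<le> (LINT x|lebesgue. F0 * indicator \<Omega> x)"
    using F_integrable[OF assms] integrable_indicator_\<Omega> F_bound by (intro integral_mono) auto
  also have "\<dots> = F0 * \<Omega>_vol" using integral_indicator_\<Omega> by simp
  finally show ?thesis .
qed

lemma J_conv:
  assumes X: "\<And>k. X k \<in> V" and u: "u \<in> V" and lim: "conv X u"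
  shows "(\<lambda>k. J (X k)) \<longlonglongrightarrow> J u"
  unfolding J_eq[OF X] J_eq[OF u]
proof (rule integral_dominated_convergence[where w = "\<lambda>x. F0 * indicator \<Omega> x"])
  show "integrable lebesgue (\<lambda>x. F0 * indicator \<Omega> x)" using integrable_indicator_\<Omega> by simp
  show "AE x in lebesgue. (\<lambda>k. F x (X k x)) \<longlonglongrightarrow> F x (u x)"
    using lim unfolding conv_def
    by eventually_elim (rule isCont_tendsto_compose[OF DERIV_isCont[OF F_deriv]])
  show "(\<lambda>x. F x (X k x)) \<in> borel_measurable lebesgue" for k by (rule F_super[OF V_measurable[OF X]])
  show "(\<lambda>x. F x (u x)) \<in> borel_measurable lebesgue" by (rule F_super[OF V_measurable[OF u]])
qed (use F_bound in auto)

text \<open>Replacing both arguments by the larger modulus \<open>m\<close> leaves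
  \<open>m + m powr q\<close>, which the critical power dominates. The bound is integrable by the
  Sobolev inequality, so no conjugate exponents are needed.\<close>

lemma growth:
  "\<bar>g x a * c\<bar> \<le> 2 * C * (indicator \<Omega> x + \<bar>a\<bar> powr p + \<bar>c\<bar> powr p)"
proof (cases "x \<in> \<Omega>")
  case True
  define m where "m = max \<bar>a\<bar> \<bar>c\<bar>"
  have m: "0 \<le> m" "\<bar>a\<bar> \<le> m" "\<bar>c\<bar> \<le> m" by (auto simp: m_def)
  have mp: "m powr p \<le> \<bar>a\<bar> powr p + \<bar>c\<bar> powr p" by (auto simp: m_def max_def)
  have "\<bar>g x a * c\<bar> \<le> C * (1 + \<bar>a\<bar> powr (q - 1)) * \<bar>c\<bar>"
    unfolding abs_mult by (intro mult_right_mono g_growth) simp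
  also have "\<dots> \<le> C * (1 + m powr (q - 1)) * m"
    using m q C_nonneg by (intro mult_mono mult_left_mono add_left_mono powr_mono2) auto
  also have "\<dots> = C * (m + m powr q)"
  proof (cases "m = 0")
    case False
    then have "m powr (q - 1) * m = m powr q" using m powr_add[of m "q - 1" 1] by simp
    then show ?thesis by (simp add: algebra_simps)
  qed simp
  also have "\<dots> \<le> C * (2 * (1 + m powr p))"
    using m q q_less p_gt_2 powr_le_1_add_powr[of m 1 p] powr_le_1_add_powr[of m q p] C_nonneg
    by (intro mult_left_mono) auto
  also have "\<dots> \<le> C * (2 * (1 + (\<bar>a\<bar> powr p + \<bar>c\<bar> powr p)))"
    using mp C_nonneg by (intro mult_left_mono) auto
  finally show ?thesis using True by (simp add: algebra_simps)
qed (use C_nonneg in \<open>simp add: g_outside\<close>)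

lemma DJ_integrable:
  assumes u: "u \<in> V" and v: "v \<in> V"
  shows "integrable lebesgue (\<lambda>x. g x (u x) * v x)"
proof (rule Bochner_Integration.integrable_bound)
  show "integrable lebesgue (\<lambda>x. 2 * C * (indicator \<Omega> x + \<bar>u x\<bar> powr p + \<bar>v x\<bar> powr p))"
    using integrable_indicator_\<Omega> sobolev_V u v by simp
  show "(\<lambda>x. g x (u x) * v x) \<in> borel_measurable lebesgue"
    using u v by (intro borel_measurable_times g_super V_measurable)
  show "AE x in lebesgue. norm (g x (u x) * v x) \<le> norm (2 * C * (indicator \<Omega> x + \<bar>u x\<bar> powr p + \<bar>v x\<bar> powr p))"
    using growth C_nonneg by (auto intro!: AE_I2 order_trans[OF growth])
qed

lemma DJ_add: "u \<in> V \<Longrightarrow> v \<in> V \<Longrightarrow> w \<in> V \<Longrightarrow> DJ u (v + w) = DJ u v + DJ u w"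
  unfolding DJ_def by (simp add: distrib_left DJ_integrable)

lemma DJ_scale: "DJ u (c *\<^sub>R v) = c * DJ u v"
  unfolding DJ_def by (simp add: mult.left_commute[of _ c])

text \<open>\<open>growth\<close> is not homogeneous in the test function, so it is used on the unit
  ball and extended by \<open>homogeneous_bound\<close>.\<close>

lemma DJ_unit_bound:
  assumes u: "u \<in> V" and v: "v \<in> V" "N v \<le> 1"
  shows "\<bar>DJ u v\<bar> \<le> 2 * C * (\<Omega>_vol + Cs * N u powr p + Cs)"
proof -
  have "\<bar>DJ u v\<bar> \<le> (LINT x|lebesgue. \<bar>g x (u x) * v x\<bar>)" unfolding DJ_def by (rule integral_abs_bound)
  also have "\<dots> \<le> (LINT x|lebesgue. 2 * C * (indicator \<Omega> x + \<bar>u x\<bar> powr p + \<bar>v x\<bar> powr p))"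
    using DJ_integrable[OF u v(1)] integrable_indicator_\<Omega> sobolev_V u v growth by (intro integral_mono) auto
  also have "\<dots> = 2 * C * (\<Omega>_vol + Lp u + Lp v)"
    using integrable_indicator_\<Omega> integral_indicator_\<Omega> sobolev_V u v by simp
  also have "\<dots> \<le> 2 * C * (\<Omega>_vol + Cs * N u powr p + Cs * 1)"
    using sobolev_V(2)[OF u] sobolev_V(2)[OF v(1)] Cs_mono[OF v(2)] C_nonneg by (intro mult_left_mono) auto
  finally show ?thesis by simp
qed

text \<open>Dominated convergence along an arbitrary null sequence of increments. The sequence is
  bounded by some \<open>A\<close>, which provides a common dominating function
  \<open>w\<close>.\<close>

lemma J_deriv:
  assumes u: "u \<in> V" and v: "v \<in> V"
  shows "((\<lambda>t. J (u + t *\<^sub>R v)) has_real_derivative DJ u v) (at 0)"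
  unfolding DERIV_def tendsto_at_iff_sequentially
proof (intro allI impI)
  fix X :: "nat \<Rightarrow> real" assume X0: "\<forall>i. X i \<in> UNIV - {0}" and X: "X \<longlonglongrightarrow> 0"
  then have X_ne: "X i \<noteq> 0" for i by auto
  obtain A where A: "0 < A" "\<And>i. \<bar>X i\<bar> \<le> A"
    using convergent_imp_Bseq[OF convergentI[OF X]] by (auto simp: Bseq_def)
  define w where "w x = 2 * C * (indicator \<Omega> x + 2 powr p * (\<bar>u x\<bar> powr p + A powr p * \<bar>v x\<bar> powr p) + \<bar>v x\<bar> powr p)" for x
  let ?h = "\<lambda>i x. (F x (u x + X i * v x) - F x (u x)) / X i"
  have Vi: "u + X i *\<^sub>R v \<in> V" for i using u v by (intro V_add V_scale)
  have eq: "(J (u + X i *\<^sub>R v) - J u) / X i = (LINT x|lebesgue. ?h i x)" for i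
  proof -
    have "J (u + X i *\<^sub>R v) - J u = (LINT x|lebesgue. F x (u x + X i * v x) - F x (u x))"
      using F_integrable[OF Vi[of i]] F_integrable[OF u] by (simp add: J_eq[OF Vi] J_eq[OF u])
    then show ?thesis by simp
  qed
  have lim: "(\<lambda>i. LINT x|lebesgue. ?h i x) \<longlonglongrightarrow> (LINT x|lebesgue. g x (u x) * v x)"
  proof (rule integral_dominated_convergence[where w = w])
    show "(\<lambda>x. g x (u x) * v x) \<in> borel_measurable lebesgue"
      using u v by (intro borel_measurable_times g_super V_measurable)
    show "?h i \<in> borel_measurable lebesgue" for i
      using F_super[OF V_measurable[OF Vi[of i]]] F_super[OF V_measurable[OF u]] by simp
    show "integrable lebesgue w"
      unfolding w_def using integrable_indicator_\<Omega> sobolev_V u v by simp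
    show "AE x in lebesgue. (\<lambda>i. ?h i x) \<longlonglongrightarrow> g x (u x) * v x"
    proof (rule AE_I2)
      fix x
      have "((\<lambda>t. F x (u x + t * v x)) has_real_derivative g x (u x + 0 * v x) * v x) (at 0)"
        by (rule DERIV_chain2[OF F_deriv]) (auto intro!: derivative_eq_intros)
      then have "((\<lambda>h. (F x (u x + h * v x) - F x (u x)) / h) \<longlongrightarrow> g x (u x) * v x) (at 0)"
        by (simp add: DERIV_def)
      then show "(\<lambda>i. ?h i x) \<longlonglongrightarrow> g x (u x) * v x"
        using X0 X by (auto simp: tendsto_at_iff_sequentially o_def)
    qed
    show "AE x in lebesgue. norm (?h i x) \<le> w x" for i
    proof (rule AE_I2)
      fix x
      \<comment> \<open>The intermediate point depends on \<open>x\<close> in an uncontrolled way,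
        but it is used only for the pointwise bound.\<close>
      have "\<exists>z. \<bar>z\<bar> \<le> \<bar>u x\<bar> + A * \<bar>v x\<bar> \<and> F x (u x + X i * v x) - F x (u x) = X i * v x * g x z"
      proof (cases "X i * v x = 0")
        case True then show ?thesis using A(1) by (intro exI[of _ "u x"]) auto
      next
        case False
        define a c where "a = min (u x) (u x + X i * v x)" and "c = max (u x) (u x + X i * v x)"
        have "min t (t + y) < max t (t + y)" if "y \<noteq> 0" for t y :: real using that by (auto simp: min_def max_def)
        from this[OF False, of "u x"] have "a < c" by (simp only: a_def c_def)
        then obtain z where z: "a < z" "z < c" "F x c - F x a = (c - a) * g x z"
          using MVT2[of a c "F x" "g x"] F_deriv by blast
        have "F x (u x + X i * v x) - F x (u x) = X i * v x * g x z"
          using z(3) by (auto simp: a_def c_def min_def max_def algebra_simps split: if_splits)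
        moreover have "\<bar>z\<bar> \<le> \<bar>u x\<bar> + \<bar>X i * v x\<bar>" using z(1,2) by (auto simp: a_def c_def)
        moreover have "\<bar>X i * v x\<bar> \<le> A * \<bar>v x\<bar>" unfolding abs_mult using A by (intro mult_right_mono) auto
        ultimately show ?thesis by (intro exI[of _ z]) auto
      qed
      then obtain z where z: "\<bar>z\<bar> \<le> \<bar>u x\<bar> + A * \<bar>v x\<bar>" "F x (u x + X i * v x) - F x (u x) = X i * v x * g x z" by blast
      have "?h i x = g x z * v x" using z(2) X_ne[of i] by simp
      then have "norm (?h i x) \<le> 2 * C * (indicator \<Omega> x + \<bar>z\<bar> powr p + \<bar>v x\<bar> powr p)" using growth[of x z "v x"] by simp
      also have "\<bar>z\<bar> powr p \<le> 2 powr p * (\<bar>u x\<bar> powr p + A powr p * \<bar>v x\<bar> powr p)"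
      proof -
        have "\<bar>z\<bar> powr p \<le> (\<bar>u x\<bar> + A * \<bar>v x\<bar>) powr p" using z p_gt_2 by (intro powr_mono2) auto
        also have "\<dots> \<le> 2 powr p * (\<bar>u x\<bar> powr p + (A * \<bar>v x\<bar>) powr p)"
          using A p_gt_2 by (intro powr_add_le) auto
        finally show ?thesis by (simp add: powr_mult)
      qed
      finally show "norm (?h i x) \<le> w x" using C_nonneg by (simp add: w_def mult_left_mono)
    qed
  qed
  have "(\<lambda>i. (J (u + X i *\<^sub>R v) - J u) / X i) \<longlonglongrightarrow> DJ u v" unfolding eq DJ_def by (rule lim)
  then show "((\<lambda>h. (J (u + (0 + h) *\<^sub>R v) - J (u + 0 *\<^sub>R v)) / h) \<circ> X) \<longlonglongrightarrow> DJ u v"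
    by (simp add: o_def)
qed

text \<open>
  Splits the integrand of the difference of two derivatives into a part that is small because the
  test function \<open>c\<close> is bounded in mean square, a bounded part, and a part carried by large values, which
  is small because \<open>q < p\<close>.
\<close>

lemma split_bound:
  fixes a c y z T e :: real
  assumes a: "\<bar>a\<bar> \<le> C * (2 + \<bar>y\<bar> powr (q - 1) + \<bar>z\<bar> powr (q - 1))" and T: "1 \<le> T" and e: "0 < e"
  shows "\<bar>a * c\<bar> \<le> e * c\<^sup>2 + (min \<bar>a\<bar> (4 * C * T powr (q - 1)))\<^sup>2 / e
    + 4 * C * T powr (q - p) * (\<bar>y\<bar> powr p + \<bar>z\<bar> powr p + \<bar>c\<bar> powr p)"
proof -
  let ?B = "4 * C * T powr (q - 1)"
  let ?rest = "4 * C * T powr (q - p) * (\<bar>y\<bar> powr p + \<bar>z\<bar> powr p + \<bar>c\<bar> powr p)"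
  have rest: "0 \<le> ?rest" using C_nonneg by simp
  have a_le: "\<bar>a\<bar> \<le> 4 * C * t powr (q - 1)" if "1 \<le> t" "\<bar>y\<bar> \<le> t" "\<bar>z\<bar> \<le> t" for t
  proof -
    have "\<bar>y\<bar> powr (q - 1) \<le> t powr (q - 1)" "\<bar>z\<bar> powr (q - 1) \<le> t powr (q - 1)" "1 \<le> t powr (q - 1)"
      using that q by (auto intro: powr_mono2 ge_one_powr_ge_zero)
    then have "C * (2 + \<bar>y\<bar> powr (q - 1) + \<bar>z\<bar> powr (q - 1)) \<le> C * (4 * t powr (q - 1))"
      using C_nonneg by (intro mult_left_mono) auto
    then show ?thesis using a by simp
  qed
  show ?thesis
  proof (cases "\<bar>y\<bar> \<le> T \<and> \<bar>z\<bar> \<le> T")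
    case True
    then have "min \<bar>a\<bar> ?B = \<bar>a\<bar>" using a_le[of T] T by simp
    moreover have "\<bar>a * c\<bar> \<le> e * c\<^sup>2 + \<bar>a\<bar>\<^sup>2 / e"
    proof -
      have "0 \<le> (e * \<bar>c\<bar> - \<bar>a\<bar>)\<^sup>2" by simp
      then have "2 * (e * (\<bar>a\<bar> * \<bar>c\<bar>)) \<le> e * (e * c\<^sup>2) + \<bar>a\<bar>\<^sup>2"
        by (simp add: power2_diff power_mult_distrib power2_eq_square algebra_simps)
      moreover have "0 \<le> e * (\<bar>a\<bar> * \<bar>c\<bar>)" using e by simp
      ultimately have "e * (\<bar>a\<bar> * \<bar>c\<bar>) \<le> e * (e * c\<^sup>2) + \<bar>a\<bar>\<^sup>2" by linarith
      also have "\<dots> = e * (e * c\<^sup>2 + \<bar>a\<bar>\<^sup>2 / e)" using e by (simp add: distrib_left)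
      finally show ?thesis using e by (simp only: mult_le_cancel_left_pos abs_mult)
    qed
    ultimately show ?thesis using rest by simp
  next
    case False
    \<comment> \<open>Here \<open>m\<close> exceeds \<open>T\<close>, and as \<open>q - p\<close> is
      negative, \<open>m powr q\<close> is at most \<open>T powr (q - p)\<close> times
      \<open>m powr p\<close>.\<close>
    define m where "m = max (max \<bar>y\<bar> \<bar>z\<bar>) \<bar>c\<bar>"
    have m: "T < m" "1 \<le> m" "\<bar>y\<bar> \<le> m" "\<bar>z\<bar> \<le> m" "\<bar>c\<bar> \<le> m" using False T by (auto simp: m_def)
    have "\<bar>a * c\<bar> \<le> 4 * C * m powr (q - 1) * m"
      unfolding abs_mult using a_le[of m] m by (intro mult_mono) auto
    also have "\<dots> = 4 * C * m powr q" using m powr_add[of m "q - 1" 1] by simp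
    also have "m powr q = m powr (q - p) * m powr p" by (simp flip: powr_add)
    also have "4 * C * (m powr (q - p) * m powr p) \<le> 4 * C * (T powr (q - p) * (\<bar>y\<bar> powr p + \<bar>z\<bar> powr p + \<bar>c\<bar> powr p))"
    proof (intro mult_left_mono mult_mono)
      show "m powr (q - p) \<le> T powr (q - p)" using m T q_less by (intro powr_mono2') auto
      show "m powr p \<le> \<bar>y\<bar> powr p + \<bar>z\<bar> powr p + \<bar>c\<bar> powr p" by (auto simp: m_def max_def)
    qed (use C_nonneg in auto)
    finally have "\<bar>a * c\<bar> \<le> ?rest" by (simp add: mult.assoc)
    moreover have "0 \<le> e * c\<^sup>2" "0 \<le> (min \<bar>a\<bar> ?B)\<^sup>2 / e" using e by auto
    ultimately show ?thesis by linarith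
  qed
qed

text \<open>The three parts of \<open>split_bound\<close> get \<open>d / 3\<close> each, and the
  order of choice matters. The level \<open>T\<close> makes the part of large values small uniformly
  in \<open>k\<close> and \<open>w\<close> through the Sobolev bound \<open>S\<close>; then
  \<open>e\<close> makes the mean square term small; only then is \<open>k\<close> taken large, for
  the truncated part.\<close>

lemma DJ_conv_unit:
  assumes X: "\<And>k. X k \<in> V" "\<And>k. N (X k) \<le> R" and u: "u \<in> V" and lim: "conv X u" and d: "d > 0"
  shows "\<forall>\<^sub>F k in sequentially. \<forall>w\<in>V. N w \<le> 1 \<longrightarrow> \<bar>DJ (X k) w - DJ u w\<bar> \<le> d"
proof -
  have R: "0 \<le> R" using N_nonneg[of "X 0"] X(2)[of 0] by simp
  have Nu: "N u \<le> R" by (rule V_closed(2)[of X, OF _ _ V_measurable[OF u] lim]) (rule X)+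
  define S where "S = Cs * R powr p + Cs * R powr p + Cs"
  have Sp: "Lp v \<le> Cs * r powr p" if "v \<in> V" "N v \<le> r" for v r
    using sobolev_V(2)[OF that(1)] Cs_mono[OF that(2)] by simp
  have "((\<lambda>T. 4 * C * S * T powr (q - p)) \<longlongrightarrow> 4 * C * S * 0) at_top"
    using q_less by (intro tendsto_mult_left tendsto_neg_powr filterlim_ident) auto
  then have "((\<lambda>T. 4 * C * S * T powr (q - p)) \<longlongrightarrow> 0) at_top" by simp
  then have "\<forall>\<^sub>F T in at_top. 4 * C * S * T powr (q - p) < d / 3"
    by (rule order_tendstoD) (use d in simp)
  then have "\<forall>\<^sub>F T in at_top. 4 * C * S * T powr (q - p) < d / 3 \<and> 1 \<le> T"
    using eventually_ge_at_top[of 1] by eventually_elim simp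
  then obtain T where T: "4 * C * S * T powr (q - p) < d / 3" "1 \<le> T"
    using eventually_happens'[OF trivial_limit_at_top_linorder] by blast
  define B where "B = 4 * C * T powr (q - 1)"
  define A where "A = \<Omega>_vol + Cs + 1"
  define e where "e = d / 3 / A"
  have A: "A > 0" using \<Omega>_vol_nonneg Cs_nonneg by (simp add: A_def)
  have e: "e > 0" using A d by (simp add: e_def)
  have eA: "e * A = d / 3" using A by (simp add: e_def)
  define a where "a k x = g x (X k x) - g x (u x)" for k x
  have a_m [measurable]: "a k \<in> borel_measurable lebesgue" for k
    unfolding a_def using g_super[OF V_measurable[OF X(1)]] g_super[OF V_measurable[OF u]] by simp
  have a_le: "\<bar>a k x\<bar> \<le> C * (2 + \<bar>X k x\<bar> powr (q - 1) + \<bar>u x\<bar> powr (q - 1))" for k x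
    using g_growth[of x "X k x"] g_growth[of x "u x"] by (simp add: a_def algebra_simps)
  have B: "0 \<le> B" using C_nonneg by (simp add: B_def)
  \<comment> \<open>The differences \<open>a k\<close> need not be square integrable; truncated at
    \<open>B\<close>, their squares are dominated by a constant on \<Omega>.\<close>
  have min_le: "(min \<bar>a k x\<bar> B)\<^sup>2 \<le> B\<^sup>2 * indicator \<Omega> x" for k x
  proof (cases "x \<in> \<Omega>")
    case True
    have "(min \<bar>a k x\<bar> B)\<^sup>2 \<le> B\<^sup>2" using B by (intro power_mono) auto
    then show ?thesis using True by simp
  next
    case False
    then have "a k x = 0" by (simp add: a_def g_outside)
    then show ?thesis using B by simp
  qed
  have min_int: "integrable lebesgue (\<lambda>x. (min \<bar>a k x\<bar> B)\<^sup>2)" for k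
    by (rule Bochner_Integration.integrable_bound[where f = "\<lambda>x. B\<^sup>2 * indicator \<Omega> x"])
       (use min_le integrable_indicator_\<Omega> in auto)
  have "(\<lambda>k. LINT x|lebesgue. (min \<bar>a k x\<bar> B)\<^sup>2) \<longlonglongrightarrow> (LINT x|(lebesgue :: (real^'n) measure). (0 :: real))"
  proof (rule integral_dominated_convergence[where w = "\<lambda>x. B\<^sup>2 * indicator \<Omega> x"])
    show "integrable lebesgue (\<lambda>x. B\<^sup>2 * indicator \<Omega> x)" using integrable_indicator_\<Omega> by simp
    show "AE x in lebesgue. (\<lambda>k. (min \<bar>a k x\<bar> B)\<^sup>2) \<longlonglongrightarrow> 0"
      using lim unfolding conv_def
    proof eventually_elim
      case (elim x)
      have "isCont (g x) (u x)" using g_cont[of x] by (simp add: continuous_on_eq_continuous_at)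
      from isCont_tendsto_compose[OF this elim]
      have "(\<lambda>k. a k x) \<longlonglongrightarrow> g x (u x) - g x (u x)" unfolding a_def by (intro tendsto_intros)
      then have "(\<lambda>k. (min \<bar>a k x\<bar> B)\<^sup>2) \<longlonglongrightarrow> (min \<bar>g x (u x) - g x (u x)\<bar> B)\<^sup>2"
        by (intro tendsto_intros)
      then show ?case using B by simp
    qed
    show "AE x in lebesgue. norm ((min \<bar>a k x\<bar> B)\<^sup>2) \<le> B\<^sup>2 * indicator \<Omega> x" for k
      using min_le by simp
  qed simp_all
  then have "\<forall>\<^sub>F k in sequentially. (LINT x|lebesgue. (min \<bar>a k x\<bar> B)\<^sup>2) < e * (d / 3)"
    by (rule order_tendstoD) (use e d in simp)
  then show ?thesis
  proof eventually_elim
    case (elim k)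
    show ?case
    proof (intro ballI impI)
      fix w assume w: "w \<in> V" "N w \<le> 1"
      have w2: "(LINT x|lebesgue. (w x)\<^sup>2) \<le> A"
        using V_square_le[OF w] by (simp add: A_def)
      have ig: "integrable lebesgue (\<lambda>x. \<bar>X k x\<bar> powr p)" "integrable lebesgue (\<lambda>x. \<bar>u x\<bar> powr p)" "integrable lebesgue (\<lambda>x. \<bar>w x\<bar> powr p)"
        using sobolev_V(1) X(1) u w(1) by auto
      have i1: "integrable lebesgue (\<lambda>x. e * (w x)\<^sup>2 + (min \<bar>a k x\<bar> B)\<^sup>2 / e
        + 4 * C * T powr (q - p) * (\<bar>X k x\<bar> powr p + \<bar>u x\<bar> powr p + \<bar>w x\<bar> powr p))"
        using ig min_int V_square[OF w(1)] by simp
      have i2: "integrable lebesgue (\<lambda>x. a k x * w x)"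
        using DJ_integrable[OF X(1)[of k] w(1)] DJ_integrable[OF u w(1)] by (simp add: a_def left_diff_distrib)
      have "DJ (X k) w - DJ u w = (LINT x|lebesgue. a k x * w x)"
        using DJ_integrable[OF X(1)[of k] w(1)] DJ_integrable[OF u w(1)] by (simp add: DJ_def a_def left_diff_distrib)
      then have "\<bar>DJ (X k) w - DJ u w\<bar> \<le> (LINT x|lebesgue. \<bar>a k x * w x\<bar>)"
        by (simp only: integral_abs_bound)
      also have "\<dots> \<le> (LINT x|lebesgue. e * (w x)\<^sup>2 + (min \<bar>a k x\<bar> B)\<^sup>2 / e
        + 4 * C * T powr (q - p) * (\<bar>X k x\<bar> powr p + \<bar>u x\<bar> powr p + \<bar>w x\<bar> powr p))"
        by (rule integral_mono[OF integrable_abs[OF i2] i1]) (unfold B_def, rule split_bound[OF a_le T(2) e])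
      also have "\<dots> = e * (LINT x|lebesgue. (w x)\<^sup>2) + (LINT x|lebesgue. (min \<bar>a k x\<bar> B)\<^sup>2) / e
        + 4 * C * T powr (q - p) * (Lp (X k) + Lp u + Lp w)"
        using ig min_int V_square[OF w(1)] by simp
      also have "\<dots> \<le> e * A + e * (d / 3) / e + 4 * C * T powr (q - p) * S"
      proof (intro add_mono mult_left_mono divide_right_mono)
        show "Lp (X k) + Lp u + Lp w \<le> S"
          using Sp[OF X(1,2)[of k]] Sp[OF u Nu] Sp[OF w] by (simp add: S_def)
      qed (use w2 elim e C_nonneg in auto)
      also have "\<dots> \<le> d"
      proof -
        have "4 * C * T powr (q - p) * S = 4 * C * S * T powr (q - p)" by simp
        moreover have "e * (d / 3) / e = d / 3" using e by simp
        ultimately show ?thesis using T(1) eA by linarith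
      qed
      finally show "\<bar>DJ (X k) w - DJ u w\<bar> \<le> d" .
    qed
  qed
qed

text \<open>By the Sobolev inequality the seminorm is a norm on classes modulo null sets.\<close>

lemma AE_eq_of_N_zero:
  assumes u: "u \<in> V" and v: "v \<in> V" and uv: "N (u - v) = 0"
  shows "AE x in lebesgue. u x = v x"
proof -
  have w: "u - v \<in> V" using u v by (rule V_diff)
  have "(LINT x|lebesgue. \<bar>(u - v) x\<bar> powr p) \<le> 0" using sobolev_V(2)[OF w] uv p_gt_2 by simp
  then have "(LINT x|lebesgue. \<bar>(u - v) x\<bar> powr p) = 0" by (intro antisym integral_nonneg_AE) auto
  then have "AE x in lebesgue. \<bar>(u - v) x\<bar> powr p = 0"
    using integral_nonneg_eq_0_iff_AE[OF sobolev_V(1)[OF w]] by simp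
  then show ?thesis by eventually_elim simp
qed

lemma conv_null:
  assumes "conv X u" "u \<in> V" "v \<in> V" "N (u - v) = 0" shows "conv X v"
  using assms(1) AE_eq_of_N_zero[OF assms(2-4)] unfolding conv_def by eventually_elim simp

sublocale semi_hilbert V B N
proof -
  \<comment> \<open>The triangle inequality is needed first: it shows that Cauchy sequences are
    bounded, as \<open>V_complete\<close> requires.\<close>
  interpret semi_inner_space V B N
    by unfold_locales (auto intro: subspace_V B_sym B_add B_scale B_nonneg N_eq)
  show "semi_hilbert V B N"
  proof
    fix X :: "nat \<Rightarrow> real^'n \<Rightarrow> real"
    assume X: "\<And>k. X k \<in> V" and c: "\<And>e. e > 0 \<Longrightarrow> \<exists>n0. \<forall>m\<ge>n0. \<forall>n\<ge>n0. N (X m - X n) < e"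
    obtain R where R: "\<forall>k. N (X k) \<le> R" using Cauchy_bounded[of X, OF X c] by blast
    show "\<exists>u\<in>V. (\<lambda>k. N (X k - u)) \<longlonglongrightarrow> 0" by (rule V_complete[OF X c]) (use R in auto)
  qed
qed

lemma DJ_bound: assumes u: "u \<in> V" shows "\<exists>c. \<forall>v\<in>V. \<bar>DJ u v\<bar> \<le> c * N v"
proof (intro exI ballI)
  fix v assume "v \<in> V"
  then show "\<bar>DJ u v\<bar> \<le> (2 * C * (\<Omega>_vol + Cs * N u powr p + Cs)) * N v"
    by (intro homogeneous_bound DJ_scale DJ_unit_bound u)
qed

lemma DJ_conv:
  assumes X: "\<And>k. X k \<in> V" and u: "u \<in> V" and lim: "conv X u" and R: "\<And>k. N (X k) \<le> R" and d: "d > 0"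
  shows "\<forall>\<^sub>F k in sequentially. \<forall>w\<in>V. \<bar>DJ (X k) w - DJ u w\<bar> \<le> d * N w"
proof -
  have "\<forall>\<^sub>F k in sequentially. \<forall>w\<in>V. N w \<le> 1 \<longrightarrow> \<bar>DJ (X k) w - DJ u w\<bar> \<le> d"
    by (rule DJ_conv_unit[OF X R u lim d])
  then show ?thesis
  proof eventually_elim
    case (elim k)
    show ?case
    proof
      fix w assume "w \<in> V"
      then show "\<bar>DJ (X k) w - DJ u w\<bar> \<le> d * N w"
        by (intro homogeneous_bound[where L = "\<lambda>w. DJ (X k) w - DJ u w"])
           (use elim in \<open>auto simp: DJ_scale right_diff_distrib\<close>)
    qed
  qed
qed

end

section \<open>The three solutions\<close>

text \<open>A non-decreasing function whose only zero is 0 has the sign of its argument; the mean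
  value theorem transfers this to the primitive.\<close>

lemma prim_pos:
  assumes h: "continuous_on {a<..<b} h" "mono_on {a<..<b} h" and zero: "\<And>t. t \<in> {a<..<b} \<Longrightarrow> h t = 0 \<longleftrightarrow> t = 0"
    and ab: "a < 0" "0 < b" and t: "t \<in> {a<..<b}" "t \<noteq> 0"
  shows "0 < prim h t"
proof (cases "0 < t")
  case True
  obtain z where z: "0 < z" "z < t" "prim h t - prim h 0 = (t - 0) * h z"
    using MVT2[OF True, of "prim h" h] prim_has_derivative[OF ab h(1)] t ab by auto
  have "h 0 \<le> h z" using z t ab by (intro mono_onD[OF h(2)]) auto
  moreover have "h 0 = 0" "h z \<noteq> 0" using zero[of 0] zero[of z] z t ab by auto
  ultimately have "0 < h z" by simp
  then show ?thesis using z True by simp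
next
  case False
  then have t0: "t < 0" using t by simp
  obtain z where z: "t < z" "z < 0" "prim h 0 - prim h t = (0 - t) * h z"
    using MVT2[OF t0, of "prim h" h] prim_has_derivative[OF ab h(1)] t ab by auto
  have "h z \<le> h 0" using z t ab by (intro mono_onD[OF h(2)]) auto
  moreover have "h 0 = 0" "h z \<noteq> 0" using zero[of 0] zero[of z] z t ab by auto
  ultimately have "h z < 0" by simp
  then have "0 < t * h z" using t0 by (simp add: mult_neg_neg)
  then show ?thesis using z by simp
qed

section \<open>From critical points to weak solutions\<close>

context nonlocal_potential begin

definition three_solutions :: "(real \<Rightarrow> real) \<Rightarrow> (real \<Rightarrow> real) \<Rightarrow> real \<Rightarrow> real \<Rightarrow> real \<Rightarrow> bool" where
  "three_solutions M h \<mu> \<rho> l \<longleftrightarrow> (\<exists>u v w.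
      (\<forall>z\<in>{u, v, w}. weak_solution K \<Omega> f M h \<mu> l z \<and> N z < \<rho>) \<and>
      \<not> (AE x in lebesgue. u x = v x) \<and> \<not> (AE x in lebesgue. u x = w x) \<and> \<not> (AE x in lebesgue. v x = w x))"

lemma J_AE_cong:
  assumes "u \<in> V" "v \<in> V" "AE x in lebesgue. u x = v x" shows "J u = J v"
  unfolding J_eq[OF assms(1)] J_eq[OF assms(2)]
  by (rule integral_cong_AE) (use assms in \<open>auto intro: F_super V_measurable elim: eventually_mono\<close>)

lemma N_AE_cong:
  assumes "u \<in> V" "v \<in> V" "AE x in lebesgue. u x = v x" shows "N u = N v"
proof -
  have "AE r in lebesgue. D u r = D v r"
    using AE_lebesgue_fst[OF assms(3)] AE_lebesgue_snd[OF assms(3)] by eventually_elim (simp add: D_def)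
  then have "(LINT r|lebesgue. (D u r)\<^sup>2) = (LINT r|lebesgue. (D v r)\<^sup>2)"
    using D_measurable[OF V_measurable[OF assms(1)]] D_measurable[OF V_measurable[OF assms(2)]]
    by (intro integral_cong_AE) (auto elim: eventually_mono)
  then have "(N u)\<^sup>2 = (N v)\<^sup>2" by (simp add: nonlocal_space.N_sq[OF nonlocal_space_axioms])
  then show ?thesis using assms(1,2) by (simp add: power2_eq_iff_nonneg)
qed

lemma J_0: "J 0 = 0" by (simp add: J_eq F_def)

lemma J_bdd: "bdd_above (J ` V)" "bdd_below (J ` V)"
proof -
  show "bdd_above (J ` V)" by (rule bdd_aboveI2) (use J_bound abs_le_D1 in blast)
  show "bdd_below (J ` V)"
  proof (rule bdd_belowI2)
    show "- (F0 * \<Omega>_vol) \<le> J u" if "u \<in> V" for u using J_bound[OF that] by linarith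
  qed
qed

lemma J_range: assumes "u \<in> V" shows "alpha K \<Omega> f \<le> J u" "J u \<le> beta K \<Omega> f"
  unfolding alpha_def beta_def using J_bdd assms by (auto intro: cINF_lower cSUP_upper)

text \<open>The closed interval from \<open>l1\<close> to \<open>l2\<close> lies strictly between
  \<alpha> and \<beta>. Therefore all shifted values \<open>J u - l\<close> lie in one compact
  subinterval of the domain of \<open>h\<close>, and a single bound \<open>S\<close>, hence a single
  radius, serves every \<open>l\<close>.\<close>

lemma solutions_on_interval:
  fixes M h :: "real \<Rightarrow> real" and \<mu> l1 l2 m :: real
  defines "\<alpha> \<equiv> alpha K \<Omega> f" and "\<beta> \<equiv> beta K \<Omega> f" and "\<omega> \<equiv> omega K \<Omega> f"
  defines "\<Phi> \<equiv> \<lambda>l u. prim M ((N u)\<^sup>2) / 2 - \<mu> * prim h (J u - l)"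
  assumes m: "m > 0" "\<And>t. t \<ge> 0 \<Longrightarrow> m \<le> M t" "continuous_on {0..} M"
    and h: "continuous_on {- \<omega><..<\<omega>} h" "mono_on {- \<omega><..<\<omega>} h"
      "\<And>t. t \<in> {- \<omega><..<\<omega>} \<Longrightarrow> h t = 0 \<longleftrightarrow> t = 0"
    and \<mu>: "0 \<le> \<mu>" and l12: "\<alpha> < l1" "l1 < l2" "l2 < \<beta>"
    and low: "\<And>l. l \<in> {l1<..<l2} \<Longrightarrow> \<exists>u\<in>V. J u < l \<and> \<Phi> l u < 0"
    and high: "\<And>l. l \<in> {l1<..<l2} \<Longrightarrow> \<exists>u\<in>V. l < J u \<and> \<Phi> l u < 0"
  shows "\<exists>\<rho>>0. \<forall>l\<in>{l1<..<l2}. three_solutions M h \<mu> \<rho> l"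
proof -
  have \<omega>_eq: "\<omega> = \<beta> - \<alpha>" by (simp add: \<omega>_def omega_def \<alpha>_def \<beta>_def)
  have \<omega>: "0 < \<omega>" using l12 by (simp add: \<omega>_eq)
  have h_deriv: "(prim h has_real_derivative h t) (at t)" if "t \<in> {- \<omega><..<\<omega>}" for t
    using \<omega> by (intro prim_has_derivative[OF _ _ h(1) that]) auto
  have h_nonneg: "0 \<le> prim h t" if "t \<in> {- \<omega><..<\<omega>}" for t
    using prim_pos[OF h(1,2,3) _ _ that] \<omega> by (cases "t = 0") (auto intro: less_imp_le)
  \<comment> \<open>Since \<open>l2 < \<beta>\<close> and \<open>\<alpha> < l1\<close>, this
    interval stays strictly inside the domain of \<open>h\<close>.\<close>
  have "continuous_on {\<alpha> - l2..\<beta> - l1} (prim h)"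
    using l12 by (intro continuous_at_imp_continuous_on ballI DERIV_isCont[OF h_deriv]) (auto simp: \<omega>_eq)
  then have "bounded (prim h ` {\<alpha> - l2..\<beta> - l1})"
    by (intro compact_imp_bounded compact_continuous_image) auto
  then obtain S0 where "\<forall>t\<in>{\<alpha> - l2..\<beta> - l1}. \<bar>prim h t\<bar> \<le> S0"
    by (auto simp: bounded_iff)
  then have S0: "\<bar>prim h t\<bar> \<le> S0" if "t \<in> {\<alpha> - l2..\<beta> - l1}" for t using that by blast
  define S where "S = \<mu> * S0"
  \<comment> \<open>The bounds on the critical points are not strict; adding 1 makes them
    so.\<close>
  define \<rho> where "\<rho> = max (sqrt (2 * S / m)) (sqrt ((prim M (2 * S / m) + 2 * S) / m)) + 1"
  have S: "0 \<le> S" using \<mu> S0[of 0] l12 J_range[of 0] by (simp add: S_def J_0 \<alpha>_def \<beta>_def)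
  have "0 \<le> sqrt (2 * S / m)" using S m by simp
  then have \<rho>: "0 < \<rho>" unfolding \<rho>_def by linarith
  have "three_solutions M h \<mu> \<rho> l"
    if l: "l \<in> {l1<..<l2}" for l
  proof -
    have shift: "c - l \<in> {- \<omega><..<\<omega>}" "c - l \<in> {\<alpha> - l2..\<beta> - l1}" if "c \<in> {\<alpha>..\<beta>}" for c
      using that l l12 by (auto simp: \<omega>_eq)
    interpret KF: kirchhoff V B N conv J DJ M "prim M" "\<lambda>c. \<mu> * prim h (c - l)" "\<lambda>c. \<mu> * h (c - l)" \<alpha> \<beta> l S m
    proof unfold_locales
      show "\<exists>(r :: nat \<Rightarrow> nat) u. strict_mono r \<and> u \<in> V \<and> conv (\<lambda>k. X (r k)) u"
        if "\<And>k::nat. X k \<in> V" "\<And>k. N (X k) \<le> R" for X R using that by (rule V_compact)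
      show "N u \<le> R" if "\<And>k. X k \<in> V" "u \<in> V" "conv X u" "\<And>k. N (X k) \<le> R" for X u R
        by (rule V_closed(2)[of X]) (use that V_measurable in auto)
      show "conv X v" if "conv X u" "u \<in> V" "v \<in> V" "N (u - v) = 0" for X u v
        using that by (rule conv_null)
      show "(\<lambda>k. J (X k)) \<longlonglongrightarrow> J u" if "\<And>k. X k \<in> V" "u \<in> V" "conv X u" for X u
        using that by (rule J_conv)
      show "\<forall>\<^sub>F k in sequentially. \<forall>w\<in>V. \<bar>DJ (X k) w - DJ u w\<bar> \<le> d * N w"
        if "\<And>k. X k \<in> V" "u \<in> V" "conv X u" "\<And>k. N (X k) \<le> R" "d > 0" for X u R d
        using that by (rule DJ_conv)
      show "J u \<in> {\<alpha>..\<beta>}" if "u \<in> V" for u using J_range[OF that] by (simp add: \<alpha>_def \<beta>_def)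
      show "(prim M has_real_derivative M t) (at t within {0..})" if "0 \<le> t" for t
        using m(3) that by (rule prim_has_derivative_atLeast)
      show "((\<lambda>c. \<mu> * prim h (c - l)) has_real_derivative \<mu> * h (c - l)) (at c)" if "c \<in> {\<alpha>..\<beta>}" for c
      proof -
        have "((\<lambda>c. prim h (c - l)) has_real_derivative h (c - l) * 1) (at c)"
          by (rule DERIV_chain2[where f = "prim h" and g = "\<lambda>c. c - l", OF h_deriv[OF shift(1)[OF that]]])
             (auto intro!: derivative_eq_intros)
        then show ?thesis by (intro DERIV_cmult) simp
      qed
      show "continuous_on {\<alpha>..\<beta>} (\<lambda>c. \<mu> * h (c - l))"
        by (intro continuous_intros continuous_on_compose2[OF h(1)]) (use l l12 in \<open>auto simp: \<omega>_eq\<close>)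
      show "\<mu> * prim h (c - l) \<in> {0..S}" if "c \<in> {\<alpha>..\<beta>}" for c
        using h_nonneg[OF shift(1)[OF that]] S0[OF shift(2)[OF that]] \<mu> by (auto simp: S_def intro: mult_left_mono)
    qed (use m in \<open>auto intro: conv_const conv_subseq conv_diff DJ_add DJ_scale DJ_bound J_deriv\<close>)
    obtain u1 where u1: "u1 \<in> V" "J u1 < l" "\<Phi> l u1 < 0" using low[OF l] by blast
    obtain u2 where u2: "u2 \<in> V" "l < J u2" "\<Phi> l u2 < 0" using high[OF l] by blast
    have \<Phi>_eq: "KF.\<Phi> u = \<Phi> l u" for u by (simp add: KF.\<Phi>_def \<Phi>_def)
    obtain w1 w2 w3 where w: "w1 \<in> V" "w2 \<in> V" "w3 \<in> V"
      and crit: "N (KF.G w1) = 0" "N (KF.G w2) = 0" "N (KF.G w3) = 0"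
      and Jw: "J w1 < l" "l < J w2" and \<Phi>w: "\<Phi> l w1 < 0" "\<Phi> l w2 < 0" "0 \<le> \<Phi> l w3"
      and Nw: "N w1 \<le> sqrt (2 * S / m)" "N w2 \<le> sqrt (2 * S / m)" "N w3 \<le> sqrt ((prim M (2 * S / m) + 2 * S) / m)"
      using KF.three_critical_points[OF u1(1,2) _ u2(1,2)] u1(3) u2(3) unfolding \<Phi>_eq by blast
    have "weak_solution K \<Omega> f M h \<mu> l z" if "z \<in> V" "N (KF.G z) = 0" for z
      unfolding weak_solution_def
    proof (intro conjI ballI)
      fix v assume v: "v \<in> V"
      show "M ((N z)\<^sup>2) * set_lebesgue_integral lebesgue Q (\<lambda>(x, y). (z x - z y) * (v x - v y) * K (x - y))
        = \<mu> * h (J z - l) * (LINT x:\<Omega>|lebesgue. f x (z x) * v x)"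
        using KF.critical_point_equation[OF that v] by (simp only: B_def DJ_eq[OF that(1) v])
    qed (rule that)
    moreover have "N w1 < \<rho>" "N w2 < \<rho>" "N w3 < \<rho>" using Nw unfolding \<rho>_def by linarith+
    moreover have \<Phi>_cong: "\<Phi> l u = \<Phi> l v" if "u \<in> V" "v \<in> V" "AE x in lebesgue. u x = v x" for u v
      using J_AE_cong[OF that] N_AE_cong[OF that] by (simp add: \<Phi>_def)
    have "\<not> (AE x in lebesgue. w1 x = w2 x)" using J_AE_cong[OF w(1,2)] Jw by auto
    moreover have "\<not> (AE x in lebesgue. w1 x = w3 x)" using \<Phi>_cong[OF w(1,3)] \<Phi>w by auto
    moreover have "\<not> (AE x in lebesgue. w2 x = w3 x)" using \<Phi>_cong[OF w(2,3)] \<Phi>w by auto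
    ultimately show ?thesis
      unfolding three_solutions_def using w crit by (intro exI[of _ w1] exI[of _ w2] exI[of _ w3]) auto
  qed
  then show ?thesis using \<rho> by blast
qed

text \<open>The two functions of negative energy are \<open>0\<close> and \<open>u0\<close>. For
  \<open>u0\<close> the condition on \<mu> says that the energy is negative at \<open>l = 0\<close>,
  and continuity in \<open>l\<close> keeps it so nearby.\<close>

lemma solutions_near_zero:
  fixes M h :: "real \<Rightarrow> real" and \<mu> m :: real
  defines "\<alpha> \<equiv> alpha K \<Omega> f" and "\<beta> \<equiv> beta K \<Omega> f" and "\<omega> \<equiv> omega K \<Omega> f"
  assumes m: "m > 0" "\<And>t. t \<ge> 0 \<Longrightarrow> m \<le> M t" "continuous_on {0..} M"
    and h: "continuous_on {- \<omega><..<\<omega>} h" "mono_on {- \<omega><..<\<omega>} h"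
      "\<And>t. t \<in> {- \<omega><..<\<omega>} \<Longrightarrow> h t = 0 \<longleftrightarrow> t = 0"
    and u0: "u0 \<in> V" "J u0 \<in> {\<alpha><..<\<beta>} - {0}" and \<mu>: "prim M ((N u0)\<^sup>2) / (2 * prim h (J u0)) < \<mu>"
  shows "\<exists>l1 l2. l1 < l2 \<and> {l1<..<l2} \<subseteq> {\<alpha><..<\<beta>} \<and>
    (\<exists>\<rho>>0. \<forall>l\<in>{l1<..<l2}. three_solutions M h \<mu> \<rho> l)"
proof -
  have \<omega>_eq: "\<omega> = \<beta> - \<alpha>" by (simp add: \<omega>_def omega_def \<alpha>_def \<beta>_def)
  have \<alpha>\<beta>: "\<alpha> \<le> 0" "0 \<le> \<beta>" using J_range[of 0] by (auto simp: J_0 \<alpha>_def \<beta>_def)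
  define c where "c = J u0"
  have c: "\<alpha> < c" "c < \<beta>" "c \<noteq> 0" using u0(2) by (auto simp: c_def)
  have \<omega>: "0 < \<omega>" using c by (simp add: \<omega>_eq)
  have c_in: "c \<in> {- \<omega><..<\<omega>}" using c \<alpha>\<beta> by (auto simp: \<omega>_eq)
  have pos: "0 < prim h t" if "t \<in> {- \<omega><..<\<omega>}" "t \<noteq> 0" for t
    using prim_pos[OF h _ _ that] \<omega> by auto
  have prim_M_nonneg: "0 \<le> prim M t" if "0 \<le> t" for t
  proof -
    have "m * t \<le> prim M t"
      using derivative_lower_bound[OF prim_has_derivative_atLeast[OF m(3)] m(2) order_refl that] by simp
    moreover have "0 \<le> m * t" using m(1) that by simp
    ultimately show ?thesis by linarith
  qed
  \<comment> \<open>A nonnegative quotient lies below \<mu>, which makes \<mu> positive.\<close>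
  have "0 \<le> prim M ((N u0)\<^sup>2) / (2 * prim h (J u0))"
    using prim_M_nonneg[of "(N u0)\<^sup>2"] pos[OF c_in c(3)] by (simp add: c_def)
  then have \<mu>0: "0 < \<mu>" using \<mu> by linarith
  define \<Phi> where "\<Phi> l u = prim M ((N u)\<^sup>2) / 2 - \<mu> * prim h (J u - l)" for l u
  have neg0: "\<Phi> l 0 < 0" if "l \<in> {- \<omega><..<\<omega>}" "l \<noteq> 0" for l
    using pos[of "- l"] that \<mu>0 by (simp add: \<Phi>_def J_0)
  have "isCont (prim h) c"
    using \<omega> by (intro DERIV_isCont[OF prim_has_derivative[OF _ _ h(1) c_in]]) auto
  then have "((\<lambda>l. prim h (c - l)) \<longlongrightarrow> prim h c) (at 0)"
    by (rule isCont_tendsto_compose) (auto intro!: tendsto_eq_intros)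
  then have "((\<lambda>l. \<Phi> l u0) \<longlongrightarrow> prim M ((N u0)\<^sup>2) / 2 - \<mu> * prim h c) (at 0)"
    unfolding \<Phi>_def c_def[symmetric] by (intro tendsto_intros)
  moreover have "prim M ((N u0)\<^sup>2) / 2 - \<mu> * prim h c < 0"
    using \<mu> pos[OF c_in c(3)] by (simp add: pos_divide_less_eq c_def mult_ac)
  ultimately have "\<forall>\<^sub>F l in at 0. \<Phi> l u0 < 0" by (rule order_tendstoD)
  then obtain d where d: "d > 0" "\<And>l. l \<noteq> 0 \<Longrightarrow> \<bar>l\<bar> < d \<Longrightarrow> \<Phi> l u0 < 0"
    by (auto simp: eventually_at dist_real_def)
  have "\<exists>l1 l2. \<alpha> < l1 \<and> l1 < l2 \<and> l2 < \<beta> \<and>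
      (\<forall>l\<in>{l1<..<l2}. (\<exists>u\<in>V. J u < l \<and> \<Phi> l u < 0) \<and> (\<exists>u\<in>V. l < J u \<and> \<Phi> l u < 0))"
  proof (cases "0 < c")
    case True
    \<comment> \<open>The lower end \<open>r / 2\<close> keeps \<open>l\<close> away from 0: at 0
      the energy of the zero function vanishes, and \<alpha> may itself be 0.\<close>
    define r where "r = min d c"
    have r: "0 < r" "r \<le> d" "r \<le> c" using d True by (auto simp: r_def)
    have "J 0 < l \<and> \<Phi> l 0 < 0" "l < J u0 \<and> \<Phi> l u0 < 0" if "l \<in> {r / 2<..<r}" for l
      using neg0[of l] d(2)[of l] that r c \<alpha>\<beta> by (auto simp: J_0 \<omega>_eq simp flip: c_def)
    then show ?thesis using r \<alpha>\<beta> c u0 V_0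
      by (intro exI[of _ "r / 2"] exI[of _ r] conjI ballI) (auto intro: bexI[of _ 0] bexI[of _ u0])
  next
    case False
    define r where "r = min d (- c)"
    have r: "0 < r" "r \<le> d" "r \<le> - c" using d False c by (auto simp: r_def)
    have "l < J 0 \<and> \<Phi> l 0 < 0" "J u0 < l \<and> \<Phi> l u0 < 0" if "l \<in> {- r<..<- (r / 2)}" for l
      using neg0[of l] d(2)[of l] that r c \<alpha>\<beta> by (auto simp: J_0 \<omega>_eq simp flip: c_def)
    then show ?thesis using r \<alpha>\<beta> c u0 V_0
      by (intro exI[of _ "- r"] exI[of _ "- (r / 2)"] conjI ballI) (auto intro: bexI[of _ 0] bexI[of _ u0])
  qed
  then obtain l1 l2 where l12: "\<alpha> < l1" "l1 < l2" "l2 < \<beta>"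
    and low: "\<And>l. l \<in> {l1<..<l2} \<Longrightarrow> \<exists>u\<in>V. J u < l \<and> \<Phi> l u < 0"
    and high: "\<And>l. l \<in> {l1<..<l2} \<Longrightarrow> \<exists>u\<in>V. l < J u \<and> \<Phi> l u < 0" by blast
  have "\<exists>\<rho>>0. \<forall>l\<in>{l1<..<l2}. three_solutions M h \<mu> \<rho> l"
    by (rule solutions_on_interval[OF m h[unfolded \<omega>_def] less_imp_le[OF \<mu>0], folded \<alpha>_def \<beta>_def \<Phi>_def])
       (assumption | rule l12 | rule low, assumption | rule high, assumption)+
  then show ?thesis using l12 by (intro exI[of _ l1] exI[of _ l2]) auto
qed

end

lemma SUP_ereal_less_infinity:
  assumes "(SUP y\<in>A. ereal (g y)) < \<infinity>"
  obtains c where "0 \<le> c" "\<And>y. y \<in> A \<Longrightarrow> g y \<le> c"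
proof -
  obtain c where c: "(SUP y\<in>A. ereal (g y)) < ereal c" using ereal_dense2[OF assms] by blast
  have "g y \<le> max c 0" if "y \<in> A" for y
  proof -
    have "ereal (g y) \<le> (SUP y\<in>A. ereal (g y))" using that by (rule SUP_upper)
    also have "\<dots> < ereal c" by (rule c)
    finally show ?thesis by simp
  qed
  then show ?thesis using that[of "max c 0"] by simp
qed

theorem theorem3p1:
  fixes s \<mu> :: real
    and \<Omega> :: "(real^'n) set"
    and K :: "real^'n \<Rightarrow> real"
    and f :: "real^'n \<Rightarrow> real \<Rightarrow> real"
    and M h :: "real \<Rightarrow> real"
  assumes "0 < s" "s < 1" "real CARD('n) > 2 * s"
    and "open \<Omega>" "bounded \<Omega>" "lipschitz_boundary \<Omega>"
    and "\<And>x. x \<noteq> 0 \<Longrightarrow> K x > 0"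
    and "integrable lebesgue (\<lambda>x. min ((norm x)\<^sup>2) 1 * K x)"
    and "\<exists>b>0. \<forall>x. x \<noteq> 0 \<longrightarrow> K x \<ge> b * norm x powr (- (real CARD('n) + 2 * s))"
    and "\<And>x. x \<noteq> 0 \<Longrightarrow> K x = K (- x)"
    and "f \<in> class_A s \<Omega>"
    and "(SUP (x, \<xi>)\<in>\<Omega> \<times> UNIV. ereal \<bar>prim (f x) \<xi>\<bar>) < \<infinity>"
    and "(SUP u\<in>space_X0 K \<Omega>. ereal \<bar>potential \<Omega> f u\<bar>) > 0"
    and "M \<in> class_M"
    and "continuous_on {- omega K \<Omega> f<..<omega K \<Omega> f} h"
    and "mono_on {- omega K \<Omega> f<..<omega K \<Omega> f} h"
    and "{t \<in> {- omega K \<Omega> f<..<omega K \<Omega> f}. h t = 0} = {0}"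
    and "ereal \<mu> > (INF u\<in>R_set K \<Omega> f.
           ereal (prim M ((norm_X0 K \<Omega> u)\<^sup>2) / (2 * prim h (potential \<Omega> f u))))"
  shows "\<exists>a b. a < b \<and> {a<..<b} \<subseteq> {alpha K \<Omega> f<..<beta K \<Omega> f} \<and>
           (\<exists>\<rho>>0. \<forall>l\<in>{a<..<b}. \<exists>u v w.
              (\<forall>z\<in>{u, v, w}. weak_solution K \<Omega> f M h \<mu> l z \<and> norm_X0 K \<Omega> z < \<rho>) \<and>
              \<not> (AE x in lebesgue. u x = v x) \<and>
              \<not> (AE x in lebesgue. u x = w x) \<and>
              \<not> (AE x in lebesgue. v x = w x))"
proof -
  obtain b where b: "b > 0" "\<And>x. x \<noteq> 0 \<Longrightarrow> b * norm x powr (- (real CARD('n) + 2 * s)) \<le> K x"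
    using assms(9) by blast
  obtain q where cara: "caratheodory \<Omega> f" and q: "1 \<le> q" "q < 2 * real CARD('n) / (real CARD('n) - 2 * s)"
    and fin: "(SUP (x, t)\<in>\<Omega> \<times> UNIV. ereal (\<bar>f x t\<bar> / (1 + \<bar>t\<bar> powr (q - 1)))) < \<infinity>"
    using assms(11) by (auto simp: class_A_def)
  have "(SUP y\<in>\<Omega> \<times> UNIV. ereal (\<bar>f (fst y) (snd y)\<bar> / (1 + \<bar>snd y\<bar> powr (q - 1)))) < \<infinity>"
    using fin by (simp add: case_prod_beta)
  then obtain C where C: "0 \<le> C" "\<And>y. y \<in> \<Omega> \<times> UNIV \<Longrightarrow> \<bar>f (fst y) (snd y)\<bar> / (1 + \<bar>snd y\<bar> powr (q - 1)) \<le> C"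
    by (rule SUP_ereal_less_infinity) blast
  have growth: "\<bar>f x t\<bar> \<le> C * (1 + \<bar>t\<bar> powr (q - 1))" if "x \<in> \<Omega>" for x t
  proof -
    have "0 < 1 + \<bar>t\<bar> powr (q - 1)" by (simp add: add_pos_nonneg)
    then show ?thesis using C(2)[of "(x, t)"] that by (simp add: pos_divide_le_eq)
  qed
  have "(SUP y\<in>\<Omega> \<times> UNIV. ereal \<bar>prim (f (fst y)) (snd y)\<bar>) < \<infinity>"
    using assms(12) by (simp add: case_prod_beta)
  then obtain F0 where F0: "0 \<le> F0" "\<And>y. y \<in> \<Omega> \<times> UNIV \<Longrightarrow> \<bar>prim (f (fst y)) (snd y)\<bar> \<le> F0"
    by (rule SUP_ereal_less_infinity) blast
  interpret nonlocal_potential s b \<Omega> K f q C F0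
    by unfold_locales (use assms(1-8) b cara q C(1) growth F0 in auto)
  have M: "continuous_on {0..} M" "(INF t\<in>{0..}. ereal (M t)) > 0"
    using assms(14) by (auto simp: class_M_def)
  \<comment> \<open>The infimum is an extended real; a positive real below it serves as the lower
    bound of \<open>M\<close>.\<close>
  obtain m where m: "0 < ereal m" "ereal m < (INF t\<in>{0..}. ereal (M t))"
    using ereal_dense2[OF M(2)] by blast
  have M_ge: "m \<le> M t" if "0 \<le> t" for t
  proof -
    have "(INF t\<in>{0..}. ereal (M t)) \<le> ereal (M t)" using that by (intro INF_lower) simp
    then show ?thesis using m(2) by (simp add: less_le_trans less_imp_le flip: ereal_less_eq(3))
  qed
  have h0: "h t = 0 \<longleftrightarrow> t = 0" if "t \<in> {- omega K \<Omega> f<..<omega K \<Omega> f}" for t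
    using assms(17) that by (auto simp: set_eq_iff)
  \<comment> \<open>An infimum over the empty set would be \<infinity>, so the strict inequality
    provides an actual element.\<close>
  obtain u0 where u0: "u0 \<in> R_set K \<Omega> f" "prim M ((norm_X0 K \<Omega> u0)\<^sup>2) / (2 * prim h (potential \<Omega> f u0)) < \<mu>"
    using assms(18) by (auto simp: INF_less_iff)
  show ?thesis
    unfolding three_solutions_def[symmetric]
    by (rule solutions_near_zero[of m M h u0 \<mu>]) (use m M_ge M assms(15,16) h0 u0 in \<open>auto simp: R_set_def\<close>)
qed

end
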